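(* Let $n\ge 1$ be an integer, $s\in(0,1)$, $p\in(1,+\infty)$ and $a\in\left[0,\frac{n-sp}{2}\right)$. For any $u\in\dot{W}^{s,p}_a(\mathbb{R}^n)$ there exists a sequence of functions $u_\varepsilon\in C^\infty_0(\mathbb{R}^n)$ such that $\|u-u_\varepsilon\|_{\dot{W}^{s,p}_a(\mathbb{R}^n)}\to 0$ as $\varepsilon\to 0$. Namely, $C^\infty_0(\mathbb{R}^n)$ is dense in $\dot{W}^{s,p}_a(\mathbb{R}^n)$.
   Context: The assumption on $a$ forces $sp<n$. Put $p^*_s:=\frac{np}{n-sp}$. For measurable $u:\mathbb{R}^n\to\mathbb{R}$ define $$[u]_{\widetilde{W}^{s,p}_a(\mathbb{R}^n)}:=\left(\iint_{\mathbb{R}^{2n}}\frac{|u(x)-u(y)|^p}{|x-y|^{n+sp}}\,\frac{dx}{|x|^a}\,\frac{dy}{|y|^a}\right)^{1/p},\qquad \|u\|_{L^{p^*_s}_a(\mathbb{R}^n)}:=\left(\int_{\mathbb{R}^n}\frac{|u(x)|^{p^*_s}}{|x|^{2ap^*_s/p}}\,dx\right)^{1/p^*_s}.$$ $\widetilde{W}^{s,p}_a(\mathbb{R}^n)$ and $L^{p^*_s}_a(\mathbb{R}^n)$ are the sets of measurable $u:\mathbb{R}^n\to\mathbb{R}$ for which the first, respectively the second, quantity is finite. Set $\dot{W}^{s,p}_a(\mathbb{R}^n):=\widetilde{W}^{s,p}_a(\mathbb{R}^n)\cap L^{p^*_s}_a(\mathbb{R}^n)$, with norm $\|u\|_{\dot{W}^{s,p}_a(\mathbb{R}^n)}:=[u]_{\widetilde{W}^{s,p}_a(\mathbb{R}^n)}+\|u\|_{L^{p^*_s}_a(\mathbb{R}^n)}$.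 $C^\infty_0(\mathbb{R}^n)$ denotes the smooth real-valued functions on $\mathbb{R}^n$ with compact support. *)

theory Defs
  imports "HOL-Analysis.Analysis"
begin

primrec Ck :: "nat \<Rightarrow> (real ^ 'n \<Rightarrow> real) \<Rightarrow> bool" where
  "Ck 0 f \<longleftrightarrow> continuous_on UNIV f"
| "Ck (Suc k) f \<longleftrightarrow>
     (\<forall>x. f differentiable (at x)) \<and> (\<forall>v. Ck k (\<lambda>x. frechet_derivative f (at x) v))"

definition test_functions :: "(real ^ 'n \<Rightarrow> real) set" where
  "test_functions = {f. (\<forall>k. Ck k f) \<and> compact (closure {x. f x \<noteq> 0})}"

(* Powers of extended nonnegative reals, only used with r > 0. The norms below take the value
   \<infinity> when the integral diverges; enn2real alone would send \<infinity> to 0. *)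
definition ennpowr :: "ennreal \<Rightarrow> real \<Rightarrow> ennreal" where
  "ennpowr x r = (if x = \<infinity> then \<infinity> else ennreal (enn2real x powr r))"

definition crit_exp :: "nat \<Rightarrow> real \<Rightarrow> real \<Rightarrow> real" where
  "crit_exp n s p = real n * p / (real n - s * p)"

(* The conventions y / 0 = 0 and 0 powr r = 0 affect the integrands below only on the null sets
   x = 0, y = 0 and x = y. *)
definition gagliardo :: "real \<Rightarrow> real \<Rightarrow> real \<Rightarrow> (real ^ 'n \<Rightarrow> real) \<Rightarrow> ennreal" where
  "gagliardo s p a u =
     ennpowr (\<integral>\<^sup>+ (x, y).
         ennreal (\<bar>u x - u y\<bar> powr p / norm (x - y) powr (real CARD('n) + s * p)
                    * (1 / norm x powr a) * (1 / norm y powr a))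
       \<partial>(lebesgue \<Otimes>\<^sub>M lebesgue)) (1 / p)"

definition weighted_norm :: "real \<Rightarrow> real \<Rightarrow> real \<Rightarrow> (real ^ 'n \<Rightarrow> real) \<Rightarrow> ennreal" where
  "weighted_norm s p a u =
     (let q = crit_exp CARD('n) s p in
       ennpowr (\<integral>\<^sup>+ x. ennreal (\<bar>u x\<bar> powr q / norm x powr (2 * a * q / p)) \<partial>lebesgue) (1 / q))"

definition W_tilde :: "real \<Rightarrow> real \<Rightarrow> real \<Rightarrow> (real ^ 'n \<Rightarrow> real) set" where
  "W_tilde s p a = {u. u \<in> borel_measurable lebesgue \<and> gagliardo s p a u < \<infinity>}"

definition L_crit :: "real \<Rightarrow> real \<Rightarrow> real \<Rightarrow> (real ^ 'n \<Rightarrow> real) set" where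
  "L_crit s p a = {u. u \<in> borel_measurable lebesgue \<and> weighted_norm s p a u < \<infinity>}"

definition W_dot :: "real \<Rightarrow> real \<Rightarrow> real \<Rightarrow> (real ^ 'n \<Rightarrow> real) set" where
  "W_dot s p a = W_tilde s p a \<inter> L_crit s p a"

definition W_norm :: "real \<Rightarrow> real \<Rightarrow> real \<Rightarrow> (real ^ 'n \<Rightarrow> real) \<Rightarrow> ennreal" where
  "W_norm s p a u = gagliardo s p a u + weighted_norm s p a u"

end

theory Submission
  imports Defs
begin

text \<open>
  Replacing \<open>u\<close> by a Borel representative, one first truncates its values, which is harmless by dominated
  convergence. Next one multiplies by a cutoff that vanishes near the origin and near infinity. In the
  commutator term the smaller of \<open>|u x|\<close> and \<open>|u y|\<close> may be put in front of
  \<open>|\<eta> x - \<eta> y|\<close>; together with the monotonicity of the weights this bounds the term by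
  \<open>C R\<^bsup>-sp\<^esup> \<integral> |u|\<^bsup>p\<^esup> |x|\<^bsup>-2a\<^esup>\<close> over the ball of radius \<open>2 R\<close>. This vanishes as \<open>R \<rightarrow> 0\<close> because
  \<open>u\<close> is bounded and \<open>2 a < n - s p\<close>, and as \<open>R \<rightarrow> \<infinity>\<close> because \<open>u\<close> lies in the critical weighted
  Lebesgue space. For a bounded function supported in an annulus, translation is continuous in both
  seminorms: close to the diagonal the weights are comparable to constants, and far from it everything
  reduces to translation continuity in \<open>L\<^sup>1\<close>. By Jensen's inequality mollification then converges.
\<close>

section \<open>Integrals of powers, translations and means\<close>

text \<open>Two difficulties shape the argument. The weights are singular at the origin and not
  translation invariant, so a shift may carry the mass of a function towards the singularity; a
  function that vanishes near the origin is safe from this, and that is why a cutoff at the origin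
  precedes mollification. The cutoff at infinity is scale critical: for the critical exponent,
  Hoelder's inequality on a ball of radius \<open>2 * R\<close> produces exactly the factor
  \<open>R powr (s * p)\<close> that cancels \<open>R powr (- (s * p))\<close>. This alone gives
  boundedness, and smallness has to come from the tail of the critical integral. The estimates
  concern the \<open>p\<close>-th and \<open>q\<close>-th powers of the two seminorms, as extended
  nonnegative integrals of Borel functions. Since only three approximations are composed, a triangle
  inequality up to the constants \<open>2 powr p\<close> and \<open>2 powr q\<close> is enough.
  Roots and Lebesgue measurable representatives enter at the very end.\<close>

lemma powr_add_le:
  fixes x y p :: real
  assumes "0 \<le> x" "0 \<le> y" "0 \<le> p"
  shows "(x + y) powr p \<le> 2 powr p * (x powr p + y powr p)"
proof -
  have "(x + y) powr p \<le> (2 * max x y) powr p"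
    using assms by (intro powr_mono2) auto
  also have "\<dots> = 2 powr p * max x y powr p"
    using assms by (simp add: powr_mult)
  also have "max x y powr p \<le> x powr p + y powr p"
    by (auto simp: max_def)
  finally show ?thesis by simp
qed

lemma nn_integral_lborel_translate:
  fixes c :: "'a::euclidean_space"
  assumes [measurable]: "f \<in> borel_measurable borel"
  shows "(\<integral>\<^sup>+x. f (c + x) \<partial>lborel) = (\<integral>\<^sup>+x. f x \<partial>lborel)"
proof -
  have "(\<integral>\<^sup>+x. f x \<partial>lborel) = (\<integral>\<^sup>+x. f x \<partial>distr lborel borel ((+) c))"
    by (simp add: lborel_distr_plus)
  also have "\<dots> = (\<integral>\<^sup>+x. f (c + x) \<partial>lborel)"
    by (subst nn_integral_distr) auto
  finally show ?thesis ..
qed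

lemma lborel_distr_reflect:
  fixes c :: "'a::euclidean_space"
  shows "distr lborel borel (\<lambda>x. c - x) = lborel"
  using lborel_affine[of "-1" c] by (simp add: density_1)

lemma nn_integral_lborel_reflect:
  fixes c :: "'a::euclidean_space"
  assumes [measurable]: "f \<in> borel_measurable borel"
  shows "(\<integral>\<^sup>+x. f (c - x) \<partial>lborel) = (\<integral>\<^sup>+x. f x \<partial>lborel)"
proof -
  have "(\<integral>\<^sup>+x. f x \<partial>lborel) = (\<integral>\<^sup>+x. f x \<partial>distr lborel borel (\<lambda>x. c - x))"
    by (simp add: lborel_distr_reflect)
  also have "\<dots> = (\<integral>\<^sup>+x. f (c - x) \<partial>lborel)"
    by (subst nn_integral_distr) auto
  finally show ?thesis ..
qed

section \<open>Powers of the norm integrated over balls and over their complements\<close>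

lemma inverse_powr_comparable:
  fixes x \<rho> c :: real
  assumes "0 < \<rho>" "\<rho> \<le> x" "x \<le> 2 * \<rho>"
  shows "1 / x powr c \<le> 2 powr \<bar>c\<bar> * \<rho> powr (- c)"
proof (cases "c \<ge> 0")
  case True
  have "1 / x powr c \<le> 1 / \<rho> powr c"
    using assms True by (intro divide_left_mono powr_mono2 mult_pos_pos) auto
  also have "\<dots> = 1 * \<rho> powr (- c)" by (simp add: powr_minus_divide)
  also have "\<dots> \<le> 2 powr \<bar>c\<bar> * \<rho> powr (- c)"
    by (intro mult_right_mono ge_one_powr_ge_zero) auto
  finally show ?thesis .
next
  case False
  \<comment> \<open>Negative exponents do occur: \<open>profile_integral\<close> integrates with the
    exponent \<open>N + s * p - p\<close>, which is negative for large \<open>p\<close>.\<close>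
  have "1 / x powr c = x powr (- c)" by (simp add: powr_minus_divide)
  also have "\<dots> \<le> (2 * \<rho>) powr (- c)"
    using assms False by (intro powr_mono2) auto
  also have "\<dots> = 2 powr \<bar>c\<bar> * \<rho> powr (- c)"
    using assms False by (simp add: powr_mult)
  finally show ?thesis .
qed

text \<open>Shells take the place of polar coordinates. On the shell of radius
  \<open>r * t ^ k\<close> the integrand is comparable to a constant, and the shell lies in a ball
  of twice that radius, so it contributes at most a constant times
  \<open>(r * t ^ k) powr (DIM('a) - c)\<close>; \<open>t1\<close> says that these bounds form a
  convergent geometric series. The ratio \<open>t = 1/2\<close> covers neighbourhoods of the origin,
  \<open>t = 2\<close> complements of balls.\<close>

lemma nn_integral_norm_powr_dyadic:
  fixes c t :: real
  assumes t: "0 < t" and t1: "t powr (real DIM('a::euclidean_space) - c) < 1"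
  obtains C where "0 \<le> C"
    "\<And>r A. 0 < r \<Longrightarrow> (\<And>x::'a. x \<in> A \<Longrightarrow> \<exists>k. r * t ^ k \<le> norm x \<and> norm x < 2 * (r * t ^ k)) \<Longrightarrow>
      (\<integral>\<^sup>+x. ennreal (1 / norm (x::'a) powr c) * indicator A x \<partial>lborel) \<le> ennreal (C * r powr (real DIM('a) - c))"
proof -
  let ?n = "DIM('a)"
  let ?d = "real ?n - c"
  \<comment> \<open>The factors are the distortion of the power on a shell, the volume of a ball of
    radius 2, and the sum of the geometric series.\<close>
  define C where "C = 2 powr \<bar>c\<bar> * (unit_ball_vol (real ?n) * 2 ^ ?n) * (1 / (1 - t powr ?d))"
  have C: "0 \<le> C" using t1 by (auto simp: C_def)
  show ?thesis
  proof (rule that[OF C])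
    fix r :: real and A :: "'a set"
    assume r: "0 < r" and A: "\<And>x. x \<in> A \<Longrightarrow> \<exists>k. r * t ^ k \<le> norm x \<and> norm x < 2 * (r * t ^ k)"
    define \<rho> where "\<rho> k = r * t ^ k" for k
    have \<rho>: "0 < \<rho> k" for k using r t by (auto simp: \<rho>_def)
    have \<rho>d: "\<rho> k powr ?d = r powr ?d * (t powr ?d) ^ k" for k
    proof -
      have "(t ^ k) powr ?d = (t powr real k) powr ?d" using t by (simp add: powr_realpow)
      also have "\<dots> = (t powr ?d) powr real k" by (simp add: powr_powr mult.commute)
      also have "\<dots> = (t powr ?d) ^ k" using t by (intro powr_realpow) simp
      finally show ?thesis using r t by (simp add: \<rho>_def powr_mult)
    qed
    let ?g = "\<lambda>k x. ennreal (2 powr \<bar>c\<bar> * \<rho> k powr (- c)) * indicator (ball (0::'a) (2 * \<rho> k)) x"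
    have term_le: "h k \<le> suminf h" for h :: "nat \<Rightarrow> ennreal" and k
      using sum_le_suminf[of h "{k}"] by simp
    \<comment> \<open>The balls overlap, but their sum only has to be a majorant; one shell through
      each point of \<open>A\<close> suffices.\<close>
    have le: "ennreal (1 / norm x powr c) * indicator A x \<le> (\<Sum>k. ?g k x)" for x
    proof (cases "x \<in> A")
      case True
      then obtain k where k: "\<rho> k \<le> norm x" "norm x < 2 * \<rho> k"
        using A by (auto simp: \<rho>_def)
      have "ennreal (1 / norm x powr c) \<le> ennreal (2 powr \<bar>c\<bar> * \<rho> k powr (- c))"
        using k \<rho> by (intro ennreal_leI inverse_powr_comparable) auto
      also have "\<dots> = ?g k x" using k by simp
      also have "\<dots> \<le> (\<Sum>k. ?g k x)"
        by (rule term_le[of "\<lambda>k. ?g k x"])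
      finally show ?thesis using True by simp
    qed simp
    have "(\<integral>\<^sup>+x. ennreal (1 / norm x powr c) * indicator A x \<partial>lborel) \<le> (\<integral>\<^sup>+x. (\<Sum>k. ?g k x) \<partial>lborel)"
      by (intro nn_integral_mono le)
    also have "\<dots> = (\<Sum>k. (\<integral>\<^sup>+x. ?g k x \<partial>lborel))"
      by (intro nn_integral_suminf borel_measurable_times_ennreal borel_measurable_const borel_measurable_indicator)
        (simp only: sets_lborel borel_open[OF open_ball])
    also have "\<dots> = (\<Sum>k. ennreal (2 powr \<bar>c\<bar> * (unit_ball_vol (real ?n) * 2 ^ ?n) * r powr ?d * (t powr ?d) ^ k))"
    proof (rule suminf_cong)
      fix k
      have "\<rho> k ^ ?n = \<rho> k powr real ?n"
        using \<rho>[of k] by (rule powr_realpow[symmetric])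
      then have "\<rho> k powr (- c) * \<rho> k ^ ?n = \<rho> k powr ?d"
        by (simp add: powr_add[symmetric])
      then have eq: "(2 powr \<bar>c\<bar> * \<rho> k powr (- c)) * (unit_ball_vol (real ?n) * (2 * \<rho> k) ^ ?n) =
          2 powr \<bar>c\<bar> * (unit_ball_vol (real ?n) * 2 ^ ?n) * r powr ?d * (t powr ?d) ^ k"
        by (simp add: power_mult_distrib \<rho>d[symmetric] mult.assoc)
      have "(\<integral>\<^sup>+x. ?g k x \<partial>lborel) = ennreal (2 powr \<bar>c\<bar> * \<rho> k powr (- c)) * ennreal (unit_ball_vol (real ?n) * (2 * \<rho> k) ^ ?n)"
        using \<rho>[of k] by (subst nn_integral_cmult_indicator) (auto simp: emeasure_ball)
      also have "\<dots> = ennreal ((2 powr \<bar>c\<bar> * \<rho> k powr (- c)) * (unit_ball_vol (real ?n) * (2 * \<rho> k) ^ ?n))"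
        by (rule ennreal_mult'[symmetric]) simp
      also have "\<dots> = ennreal (2 powr \<bar>c\<bar> * (unit_ball_vol (real ?n) * 2 ^ ?n) * r powr ?d * (t powr ?d) ^ k)"
        by (simp only: eq)
      finally show "(\<integral>\<^sup>+x. ?g k x \<partial>lborel) = ennreal (2 powr \<bar>c\<bar> * (unit_ball_vol (real ?n) * 2 ^ ?n) * r powr ?d * (t powr ?d) ^ k)" .
    qed
    also have "\<dots> = ennreal (C * r powr ?d)"
    proof (rule suminf_ennreal_eq)
      have "(\<lambda>k. (t powr ?d) ^ k) sums (1 / (1 - t powr ?d))"
        using t1 by (intro geometric_sums) auto
      from sums_mult[OF this, of "2 powr \<bar>c\<bar> * (unit_ball_vol (real ?n) * 2 ^ ?n) * r powr ?d"]
      show "(\<lambda>k. 2 powr \<bar>c\<bar> * (unit_ball_vol (real ?n) * 2 ^ ?n) * r powr ?d * (t powr ?d) ^ k) sums (C * r powr ?d)"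
        by (simp add: C_def algebra_simps)
    qed auto
    finally show "(\<integral>\<^sup>+x. ennreal (1 / norm x powr c) * indicator A x \<partial>lborel) \<le> ennreal (C * r powr ?d)" .
  qed
qed

lemma nn_integral_norm_powr_near:
  fixes c :: real
  assumes "c < real DIM('a::euclidean_space)"
  obtains C where "0 \<le> C"
    "\<And>r. 0 < r \<Longrightarrow> (\<integral>\<^sup>+x. ennreal (1 / norm (x::'a) powr c) * indicator {x. norm x < r} x \<partial>lborel)
        \<le> ennreal (C * r powr (real DIM('a) - c))"
proof -
  let ?d = "real DIM('a) - c"
  have "(1/2::real) powr ?d < 1 powr ?d" using assms by (intro powr_less_mono2) auto
  then obtain C where C: "0 \<le> C"
    "\<And>r A. 0 < r \<Longrightarrow> (\<And>x::'a. x \<in> A \<Longrightarrow> \<exists>k. r * (1/2) ^ k \<le> norm x \<and> norm x < 2 * (r * (1/2) ^ k)) \<Longrightarrow>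
      (\<integral>\<^sup>+x. ennreal (1 / norm (x::'a) powr c) * indicator A x \<partial>lborel) \<le> ennreal (C * r powr ?d)"
    using nn_integral_norm_powr_dyadic[of "1/2" c, where 'a='a] by auto
  show ?thesis
  proof (rule that[OF C(1)])
    fix r :: real assume r: "0 < r"
    \<comment> \<open>The origin lies in no shell and can be removed, because there
      \<open>0 powr c = 0\<close> and hence \<open>1 / norm x powr c = 0\<close>.\<close>
    have "(\<integral>\<^sup>+x. ennreal (1 / norm (x::'a) powr c) * indicator {x. norm x < r} x \<partial>lborel) =
          (\<integral>\<^sup>+x. ennreal (1 / norm (x::'a) powr c) * indicator {x. 0 < norm x \<and> norm x < r} x \<partial>lborel)"
      by (intro nn_integral_cong) (auto simp: indicator_def)
    also have "\<dots> \<le> ennreal (C * r powr ?d)"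
    proof (intro C(2)[OF r])
      fix x :: 'a assume "x \<in> {x. 0 < norm x \<and> norm x < r}"
      then have x: "0 < norm x" "norm x < r" by auto
      \<comment> \<open>The first radius that does not exceed \<open>norm x\<close>. The preceding
        radius does exceed it, which is the upper bound, and there is a preceding one because
        \<open>norm x < r\<close>.\<close>
      define k where "k = (LEAST k. r * (1/2) ^ k \<le> norm x)"
      have "\<exists>k. (1/2::real) ^ k < norm x / r"
        using x r by (intro real_arch_pow_inv) auto
      then obtain j where "r * (1/2::real) ^ j \<le> norm x"
        using r by (auto simp: field_simps intro: less_imp_le)
      then have k: "r * (1/2) ^ k \<le> norm x" unfolding k_def by (rule LeastI)
      have "k \<noteq> 0" using k x by (auto intro: gr0I)
      then obtain m where m: "k = Suc m" by (cases k) auto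
      have "\<not> r * (1/2) ^ m \<le> norm x"
        using not_less_Least[of m "\<lambda>k. r * (1/2) ^ k \<le> norm x"] m by (auto simp: k_def)
      then show "\<exists>k. r * (1/2) ^ k \<le> norm x \<and> norm x < 2 * (r * (1/2) ^ k)"
        using k m by (intro exI[of _ k]) auto
    qed
    finally show "(\<integral>\<^sup>+x. ennreal (1 / norm (x::'a) powr c) * indicator {x. norm x < r} x \<partial>lborel) \<le> ennreal (C * r powr ?d)" .
  qed
qed

lemma nn_integral_norm_powr_far:
  fixes c :: real
  assumes "real DIM('a::euclidean_space) < c"
  obtains C where "0 \<le> C"
    "\<And>r. 0 < r \<Longrightarrow> (\<integral>\<^sup>+x. ennreal (1 / norm (x::'a) powr c) * indicator {x. r \<le> norm x} x \<partial>lborel)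
        \<le> ennreal (C * r powr (real DIM('a) - c))"
proof -
  let ?d = "real DIM('a) - c"
  have "(2::real) powr ?d < 2 powr 0" using assms by (intro powr_less_mono) auto
  then obtain C where C: "0 \<le> C"
    "\<And>r A. 0 < r \<Longrightarrow> (\<And>x::'a. x \<in> A \<Longrightarrow> \<exists>k. r * 2 ^ k \<le> norm x \<and> norm x < 2 * (r * 2 ^ k)) \<Longrightarrow>
      (\<integral>\<^sup>+x. ennreal (1 / norm (x::'a) powr c) * indicator A x \<partial>lborel) \<le> ennreal (C * r powr ?d)"
    using nn_integral_norm_powr_dyadic[of 2 c, where 'a='a] by auto
  show ?thesis
  proof (rule that[OF C(1)], intro C(2))
    fix r :: real and x :: 'a assume r: "0 < r" and "x \<in> {x. r \<le> norm x}"
    then have x: "r \<le> norm x" by auto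
    \<comment> \<open>Here the least index bounds \<open>norm x\<close> from above, so the shell is
      indexed by its predecessor \<open>m\<close>.\<close>
    define k where "k = (LEAST k. norm x < r * 2 ^ k)"
    have "\<exists>k. norm x / r < (2::real) ^ k" by (intro real_arch_pow) auto
    then obtain j where "norm x < r * (2::real) ^ j"
      using r by (auto simp: field_simps)
    then have k: "norm x < r * 2 ^ k" unfolding k_def by (rule LeastI)
    have "k \<noteq> 0" using k x by (auto intro: gr0I)
    then obtain m where m: "k = Suc m" by (cases k) auto
    have "\<not> norm x < r * 2 ^ m"
      using not_less_Least[of m "\<lambda>k. norm x < r * 2 ^ k"] m by (auto simp: k_def)
    then show "\<exists>k. r * 2 ^ k \<le> norm x \<and> norm x < 2 * (r * 2 ^ k)"
      using k m by (intro exI[of _ m]) auto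
  qed
qed

text \<open>Jensen's inequality for the power function and the probability density \<open>w\<close>.
  The part of the supporting line at the mean \<open>m\<close> is played by Young's inequality for
  \<open>\<bar>f x\<bar>\<close> and \<open>m powr (p - 1)\<close>. The bound on \<open>f\<close>
  makes both moments finite, so that terms may be subtracted.\<close>

lemma powr_integral_mean_le:
  fixes w f :: "'a \<Rightarrow> real"
  assumes p: "1 < p" and [measurable]: "w \<in> borel_measurable M" "f \<in> borel_measurable M"
    and w: "\<And>x. 0 \<le> w x" "(\<integral>\<^sup>+x. ennreal (w x) \<partial>M) = 1"
    and f: "\<And>x. \<bar>f x\<bar> \<le> B"
  shows "ennreal (\<bar>\<integral>x. w x * f x \<partial>M\<bar> powr p) \<le> (\<integral>\<^sup>+x. ennreal (w x) * ennreal (\<bar>f x\<bar> powr p) \<partial>M)"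
proof -
  have wi: "integrable M w" "(\<integral>x. w x \<partial>M) = 1"
    using w integral_eq_nn_integral[of w M] by (auto intro!: integrableI_nonneg)
  have int: "integrable M (\<lambda>x. w x * g x)" if [measurable]: "g \<in> borel_measurable M" and g: "\<And>x. \<bar>g x\<bar> \<le> D" for g D
  proof (rule Bochner_Integration.integrable_bound[of M "\<lambda>x. D * w x"])
    show "AE x in M. norm (w x * g x) \<le> norm (D * w x)"
    proof (intro AE_I2)
      fix x
      have "w x * \<bar>g x\<bar> \<le> w x * \<bar>D\<bar>"
        using g[of x] w(1) by (intro mult_left_mono) auto
      then show "norm (w x * g x) \<le> norm (D * w x)"
        using w(1)[of x] by (simp only: real_norm_def abs_mult abs_of_nonneg mult.commute[of D "w x"] mult.commute[of "\<bar>D\<bar>" "w x"])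
    qed
  qed (use wi(1) in simp_all)
  define m where "m = (\<integral>x. w x * \<bar>f x\<bar> \<partial>M)"
  have i1: "integrable M (\<lambda>x. w x * \<bar>f x\<bar>)" using f by (intro int[of _ B]) auto
  have i2: "integrable M (\<lambda>x. w x * \<bar>f x\<bar> powr p)"
    using f p by (intro int[of _ "B powr p"]) (auto intro!: powr_mono2)
  have m0: "0 \<le> m" unfolding m_def using w by (intro integral_nonneg_AE) auto
  have "m powr p \<le> (\<integral>x. w x * \<bar>f x\<bar> powr p \<partial>M)"
  proof -
    define q where "q = p / (p - 1)"
    have q: "1 < q" "1 / p + 1 / q = 1" using p by (auto simp: q_def field_simps)
    have young: "w x * \<bar>f x\<bar> * m powr (p - 1) \<le> w x * \<bar>f x\<bar> powr p / p + (1 - 1/p) * m powr p * w x" for x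
    proof -
      have "\<bar>f x\<bar> * m powr (p - 1) \<le> \<bar>f x\<bar> powr p / p + (m powr (p - 1)) powr q / q"
        using p q by (intro Youngs_inequality) auto
      also have "(m powr (p - 1)) powr q / q = (1 - 1/p) * m powr p"
      proof -
        have "(p - 1) * q = p" "1 / q = 1 - 1 / p" using p by (auto simp: q_def field_simps)
        then show ?thesis by (simp only: powr_powr) (simp add: divide_inverse)
      qed
      finally have "w x * (\<bar>f x\<bar> * m powr (p - 1)) \<le> w x * (\<bar>f x\<bar> powr p / p + (1 - 1/p) * m powr p)"
        using w by (intro mult_left_mono) auto
      then show ?thesis by (simp add: algebra_simps)
    qed
    have "m * m powr (p - 1) = (\<integral>x. w x * \<bar>f x\<bar> * m powr (p - 1) \<partial>M)"
      using i1 by (simp add: m_def)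
    also have "\<dots> \<le> (\<integral>x. w x * \<bar>f x\<bar> powr p / p + (1 - 1/p) * m powr p * w x \<partial>M)"
      by (intro integral_mono young Bochner_Integration.integrable_add integrable_mult_left
          integrable_mult_right integrable_divide_zero i1 i2 wi(1))
    also have "\<dots> = (\<integral>x. w x * \<bar>f x\<bar> powr p \<partial>M) / p + (1 - 1/p) * m powr p"
      using i2 wi by simp
    finally have "m powr p \<le> (\<integral>x. w x * \<bar>f x\<bar> powr p \<partial>M) / p + (1 - 1/p) * m powr p"
      using m0 p by (cases "m = 0") (auto simp: powr_diff)
    \<comment> \<open>The share \<open>(1 - 1/p) * m powr p\<close> is absorbed on the left, which
      leaves a factor \<open>1 / p\<close> on both sides.\<close>
    then have "m powr p / p \<le> (\<integral>x. w x * \<bar>f x\<bar> powr p \<partial>M) / p" using p by (simp add: field_simps)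
    then show ?thesis using p by (simp add: divide_le_cancel)
  qed
  moreover have le_m: "\<bar>\<integral>x. w x * f x \<partial>M\<bar> \<le> m"
    using integral_norm_bound[of M "\<lambda>x. w x * f x"] w by (simp add: m_def abs_mult)
  ultimately have "\<bar>\<integral>x. w x * f x \<partial>M\<bar> powr p \<le> (\<integral>x. w x * \<bar>f x\<bar> powr p \<partial>M)"
    using powr_mono2[OF _ _ le_m, of p] p by simp
  then have "ennreal (\<bar>\<integral>x. w x * f x \<partial>M\<bar> powr p) \<le> ennreal (\<integral>x. w x * \<bar>f x\<bar> powr p \<partial>M)"
    by (rule ennreal_leI)
  also have "\<dots> = (\<integral>\<^sup>+x. ennreal (w x * \<bar>f x\<bar> powr p) \<partial>M)"
    using i2 w by (subst nn_integral_eq_integral) auto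
  finally show ?thesis using w by (simp add: ennreal_mult)
qed

section \<open>Limits, iterated integrals and a threshold form of Young's inequality\<close>

lemma tendsto_ennreal_zero_le:
  fixes f g :: "'a \<Rightarrow> ennreal"
  assumes "(g \<longlongrightarrow> 0) F" and le: "\<And>k. f k \<le> g k"
  shows "(f \<longlongrightarrow> 0) F"
proof (rule order_tendstoI)
  fix y :: ennreal assume "0 < y"
  with assms(1) have "eventually (\<lambda>k. g k < y) F" by (rule order_tendstoD)
  then show "eventually (\<lambda>k. f k < y) F"
    by eventually_elim (rule le_less_trans[OF le])
qed simp

lemma lborel_pair_integral_iterated:
  fixes f :: "'a::euclidean_space \<Rightarrow> 'b::euclidean_space \<Rightarrow> ennreal"
  assumes "(\<lambda>z. f (fst z) (snd z)) \<in> borel_measurable (lborel \<Otimes>\<^sub>M lborel)"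
  shows "(\<integral>\<^sup>+z. f (fst z) (snd z) \<partial>(lborel \<Otimes>\<^sub>M lborel)) = (\<integral>\<^sup>+x. \<integral>\<^sup>+y. f x y \<partial>lborel \<partial>lborel)"
  using lborel.nn_integral_fst[OF assms] by simp

text \<open>An integrand with exchanged variables leads to the same iterated integral as the
  original one; this turns a symmetrised bound into twice a single integral.\<close>

lemma lborel_pair_integral_iterated_swap:
  fixes f :: "'b::euclidean_space \<Rightarrow> 'a::euclidean_space \<Rightarrow> ennreal"
  assumes "(\<lambda>z. f (snd z) (fst z)) \<in> borel_measurable (lborel \<Otimes>\<^sub>M lborel)"
  shows "(\<integral>\<^sup>+z. f (snd z) (fst z) \<partial>(lborel \<Otimes>\<^sub>M lborel)) = (\<integral>\<^sup>+x. \<integral>\<^sup>+y. f x y \<partial>lborel \<partial>lborel)"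
  using lborel_pair.nn_integral_snd[OF assms] by simp

text \<open>Above the threshold, \<open>f powr (1 - r)\<close> is at most
  \<open>t powr (1 - r)\<close>, since the exponent is not positive. The freedom in \<open>t\<close>
  makes this a substitute for Hoelder's inequality on balls.\<close>

lemma young_threshold:
  fixes f t r :: real
  assumes "0 \<le> f" "0 < t" "1 \<le> r"
  shows "f \<le> t + t powr (1 - r) * f powr r"
proof (cases "f \<le> t")
  case True
  moreover have "0 \<le> t powr (1 - r) * f powr r" by simp
  ultimately show ?thesis by linarith
next
  case False
  then have f: "0 < f" using assms by simp
  have "f = f powr (1 - r) * f powr r" using f by (simp add: powr_add[symmetric])
  also have "\<dots> \<le> t powr (1 - r) * f powr r"
    using False assms f by (intro mult_right_mono powr_mono2') auto
  finally show ?thesis using assms by linarith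
qed

section \<open>Continuity of translations in weighted Lebesgue spaces\<close>

text \<open>Measurability provides continuous functions that converge to \<open>v\<close> almost
  everywhere. Clipped and cut off, they are dominated by a multiple of the indicator of a ball, so
  one of them is close to \<open>v\<close> in \<open>L^1\<close>, and its uniform continuity takes
  care of the shift.\<close>

lemma nn_integral_translate_diff_small:
  fixes v :: "'a::euclidean_space \<Rightarrow> real"
  assumes v[measurable]: "v \<in> borel_measurable borel"
    and M: "\<And>x. \<bar>v x\<bar> \<le> M" and R: "0 < R" "\<And>x. R \<le> norm x \<Longrightarrow> v x = 0"
    and e: "0 < e"
  obtains d where "0 < d"
    "\<And>z. norm z < d \<Longrightarrow> (\<integral>\<^sup>+x. ennreal \<bar>v (x - z) - v x\<bar> \<partial>lborel) \<le> ennreal e"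
proof -
  have M0: "0 \<le> M" using M[of 0] by linarith
  have "v \<in> borel_measurable lebesgue" using v by (simp add: measurable_completion)
  then have "v measurable_on UNIV"
    by (rule lebesgue_measurable_imp_measurable_on_real) simp
  then obtain N g where N: "negligible N" and g: "\<And>n. continuous_on UNIV (g n)"
    and lim: "\<And>x. x \<notin> N \<Longrightarrow> (\<lambda>n. g n x) \<longlonglongrightarrow> v x"
    unfolding measurable_on_def by auto
  \<comment> \<open>Neither operation changes the limit: \<open>v\<close> has values in
    \<open>[-M, M]\<close>, and the cutoff is 1 on the ball of radius \<open>R\<close>, outside of
    which \<open>v\<close> vanishes.\<close>
  define h where "h n x = max (- M) (min M (g n x)) * max 0 (min 1 (2 - norm x / R))" for n :: nat and x
  have h: "continuous_on UNIV (h n)" for n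
    unfolding h_def using g R by (intro continuous_intros) auto
  then have [measurable]: "h n \<in> borel_measurable borel" for n
    by (rule borel_measurable_continuous_onI)
  have h0: "h n x = 0" if "2 * R \<le> norm x" for n x
  proof -
    have "2 - norm x / R \<le> 0" using that R by (simp add: field_simps)
    then show ?thesis by (simp add: h_def)
  qed
  have hM: "\<bar>h n x\<bar> \<le> M" for n x
  proof -
    have "\<bar>h n x\<bar> \<le> M * 1"
      unfolding h_def abs_mult using M0 by (intro mult_mono) auto
    then show ?thesis by simp
  qed
  have hlim: "(\<lambda>n. h n x) \<longlonglongrightarrow> v x" if "x \<notin> N" for x
  proof -
    have "(\<lambda>n. h n x) \<longlonglongrightarrow> max (- M) (min M (v x)) * max 0 (min 1 (2 - norm x / R))"
      unfolding h_def by (intro tendsto_intros lim that)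
    moreover have "max (- M) (min M (v x)) = v x" using M[of x] by auto
    moreover have "v x * max 0 (min 1 (2 - norm x / R)) = v x"
    proof (cases "R \<le> norm x")
      case False
      then have "norm x / R \<le> 1" using R by simp
      then show ?thesis by simp
    qed (simp add: R)
    ultimately show ?thesis by simp
  qed
  have hb: "norm (h n x) \<le> M * indicator (cball 0 (2 * R)) x" for n x
  proof (cases "norm x \<le> 2 * R")
    case True
    then show ?thesis using hM[of n x] by simp
  next
    case False
    then show ?thesis using h0[of x n] by simp
  qed
  have "(\<lambda>n. \<integral>\<^sup>+x. norm (v x - h n x) \<partial>lborel) \<longlonglongrightarrow> 0"
  proof (rule nn_integral_dominated_convergence_norm[where w="\<lambda>x. M * indicator (cball 0 (2 * R)) x"])
    have "(\<integral>\<^sup>+x. ennreal (M * indicator (cball 0 (2 * R)) (x::'a)) \<partial>lborel) =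
       (\<integral>\<^sup>+x. ennreal M * indicator (cball 0 (2 * R)) (x::'a) \<partial>lborel)"
      by (intro nn_integral_cong) (auto simp: indicator_def)
    also have "\<dots> = ennreal M * emeasure lborel (cball (0::'a) (2 * R))"
      by (rule nn_integral_cmult_indicator) simp
    also have "\<dots> < \<infinity>"
      using emeasure_lborel_cball_finite[of "0::'a" "2 * R"] by (simp add: ennreal_mult_less_top)
    finally show "(\<integral>\<^sup>+x. ennreal (M * indicator (cball 0 (2 * R)) (x::'a)) \<partial>lborel) < \<infinity>" .
    have "AE x in lebesgue. x \<notin> N" using N by (simp add: AE_not_in negligible_iff_null_sets)
    then have "AE x in lborel. x \<notin> N" by (simp add: AE_completion_iff)
    then show "AE x in lborel. (\<lambda>n. h n x) \<longlonglongrightarrow> v x"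
      by eventually_elim (rule hlim)
    have "(\<lambda>x. indicator (cball 0 (2 * R)) x) \<in> borel_measurable (lborel :: 'a measure)"
      by (rule borel_measurable_indicator) simp
    then show "(\<lambda>x. M * indicator (cball 0 (2 * R)) x) \<in> borel_measurable (lborel :: 'a measure)"
      by (intro borel_measurable_times borel_measurable_const)
  qed (simp_all only: hb always_eventually simp_thms, simp_all)
  then have "eventually (\<lambda>n. (\<integral>\<^sup>+x. norm (v x - h n x) \<partial>lborel) < ennreal (e / 4)) sequentially"
    by (rule order_tendstoD) (use e in simp)
  then obtain n where n: "(\<integral>\<^sup>+x. ennreal \<bar>v x - h n x\<bar> \<partial>lborel) < ennreal (e / 4)"
    by (auto simp: eventually_sequentially)
  define V where "V = measure lborel (cball (0::'a) (2 * R + 1))"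
  have V: "emeasure lborel (cball (0::'a) (2 * R + 1)) = ennreal V" "0 \<le> V"
    unfolding V_def using emeasure_lborel_cball_finite[of "0::'a" "2 * R + 1"]
    by (auto simp: emeasure_eq_ennreal_measure)
  \<comment> \<open>The oscillation of \<open>h n\<close> will be integrated over a ball of volume
    \<open>V\<close>; the summand 1 guards against division by zero.\<close>
  define \<eta> where "\<eta> = e / (4 * (V + 1))"
  have \<eta>: "0 < \<eta>" "\<eta> * V \<le> e / 4" using e V by (auto simp: \<eta>_def field_simps)
  \<comment> \<open>If \<open>norm x \<le> 2 * R + 1\<close> and \<open>norm z < 1\<close>, then
    \<open>x\<close> and \<open>x - z\<close> both lie in this ball; this is one reason why the
    shift is later capped by 1.\<close>
  have "uniformly_continuous_on (cball 0 (2 * R + 2)) (h n)"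
    by (intro compact_uniformly_continuous continuous_on_subset[OF h]) auto
  then obtain d where d: "0 < d" and
    du: "\<And>x y. x \<in> cball 0 (2 * R + 2) \<Longrightarrow> y \<in> cball 0 (2 * R + 2) \<Longrightarrow> dist y x < d \<Longrightarrow> dist (h n y) (h n x) < \<eta>"
    unfolding uniformly_continuous_on_def using \<eta> by metis
  have [measurable]: "cball (0::'a) (2 * R + 1) \<in> sets borel" by simp
  show ?thesis
  proof (rule that[of "min d 1"])
    show "0 < min d 1" using d by simp
    fix z :: 'a assume z: "norm z < min d 1"
    have hz: "\<bar>h n (x - z) - h n x\<bar> \<le> \<eta> * indicator (cball 0 (2 * R + 1)) x" for x
    proof (cases "norm x \<le> 2 * R + 1")
      case True
      have "norm (x - z) \<le> norm x + norm z" by (rule norm_triangle_ineq4)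
      then have "dist (h n (x - z)) (h n x) < \<eta>"
        using True z by (intro du) (auto simp: dist_norm norm_minus_commute)
      then show ?thesis using True by (simp add: dist_real_def)
    next
      case False
      have "norm x \<le> norm (x - z) + norm z" using norm_triangle_ineq[of "x - z" z] by simp
      then have "2 * R \<le> norm (x - z)" using False z by simp
      then show ?thesis using False h0 by simp
    qed
    have "(\<integral>\<^sup>+x. ennreal \<bar>v (x - z) - v x\<bar> \<partial>lborel) \<le>
        (\<integral>\<^sup>+x. (ennreal \<bar>v (-z + x) - h n (-z + x)\<bar> + ennreal \<eta> * indicator (cball 0 (2 * R + 1)) x)
           + ennreal \<bar>v x - h n x\<bar> \<partial>lborel)"
    proof (rule nn_integral_mono)
      fix x
      have "\<bar>v (x - z) - v x\<bar> \<le> (\<bar>v (x - z) - h n (x - z)\<bar> + \<eta> * indicator (cball 0 (2 * R + 1)) x) + \<bar>v x - h n x\<bar>"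
        using hz[of x] by linarith
      then have "ennreal \<bar>v (x - z) - v x\<bar> \<le> ennreal ((\<bar>v (x - z) - h n (x - z)\<bar> + \<eta> * indicator (cball 0 (2 * R + 1)) x) + \<bar>v x - h n x\<bar>)"
        by (rule ennreal_leI)
      also have "\<dots> = (ennreal \<bar>v (-z + x) - h n (-z + x)\<bar> + ennreal \<eta> * indicator (cball 0 (2 * R + 1)) x)
           + ennreal \<bar>v x - h n x\<bar>"
        using \<eta>(1) by (cases "norm x \<le> 2 * R + 1") (auto simp: ennreal_plus)
      finally show "ennreal \<bar>v (x - z) - v x\<bar> \<le> (ennreal \<bar>v (-z + x) - h n (-z + x)\<bar> + ennreal \<eta> * indicator (cball 0 (2 * R + 1)) x)
           + ennreal \<bar>v x - h n x\<bar>" .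
    qed
    also have "\<dots> = (\<integral>\<^sup>+x. ennreal \<bar>v (-z + x) - h n (-z + x)\<bar> \<partial>lborel)
        + (\<integral>\<^sup>+x. ennreal \<eta> * indicator (cball 0 (2 * R + 1)) (x::'a) \<partial>lborel) + (\<integral>\<^sup>+x. ennreal \<bar>v x - h n x\<bar> \<partial>lborel)"
      by (simp add: nn_integral_add)
    \<comment> \<open>Translation invariance: the shifted approximation error equals the unshifted
      one.\<close>
    also have "(\<integral>\<^sup>+x. ennreal \<bar>v (-z + x) - h n (-z + x)\<bar> \<partial>lborel) = (\<integral>\<^sup>+x. ennreal \<bar>v x - h n x\<bar> \<partial>lborel)"
      by (rule nn_integral_lborel_translate[of "\<lambda>x. ennreal \<bar>v x - h n x\<bar>" "- z"]) simp
    also have "(\<integral>\<^sup>+x. ennreal \<eta> * indicator (cball 0 (2 * R + 1)) (x::'a) \<partial>lborel) = ennreal (\<eta> * V)"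
      using V \<eta> by (subst nn_integral_cmult_indicator) (auto simp: ennreal_mult)
    also have "(\<integral>\<^sup>+x. ennreal \<bar>v x - h n x\<bar> \<partial>lborel) + ennreal (\<eta> * V) + (\<integral>\<^sup>+x. ennreal \<bar>v x - h n x\<bar> \<partial>lborel)
        \<le> ennreal (e / 4) + ennreal (e / 4) + ennreal (e / 4)"
      using n \<eta> by (intro add_mono ennreal_leI) auto
    also have "\<dots> \<le> ennreal e" using e by (simp add: ennreal_plus[symmetric] del: ennreal_plus)
    finally show "(\<integral>\<^sup>+x. ennreal \<bar>v (x - z) - v x\<bar> \<partial>lborel) \<le> ennreal e" .
  qed
qed

text \<open>The weight is unbounded only at the origin. On a small ball the integrand is at most
  \<open>(2 * M) powr r\<close> times an integrable weight. Off that ball the weight is bounded; one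
  factor of the difference is kept and the remaining power \<open>r - 1\<close> is bounded through
  \<open>2 * M\<close>, which reduces the claim to the unweighted \<open>L^1\<close> case.\<close>

lemma nn_integral_weighted_translate_diff_small:
  fixes v :: "'a::euclidean_space \<Rightarrow> real"
  assumes v[measurable]: "v \<in> borel_measurable borel"
    and M: "\<And>x. \<bar>v x\<bar> \<le> M" and R: "0 < R" "\<And>x. R \<le> norm x \<Longrightarrow> v x = 0"
    and b: "0 \<le> b" "b < real DIM('a)" and r: "1 \<le> r" and e: "0 < e"
  obtains d where "0 < d"
    "\<And>z. norm z < d \<Longrightarrow> (\<integral>\<^sup>+x. ennreal (\<bar>v (x - z) - v x\<bar> powr r / norm x powr b) \<partial>lborel) \<le> ennreal e"
proof -
  have M0: "0 \<le> M" using M[of 0] by linarith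
  let ?n = "real DIM('a)"
  obtain C where C: "0 \<le> C"
    "\<And>t. 0 < t \<Longrightarrow> (\<integral>\<^sup>+x. ennreal (1 / norm (x::'a) powr b) * indicator {x. norm x < t} x \<partial>lborel)
        \<le> ennreal (C * t powr (?n - b))"
    using nn_integral_norm_powr_near[OF b(2)] by blast
  define A where "A = (2 * M) powr r"
  define B where "B = (2 * M) powr (r - 1)"
  have AB: "0 \<le> A" "0 \<le> B" by (auto simp: A_def B_def)
  define \<kappa> where "\<kappa> = e / (2 * (A * C + 1))"
  have \<kappa>: "0 < \<kappa>" "A * C * \<kappa> \<le> e / 2"
  proof -
    have "0 \<le> A * C" using AB C by simp
    then have "0 < A * C + 1" by linarith
    then show "0 < \<kappa>" using e by (simp add: \<kappa>_def)
    have "A * C * \<kappa> = (A * C / (A * C + 1)) * (e / 2)"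
      by (simp add: \<kappa>_def)
    also have "\<dots> \<le> 1 * (e / 2)"
      using e \<open>0 < A * C + 1\<close> by (intro mult_right_mono) (auto simp: field_simps)
    finally show "A * C * \<kappa> \<le> e / 2" by simp
  qed
  \<comment> \<open>The radius for which the singular part contributes at most
    \<open>A * C * \<kappa>\<close>, that is, half of \<open>e\<close>.\<close>
  define t where "t = \<kappa> powr (1 / (?n - b))"
  have t: "0 < t" "t powr (?n - b) = \<kappa>"
    using \<kappa> b by (auto simp: t_def powr_powr)
  define D where "D = B / t powr b"
  have D: "0 \<le> D" using AB by (simp add: D_def)
  have "0 < e / (2 * (D + 1))" using e D by simp
  then obtain d where d: "0 < d" and
    dz: "\<And>z. norm z < d \<Longrightarrow> (\<integral>\<^sup>+x. ennreal \<bar>v (x - z) - v x\<bar> \<partial>lborel) \<le> ennreal (e / (2 * (D + 1)))"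
    using nn_integral_translate_diff_small[OF v M R] by blast
  show ?thesis
  proof (rule that[OF d])
    fix z :: 'a assume z: "norm z < d"
    have pt: "\<bar>v (x - z) - v x\<bar> powr r / norm x powr b \<le>
      A * (1 / norm x powr b * indicator {x. norm x < t} x) + D * \<bar>v (x - z) - v x\<bar>" for x
    proof -
      let ?w = "\<bar>v (x - z) - v x\<bar>"
      have w: "?w \<le> 2 * M" using M[of x] M[of "x - z"] by linarith
      show ?thesis
      proof (cases "norm x < t")
        case True
        have "?w powr r \<le> A" unfolding A_def using w r by (intro powr_mono2) auto
        then have "?w powr r / norm x powr b \<le> A / norm x powr b" by (intro divide_right_mono) auto
        moreover have "0 \<le> D * ?w" using D by simp
        ultimately show ?thesis using True by simp
      next
        case False
        have "?w powr r = ?w powr (r - 1) * ?w"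
          using powr_mult_base[of ?w "r - 1"] by (simp add: mult.commute)
        also have "\<dots> \<le> B * ?w" unfolding B_def using w r by (intro mult_right_mono powr_mono2) auto
        finally have "?w powr r / norm x powr b \<le> (B * ?w) / t powr b"
          using t(1) False b AB by (intro frac_le powr_mono2) auto
        then show ?thesis using False by (simp add: D_def)
      qed
    qed
    have "(\<integral>\<^sup>+x. ennreal (\<bar>v (x - z) - v x\<bar> powr r / norm x powr b) \<partial>lborel) \<le>
      (\<integral>\<^sup>+x. ennreal A * (ennreal (1 / norm x powr b) * indicator {x. norm x < t} x) + ennreal D * ennreal \<bar>v (x - z) - v x\<bar> \<partial>lborel)"
    proof (rule nn_integral_mono)
      fix x
      have "ennreal (\<bar>v (x - z) - v x\<bar> powr r / norm x powr b) \<le> ennreal (A * (1 / norm x powr b * indicator {x. norm x < t} x) + D * \<bar>v (x - z) - v x\<bar>)"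
        by (rule ennreal_leI[OF pt])
      also have "\<dots> = ennreal A * (ennreal (1 / norm x powr b) * indicator {x. norm x < t} x) + ennreal D * ennreal \<bar>v (x - z) - v x\<bar>"
        using AB D by (cases "norm x < t") (auto simp: ennreal_mult[symmetric] ennreal_plus[symmetric] simp del: ennreal_plus)
      finally show "ennreal (\<bar>v (x - z) - v x\<bar> powr r / norm x powr b) \<le> ennreal A * (ennreal (1 / norm x powr b) * indicator {x. norm x < t} x) + ennreal D * ennreal \<bar>v (x - z) - v x\<bar>" .
    qed
    also have "\<dots> = ennreal A * (\<integral>\<^sup>+x. ennreal (1 / norm (x::'a) powr b) * indicator {x. norm x < t} x \<partial>lborel)
       + ennreal D * (\<integral>\<^sup>+x. ennreal \<bar>v (x - z) - v x\<bar> \<partial>lborel)"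
      by (simp add: nn_integral_add nn_integral_cmult)
    also have "\<dots> \<le> ennreal A * ennreal (C * t powr (?n - b)) + ennreal D * ennreal (e / (2 * (D + 1)))"
      by (intro add_mono mult_left_mono C(2) t dz z) auto
    also have "\<dots> = ennreal (A * C * \<kappa> + D * (e / (2 * (D + 1))))"
      using AB C D e t \<kappa> by (simp add: ennreal_mult[symmetric] ennreal_plus[symmetric] mult.assoc del: ennreal_plus)
    also have "\<dots> \<le> ennreal e"
    proof (rule ennreal_leI)
      have "D * (e / (2 * (D + 1))) = (D / (D + 1)) * (e / 2)" by simp
      also have "\<dots> \<le> 1 * (e / 2)" using e D by (intro mult_right_mono) (auto simp: field_simps)
      finally show "A * C * \<kappa> + D * (e / (2 * (D + 1))) \<le> e" using \<kappa>(2) by linarith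
    qed
    finally show "(\<integral>\<^sup>+x. ennreal (\<bar>v (x - z) - v x\<bar> powr r / norm x powr b) \<partial>lborel) \<le> ennreal e" .
  qed
qed

section \<open>Truncation\<close>

lemma clamp_diff_bounds:
  fixes x y k :: real
  assumes "y \<le> x"
  shows "0 \<le> max (- k) (min k x) - max (- k) (min k y)" "max (- k) (min k x) - max (- k) (min k y) \<le> x - y"
  using assms by (simp_all add: max_def min_def)

text \<open>Clamping is nondecreasing and 1-Lipschitz, hence so is its remainder. Differences of the
  remainder are thus dominated by those of the function itself, as dominated convergence of the
  energy requires.\<close>

lemma clamp_remainder_diff:
  fixes x y k :: real
  shows "\<bar>(x - max (- k) (min k x)) - (y - max (- k) (min k y))\<bar> \<le> \<bar>x - y\<bar>"
proof (cases "y \<le> x")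
  case True
  then show ?thesis using clamp_diff_bounds[of y x k] by linarith
next
  case False
  then show ?thesis using clamp_diff_bounds[of x y k] by linarith
qed

lemma clamp_diff:
  fixes x y k :: real
  shows "\<bar>max (- k) (min k x) - max (- k) (min k y)\<bar> \<le> \<bar>x - y\<bar>"
  by (cases "y \<le> x") (use clamp_diff_bounds[of y x k] clamp_diff_bounds[of x y k] in simp_all)

lemma clamp_remainder_le: "0 \<le> k \<Longrightarrow> \<bar>x - max (- k) (min k x)\<bar> \<le> \<bar>x :: real\<bar>"
  using clamp_remainder_diff[of x k 0] by simp

lemma clamp_le: "0 \<le> k \<Longrightarrow> \<bar>max (- k) (min k x)\<bar> \<le> \<bar>x :: real\<bar>"
  using clamp_diff[of k x 0] by simp

lemma tendsto_ennreal_zeroI: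
  fixes f :: "'a \<Rightarrow> ennreal"
  assumes "\<And>e::real. 0 < e \<Longrightarrow> eventually (\<lambda>x. f x \<le> ennreal e) F"
  shows "(f \<longlongrightarrow> 0) F"
proof (rule order_tendstoI)
  fix y :: ennreal assume "0 < y"
  then obtain e where e: "0 < e" "ennreal e < y"
  proof (cases y)
    case (real r)
    then show ?thesis using that[of "r / 2"] \<open>0 < y\<close> by (auto simp: ennreal_lessI)
  qed (use that[of 1] in simp)
  show "eventually (\<lambda>x. f x < y) F"
    using assms[OF e(1)] by eventually_elim (rule le_less_trans[OF _ e(2)])
qed simp

text \<open>Lipschitz only, since smoothness is supplied later by mollification. With a large radius
  it is used as it stands, with a small radius through \<open>1 - radial_cutoff R x\<close>.\<close>

definition radial_cutoff :: "real \<Rightarrow> 'a::real_normed_vector \<Rightarrow> real" where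
  "radial_cutoff R x = max 0 (min 1 (2 - norm x / R))"

lemma radial_cutoff_bounds: "0 \<le> radial_cutoff R x" "radial_cutoff R x \<le> 1"
  by (auto simp: radial_cutoff_def)

lemma radial_cutoff_measurable [measurable]:
  "radial_cutoff R \<in> borel_measurable (borel :: 'a::euclidean_space measure)"
  unfolding radial_cutoff_def[abs_def] by measurable

lemma radial_cutoff_eq_1: "0 < R \<Longrightarrow> norm x \<le> R \<Longrightarrow> radial_cutoff R x = 1"
  by (simp add: radial_cutoff_def)

lemma radial_cutoff_eq_0: "0 < R \<Longrightarrow> 2 * R \<le> norm x \<Longrightarrow> radial_cutoff R x = 0"
  by (simp add: radial_cutoff_def max_def min_def field_simps)

text \<open>The bound \<open>min 1 (norm (x - y) / R)\<close> is the profile that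
  \<open>profile_integral\<close> integrates against the kernel.\<close>

lemma radial_cutoff_diff:
  assumes "0 < R"
  shows "\<bar>radial_cutoff R x - radial_cutoff R y\<bar> \<le> min 1 (norm (x - y) / R)"
proof -
  have "\<bar>radial_cutoff R x - radial_cutoff R y\<bar> \<le> \<bar>norm x / R - norm y / R\<bar>"
    unfolding radial_cutoff_def by linarith
  also have "\<dots> = \<bar>norm x - norm y\<bar> / R" using assms by (simp add: diff_divide_distrib[symmetric])
  also have "\<dots> \<le> norm (x - y) / R"
    using assms norm_triangle_ineq3 by (intro divide_right_mono) auto
  moreover have "\<bar>radial_cutoff R x - radial_cutoff R y\<bar> \<le> 1"
    using radial_cutoff_bounds[of R x] radial_cutoff_bounds[of R y] by linarith
  ultimately show ?thesis by simp
qed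

section \<open>Energy and mass in the weighted setting\<close>

locale weighted_sobolev =
  fixes s p a N :: real and dim :: "'n::finite itself"
  assumes N: "N = real CARD('n)"
    and s: "0 < s" "s < 1" and p: "1 < p"
    and a: "0 \<le> a" "a < (N - s * p) / 2"
begin

definition "q = N * p / (N - s * p)"

text \<open>Because \<open>0 powr r = 0\<close> and \<open>1 / 0 = 0\<close>, the kernel is 0 on the
  diagonal and wherever one variable is the origin. Singular pairs can therefore be dismissed
  pointwise instead of almost everywhere.\<close>

definition ker :: "real ^ 'n \<Rightarrow> real ^ 'n \<Rightarrow> real" where
  "ker x y = 1 / norm (x - y) powr (N + s * p) * (1 / norm x powr a) * (1 / norm y powr a)"

text \<open>Powers of the seminorms, without the root: \<open>energy\<close> corresponds to the
  \<open>p\<close>-th power of \<open>gagliardo\<close> and \<open>mass\<close> to the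
  \<open>q\<close>-th power of \<open>weighted_norm\<close>, both over the Borel measure.\<close>

definition energy :: "(real ^ 'n \<Rightarrow> real) \<Rightarrow> ennreal" where
  "energy u = (\<integral>\<^sup>+z. ennreal (\<bar>u (fst z) - u (snd z)\<bar> powr p * ker (fst z) (snd z)) \<partial>(lborel \<Otimes>\<^sub>M lborel))"

definition mass :: "(real ^ 'n \<Rightarrow> real) \<Rightarrow> ennreal" where
  "mass u = (\<integral>\<^sup>+x. ennreal (\<bar>u x\<bar> powr q / norm x powr (2 * a * q / p)) \<partial>lborel)"

lemma sp_pos: "0 < s * p" using s p by simp

lemma N_sp: "0 < N - s * p" "2 * a < N - s * p" "2 * a < N" "a < N"
  using a sp_pos by auto

lemma q_gt: "p < q" "1 < q" "q / p = N / (N - s * p)"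
proof -
  show *: "p < q"
    using N_sp sp_pos p by (simp add: q_def field_simps)
  then show "1 < q" using p by simp
  show "q / p = N / (N - s * p)" using p by (simp add: q_def)
qed

text \<open>This is local integrability of the weight in \<open>mass\<close>: the exponent is
  \<open>N\<close> times \<open>2 * a / (N - s * p)\<close>, a ratio that the upper bound on
  \<open>a\<close> keeps below 1.\<close>

lemma mass_exponent: "0 \<le> 2 * a * q / p" "2 * a * q / p < N"
proof -
  show "0 \<le> 2 * a * q / p" using a p q_gt by simp
  have "2 * a * q / p = 2 * a * (q / p)" by simp
  also have "\<dots> = N * (2 * a / (N - s * p))" by (simp only: q_gt(3)) simp
  also have "\<dots> < N * 1"
    using N_sp N by (intro mult_strict_left_mono) auto
  finally show "2 * a * q / p < N" by simp
qed

lemma ker_measurable [measurable (raw)]: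
  assumes [measurable]: "f \<in> M \<rightarrow>\<^sub>M borel" "g \<in> M \<rightarrow>\<^sub>M borel"
  shows "(\<lambda>z. ker (f z) (g z)) \<in> borel_measurable M"
  unfolding ker_def by measurable

lemma ker_nonneg: "0 \<le> ker x y"
  by (simp add: ker_def)

lemma ker_eq_0: "x = 0 \<or> y = 0 \<Longrightarrow> ker x y = 0"
  by (auto simp: ker_def)

lemma ker_commute: "ker x y = ker y x"
  by (simp add: ker_def norm_minus_commute)

lemma energy_mono:
  assumes "\<And>x y. \<bar>v x - v y\<bar> \<le> \<bar>u x - u y\<bar>"
  shows "energy v \<le> energy u"
  unfolding energy_def using assms p
  by (intro nn_integral_mono ennreal_leI mult_right_mono powr_mono2 ker_nonneg) auto

lemma mass_mono:
  assumes "\<And>x. \<bar>v x\<bar> \<le> \<bar>u x\<bar>"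
  shows "mass v \<le> mass u"
  unfolding mass_def using assms q_gt
  by (intro nn_integral_mono ennreal_leI divide_right_mono powr_mono2) auto

text \<open>The functions depend on the pair as a whole, because the pieces to be split off
  (commutator terms, parts near to and far from the diagonal) are not differences of a function of
  one variable.\<close>

lemma pair_integral_add_le:
  fixes f g h :: "_ \<Rightarrow> real"
  assumes [measurable]: "g \<in> borel_measurable (borel \<Otimes>\<^sub>M borel)" "h \<in> borel_measurable (borel \<Otimes>\<^sub>M borel)"
    and le: "\<And>z. \<bar>f z\<bar> \<le> \<bar>g z\<bar> + \<bar>h z\<bar>"
  shows "(\<integral>\<^sup>+z. ennreal (\<bar>f z\<bar> powr p * ker (fst z) (snd z)) \<partial>(lborel \<Otimes>\<^sub>M lborel)) \<le>
    ennreal (2 powr p) * ((\<integral>\<^sup>+z. ennreal (\<bar>g z\<bar> powr p * ker (fst z) (snd z)) \<partial>(lborel \<Otimes>\<^sub>M lborel)) +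
      (\<integral>\<^sup>+z. ennreal (\<bar>h z\<bar> powr p * ker (fst z) (snd z)) \<partial>(lborel \<Otimes>\<^sub>M lborel)))"
proof -
  have pt: "ennreal (\<bar>f z\<bar> powr p * ker (fst z) (snd z)) \<le>
     ennreal (2 powr p) * (ennreal (\<bar>g z\<bar> powr p * ker (fst z) (snd z)) + ennreal (\<bar>h z\<bar> powr p * ker (fst z) (snd z)))" for z
  proof -
    have "\<bar>f z\<bar> powr p \<le> (\<bar>g z\<bar> + \<bar>h z\<bar>) powr p" using le p by (intro powr_mono2) auto
    also have "\<dots> \<le> 2 powr p * (\<bar>g z\<bar> powr p + \<bar>h z\<bar> powr p)" using p by (intro powr_add_le) auto
    finally have "\<bar>f z\<bar> powr p * ker (fst z) (snd z) \<le> 2 powr p * (\<bar>g z\<bar> powr p + \<bar>h z\<bar> powr p) * ker (fst z) (snd z)"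
      by (intro mult_right_mono ker_nonneg)
    also have "\<dots> = 2 powr p * (\<bar>g z\<bar> powr p * ker (fst z) (snd z) + \<bar>h z\<bar> powr p * ker (fst z) (snd z))"
      by (simp add: algebra_simps)
    finally show ?thesis
      by (simp add: ker_nonneg ennreal_mult[symmetric] ennreal_plus[symmetric] ennreal_leI del: ennreal_plus)
  qed
  show ?thesis
    by (rule order_trans[OF nn_integral_mono[OF pt]]) (simp add: nn_integral_add nn_integral_cmult)
qed

lemma energy_triangle:
  assumes [measurable]: "u \<in> borel_measurable borel" "v \<in> borel_measurable borel" "w \<in> borel_measurable borel"
  shows "energy (\<lambda>x. u x - w x) \<le> ennreal (2 powr p) * (energy (\<lambda>x. u x - v x) + energy (\<lambda>x. v x - w x))"
  unfolding energy_def by (intro pair_integral_add_le) (simp_all add: split_beta' abs_if)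

lemma mass_triangle:
  assumes [measurable]: "u \<in> borel_measurable borel" "v \<in> borel_measurable borel" "w \<in> borel_measurable borel"
  shows "mass (\<lambda>x. u x - w x) \<le> ennreal (2 powr q) * (mass (\<lambda>x. u x - v x) + mass (\<lambda>x. v x - w x))"
proof -
  let ?b = "2 * a * q / p"
  have pt: "ennreal (\<bar>u x - w x\<bar> powr q / norm x powr ?b) \<le>
     ennreal (2 powr q) * (ennreal (\<bar>u x - v x\<bar> powr q / norm x powr ?b) + ennreal (\<bar>v x - w x\<bar> powr q / norm x powr ?b))" for x
  proof -
    have "\<bar>u x - w x\<bar> powr q \<le> (\<bar>u x - v x\<bar> + \<bar>v x - w x\<bar>) powr q" using q_gt by (intro powr_mono2) auto
    also have "\<dots> \<le> 2 powr q * (\<bar>u x - v x\<bar> powr q + \<bar>v x - w x\<bar> powr q)" using q_gt by (intro powr_add_le) auto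
    finally have "\<bar>u x - w x\<bar> powr q / norm x powr ?b \<le> 2 powr q * (\<bar>u x - v x\<bar> powr q + \<bar>v x - w x\<bar> powr q) / norm x powr ?b"
      by (intro divide_right_mono) auto
    also have "\<dots> = 2 powr q * (\<bar>u x - v x\<bar> powr q / norm x powr ?b + \<bar>v x - w x\<bar> powr q / norm x powr ?b)"
      by (simp add: distrib_left add_divide_distrib)
    finally show ?thesis
      by (simp add: ennreal_mult[symmetric] ennreal_plus[symmetric] ennreal_leI del: ennreal_plus)
  qed
  show ?thesis unfolding mass_def
    by (rule order_trans[OF nn_integral_mono[OF pt]]) (simp add: nn_integral_add nn_integral_cmult)
qed

text \<open>Dominated convergence with the energy density of \<open>u\<close> as majorant. It is
  enough to control the limit at pairs of distinct nonzero points, since \<open>ker\<close> vanishes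
  at all others.\<close>

lemma pair_integral_tendsto_0:
  fixes g :: "nat \<Rightarrow> (real ^ 'n) \<times> (real ^ 'n) \<Rightarrow> real"
  assumes [measurable]: "u \<in> borel_measurable borel" "\<And>k. g k \<in> borel_measurable (borel \<Otimes>\<^sub>M borel)"
    and fin: "energy u < \<infinity>"
    and le: "\<And>k z. \<bar>g k z\<bar> \<le> \<bar>u (fst z) - u (snd z)\<bar>"
    and lim: "\<And>z. fst z \<noteq> 0 \<Longrightarrow> snd z \<noteq> 0 \<Longrightarrow> fst z \<noteq> snd z \<Longrightarrow> (\<lambda>k. g k z) \<longlonglongrightarrow> 0"
  shows "(\<lambda>k. \<integral>\<^sup>+z. ennreal (\<bar>g k z\<bar> powr p * ker (fst z) (snd z)) \<partial>(lborel \<Otimes>\<^sub>M lborel)) \<longlonglongrightarrow> 0"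
proof -
  have "(\<lambda>k. \<integral>\<^sup>+z. ennreal (\<bar>g k z\<bar> powr p * ker (fst z) (snd z)) \<partial>(lborel \<Otimes>\<^sub>M lborel))
    \<longlonglongrightarrow> (\<integral>\<^sup>+z. 0 \<partial>(lborel \<Otimes>\<^sub>M lborel :: ((real ^ 'n) \<times> (real ^ 'n)) measure))"
  proof (rule nn_integral_dominated_convergence)
    show "(\<integral>\<^sup>+z. ennreal (\<bar>u (fst z) - u (snd z)\<bar> powr p * ker (fst z) (snd z)) \<partial>(lborel \<Otimes>\<^sub>M lborel)) < \<infinity>"
      using fin by (simp add: energy_def)
    show "AE z in lborel \<Otimes>\<^sub>M lborel. ennreal (\<bar>g k z\<bar> powr p * ker (fst z) (snd z)) \<le>
        ennreal (\<bar>u (fst z) - u (snd z)\<bar> powr p * ker (fst z) (snd z))" for k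
      using le p by (intro AE_I2 ennreal_leI mult_right_mono powr_mono2 ker_nonneg) auto
    show "AE z in lborel \<Otimes>\<^sub>M lborel. (\<lambda>k. ennreal (\<bar>g k z\<bar> powr p * ker (fst z) (snd z))) \<longlonglongrightarrow> 0"
    proof (rule AE_I2)
      fix z
      show "(\<lambda>k. ennreal (\<bar>g k z\<bar> powr p * ker (fst z) (snd z))) \<longlonglongrightarrow> 0"
      proof (cases "fst z \<noteq> 0 \<and> snd z \<noteq> 0 \<and> fst z \<noteq> snd z")
        case True
        have "(\<lambda>k. \<bar>g k z\<bar> powr p * ker (fst z) (snd z)) \<longlonglongrightarrow> \<bar>0\<bar> powr p * ker (fst z) (snd z)"
          using True p by (intro tendsto_intros lim tendsto_powr2) auto
        then have "(\<lambda>k. \<bar>g k z\<bar> powr p * ker (fst z) (snd z)) \<longlonglongrightarrow> 0" by simp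
        then show ?thesis by (simp add: tendsto_ennrealI[where x=0, simplified])
      next
        case False
        then have "ker (fst z) (snd z) = 0" by (auto simp: ker_def)
        then show ?thesis by simp
      qed
    qed
  qed measurable
  then show ?thesis by simp
qed

lemma energy_tendsto_0:
  assumes u [measurable]: "u \<in> borel_measurable borel" and [measurable]: "\<And>k. f k \<in> borel_measurable borel"
    and fin: "energy u < \<infinity>"
    and le: "\<And>k x y. \<bar>f k x - f k y\<bar> \<le> \<bar>u x - u y\<bar>"
    and lim: "\<And>x. x \<noteq> 0 \<Longrightarrow> (\<lambda>k. f k x) \<longlonglongrightarrow> 0"
  shows "(\<lambda>k. energy (f k)) \<longlonglongrightarrow> 0"
  unfolding energy_def
proof (rule pair_integral_tendsto_0[OF u _ fin])
  show "(\<lambda>k. f k (fst z) - f k (snd z)) \<longlonglongrightarrow> 0" if "fst z \<noteq> 0" "snd z \<noteq> 0" for z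
    using tendsto_diff[OF lim[OF that(1)] lim[OF that(2)]] by simp
qed (simp_all add: le)

lemma mass_tendsto_0:
  assumes [measurable]: "u \<in> borel_measurable borel" "\<And>k. f k \<in> borel_measurable borel"
    and fin: "mass u < \<infinity>"
    and le: "\<And>k x. \<bar>f k x\<bar> \<le> \<bar>u x\<bar>"
    and lim: "\<And>x. x \<noteq> 0 \<Longrightarrow> (\<lambda>k. f k x) \<longlonglongrightarrow> 0"
  shows "(\<lambda>k. mass (f k)) \<longlonglongrightarrow> 0"
proof -
  let ?b = "2 * a * q / p"
  have "(\<lambda>k. mass (f k)) \<longlonglongrightarrow> (\<integral>\<^sup>+x. 0 \<partial>(lborel :: (real ^ 'n) measure))"
    unfolding mass_def
  proof (rule nn_integral_dominated_convergence)
    show "(\<integral>\<^sup>+x. ennreal (\<bar>u x\<bar> powr q / norm x powr ?b) \<partial>lborel) < \<infinity>"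
      using fin by (simp add: mass_def)
    show "AE x in lborel. ennreal (\<bar>f k x\<bar> powr q / norm x powr ?b) \<le> ennreal (\<bar>u x\<bar> powr q / norm x powr ?b)" for k
      using le q_gt by (intro AE_I2 ennreal_leI divide_right_mono powr_mono2) auto
    show "AE x in lborel. (\<lambda>k. ennreal (\<bar>f k x\<bar> powr q / norm x powr ?b)) \<longlonglongrightarrow> 0"
    proof (rule AE_I2)
      fix x :: "real ^ 'n"
      show "(\<lambda>k. ennreal (\<bar>f k x\<bar> powr q / norm x powr ?b)) \<longlonglongrightarrow> 0"
      proof (cases "x = 0")
        case False
        have "(\<lambda>k. \<bar>f k x\<bar> powr q * (1 / norm x powr ?b)) \<longlonglongrightarrow> \<bar>0\<bar> powr q * (1 / norm x powr ?b)"
          using False q_gt by (intro tendsto_mult tendsto_const tendsto_rabs lim tendsto_powr2) auto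
        then have "(\<lambda>k. \<bar>f k x\<bar> powr q / norm x powr ?b) \<longlonglongrightarrow> 0" by simp
        then show ?thesis by (simp add: tendsto_ennrealI[where x=0, simplified])
      qed simp
    qed
  qed measurable
  then show ?thesis by simp
qed

lemma truncation_tendsto:
  assumes u [measurable]: "u \<in> borel_measurable borel" and fin: "energy u < \<infinity>" "mass u < \<infinity>"
  shows "(\<lambda>k. energy (\<lambda>x. u x - max (- real k) (min (real k) (u x)))) \<longlonglongrightarrow> 0"
    and "(\<lambda>k. mass (\<lambda>x. u x - max (- real k) (min (real k) (u x)))) \<longlonglongrightarrow> 0"
proof -
  have lim: "(\<lambda>k. u x - max (- real k) (min (real k) (u x))) \<longlonglongrightarrow> 0" for x
  \<comment> \<open>Once \<open>k\<close> reaches \<open>\<bar>u x\<bar>\<close> the remainder is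
    exactly 0.\<close>
  proof (rule tendsto_eventually)
    obtain m where m: "\<bar>u x\<bar> \<le> real m" using real_arch_simple by blast
    show "\<forall>\<^sub>F k in sequentially. u x - max (- real k) (min (real k) (u x)) = 0"
      using eventually_ge_at_top[of m]
    proof eventually_elim
      case (elim k)
      then have "real m \<le> real k" by simp
      then show ?case using m by (auto simp: max_def min_def)
    qed
  qed
  have [measurable]: "(\<lambda>x. u x - max (- real k) (min (real k) (u x))) \<in> borel_measurable borel" for k
    by measurable
  show "(\<lambda>k. energy (\<lambda>x. u x - max (- real k) (min (real k) (u x)))) \<longlonglongrightarrow> 0"
    by (rule energy_tendsto_0[OF u _ fin(1) clamp_remainder_diff lim]) fact
  have le: "\<bar>u x - max (- real k) (min (real k) (u x))\<bar> \<le> \<bar>u x\<bar>" for k x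
    by (rule clamp_remainder_le) simp
  show "(\<lambda>k. mass (\<lambda>x. u x - max (- real k) (min (real k) (u x)))) \<longlonglongrightarrow> 0"
    by (rule mass_tendsto_0[OF u _ fin(2) le lim]) fact
qed

section \<open>Cutoff near the origin and near infinity\<close>

lemma DIM_N: "real DIM(real ^ 'n) = N"
  by (simp add: N)

text \<open>The integral is split at \<open>norm z = R\<close>, where the minimum changes its
  branch. Inside, the exponent becomes \<open>N + s * p - p\<close>, below \<open>N\<close> because
  \<open>s < 1\<close>; outside it is \<open>N + s * p\<close>, above \<open>N\<close> because
  \<open>s * p > 0\<close>. Both pieces scale like \<open>R powr (- (s * p))\<close>.\<close>

lemma profile_integral:
  obtains C where "0 \<le> C"
    "\<And>R. 0 < R \<Longrightarrow> (\<integral>\<^sup>+z. ennreal (min 1 (norm (z :: real ^ 'n) / R) powr p / norm z powr (N + s * p)) \<partial>lborel)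
      \<le> ennreal (C * R powr (- (s * p)))"
proof -
  have "s * p < 1 * p" using s p by (intro mult_strict_right_mono) auto
  then have "N + s * p - p < real DIM(real ^ 'n)" unfolding DIM_N by simp
  then obtain C1 where C1: "0 \<le> C1"
    "\<And>r. 0 < r \<Longrightarrow> (\<integral>\<^sup>+x. ennreal (1 / norm (x :: real ^ 'n) powr (N + s * p - p)) * indicator {x. norm x < r} x \<partial>lborel)
        \<le> ennreal (C1 * r powr (N - (N + s * p - p)))"
    using nn_integral_norm_powr_near[where 'a="real ^ 'n"] unfolding DIM_N by blast
  have "real DIM(real ^ 'n) < N + s * p" unfolding DIM_N using sp_pos by simp
  then obtain C2 where C2: "0 \<le> C2"
    "\<And>r. 0 < r \<Longrightarrow> (\<integral>\<^sup>+x. ennreal (1 / norm (x :: real ^ 'n) powr (N + s * p)) * indicator {x. r \<le> norm x} x \<partial>lborel)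
        \<le> ennreal (C2 * r powr (N - (N + s * p)))"
    using nn_integral_norm_powr_far[where 'a="real ^ 'n"] unfolding DIM_N by blast
  show ?thesis
  proof (rule that[of "C1 + C2"])
    fix R :: real assume R: "0 < R"
    have pt: "ennreal (min 1 (norm z / R) powr p / norm z powr (N + s * p)) \<le>
      ennreal (R powr (- p)) * (ennreal (1 / norm z powr (N + s * p - p)) * indicator {x. norm x < R} z)
      + ennreal (1 / norm z powr (N + s * p)) * indicator {x. R \<le> norm x} z" for z :: "real ^ 'n"
    proof (cases "norm z < R")
      case True
      have "min 1 (norm z / R) powr p / norm z powr (N + s * p) = R powr (- p) * (1 / norm z powr (N + s * p - p))"
        if "z \<noteq> 0"
      proof -
        have *: "min 1 (norm z / R) = norm z / R" using True R by simp
        show ?thesis unfolding * using that R by (simp add: powr_divide powr_minus powr_diff field_simps)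
      qed
      then have "min 1 (norm z / R) powr p / norm z powr (N + s * p) \<le> R powr (- p) * (1 / norm z powr (N + s * p - p))"
        by (cases "z = 0") auto
      then show ?thesis using True by (simp add: ennreal_mult[symmetric] ennreal_leI)
    next
      case False
      then have "min 1 (norm z / R) = 1" using R by simp
      then show ?thesis using False by simp
    qed
    have "(\<integral>\<^sup>+z. ennreal (min 1 (norm (z :: real ^ 'n) / R) powr p / norm z powr (N + s * p)) \<partial>lborel)
      \<le> ennreal (R powr (- p)) * (\<integral>\<^sup>+z. ennreal (1 / norm (z :: real ^ 'n) powr (N + s * p - p)) * indicator {x. norm x < R} z \<partial>lborel)
       + (\<integral>\<^sup>+z. ennreal (1 / norm (z :: real ^ 'n) powr (N + s * p)) * indicator {x. R \<le> norm x} z \<partial>lborel)"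
      by (rule order_trans[OF nn_integral_mono[OF pt]]) (simp add: nn_integral_add nn_integral_cmult)
    also have "\<dots> \<le> ennreal (R powr (- p)) * ennreal (C1 * R powr (N - (N + s * p - p))) + ennreal (C2 * R powr (N - (N + s * p)))"
      by (intro add_mono mult_left_mono C1 C2 R) simp
    also have "\<dots> = ennreal ((C1 + C2) * R powr (- (s * p)))"
    proof -
      have "R powr (- p) * (C1 * R powr (N - (N + s * p - p))) = C1 * (R powr (- p) * R powr (p - s * p))" by simp
      also have "R powr (- p) * R powr (p - s * p) = R powr (- (s * p))"
        by (simp add: powr_add[symmetric])
      finally show ?thesis using C1(1) C2(1)
        by (simp add: ennreal_mult[symmetric] ennreal_plus[symmetric] distrib_right del: ennreal_plus)
    qed
    finally show "(\<integral>\<^sup>+z. ennreal (min 1 (norm (z :: real ^ 'n) / R) powr p / norm z powr (N + s * p)) \<partial>lborel)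
      \<le> ennreal ((C1 + C2) * R powr (- (s * p)))" .
  qed (use C1 C2 in simp)
qed

text \<open>By symmetry only pairs with \<open>|x| \<le> |y|\<close> matter; then \<open>|y|\<^bsup>-a\<^esup> \<le> |x|\<^bsup>-a\<^esup>\<close> and the \<open>y\<close>-integral
  decouples from the weights.\<close>

lemma cutoff_energy:
  obtains C where "0 \<le> C"
    "\<And>R g \<eta>. 0 < R \<Longrightarrow> g \<in> borel_measurable borel \<Longrightarrow> \<eta> \<in> borel_measurable borel \<Longrightarrow>
      (\<And>x y. \<bar>\<eta> x - \<eta> y\<bar> \<le> min 1 (norm (x - y) / R)) \<Longrightarrow> (\<And>x. 2 * R \<le> norm x \<Longrightarrow> \<eta> x = 0) \<Longrightarrow>
      (\<integral>\<^sup>+z. ennreal (\<bar>min \<bar>g (fst z)\<bar> \<bar>g (snd z)\<bar> * (\<eta> (fst z) - \<eta> (snd z))\<bar> powr p * ker (fst z) (snd z)) \<partial>(lborel \<Otimes>\<^sub>M lborel))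
      \<le> ennreal (C * R powr (- (s * p))) *
         (\<integral>\<^sup>+x. ennreal (\<bar>g x\<bar> powr p / norm x powr (2 * a)) * indicator {x. norm x < 2 * R} x \<partial>lborel)"
proof -
  obtain C where C: "0 \<le> C"
    "\<And>R. 0 < R \<Longrightarrow> (\<integral>\<^sup>+z. ennreal (min 1 (norm (z :: real ^ 'n) / R) powr p / norm z powr (N + s * p)) \<partial>lborel)
      \<le> ennreal (C * R powr (- (s * p)))"
    using profile_integral by blast
  show ?thesis
  \<comment> \<open>One copy of \<open>C\<close> for each of the two orderings of the norms.\<close>
  proof (rule that[of "2 * C"])
    fix R and g \<eta> :: "real ^ 'n \<Rightarrow> real"
    assume R: "0 < R" and [measurable]: "g \<in> borel_measurable borel" "\<eta> \<in> borel_measurable borel"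
      and \<eta>: "\<And>x y. \<bar>\<eta> x - \<eta> y\<bar> \<le> min 1 (norm (x - y) / R)" and \<eta>0: "\<And>x. 2 * R \<le> norm x \<Longrightarrow> \<eta> x = 0"
    let ?\<Phi> = "\<lambda>z :: real ^ 'n. ennreal (min 1 (norm z / R) powr p / norm z powr (N + s * p))"
    let ?G = "\<lambda>x. ennreal (\<bar>g x\<bar> powr p / norm x powr (2 * a)) * indicator {x. norm x < 2 * R} x"
    let ?F = "\<lambda>x y. ennreal (\<bar>min \<bar>g x\<bar> \<bar>g y\<bar> * (\<eta> x - \<eta> y)\<bar> powr p * ker x y)"
    have half: "?F x y \<le> ?G x * ?\<Phi> (x - y)" if xy: "norm x \<le> norm y" for x y
    proof (cases "x = 0 \<or> 2 * R \<le> norm x")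
      \<comment> \<open>If \<open>2 * R \<le> norm x\<close>, then also
        \<open>2 * R \<le> norm y\<close>, and both values of \<open>\<eta>\<close> vanish; this is
        what confines the integral of \<open>g\<close> to a ball.\<close>
      case True
      then have z: "\<bar>min \<bar>g x\<bar> \<bar>g y\<bar> * (\<eta> x - \<eta> y)\<bar> powr p * ker x y = 0"
        using \<eta>0[of x] \<eta>0[of y] xy by (auto simp: ker_eq_0)
      show ?thesis unfolding z by simp
    next
      case False
      let ?m = "min 1 (norm (x - y) / R)"
      have m: "0 \<le> ?m" using R by simp
      have "\<bar>min \<bar>g x\<bar> \<bar>g y\<bar>\<bar> \<le> \<bar>g x\<bar>" by linarith
      then have "\<bar>min \<bar>g x\<bar> \<bar>g y\<bar> * (\<eta> x - \<eta> y)\<bar> \<le> \<bar>g x\<bar> * ?m"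
        unfolding abs_mult by (intro mult_mono \<eta> abs_ge_zero)
      then have "\<bar>min \<bar>g x\<bar> \<bar>g y\<bar> * (\<eta> x - \<eta> y)\<bar> powr p \<le> (\<bar>g x\<bar> * ?m) powr p"
        using p by (intro powr_mono2) auto
      also have "\<dots> = \<bar>g x\<bar> powr p * ?m powr p" using m by (simp add: powr_mult)
      finally have 1: "\<bar>min \<bar>g x\<bar> \<bar>g y\<bar> * (\<eta> x - \<eta> y)\<bar> powr p \<le> \<bar>g x\<bar> powr p * ?m powr p" .
      have "1 / norm y powr a \<le> 1 / norm x powr a"
        using xy False a(1) by (intro divide_left_mono powr_mono2 mult_pos_pos) auto
      then have "ker x y \<le> 1 / norm (x - y) powr (N + s * p) * (1 / norm x powr a) * (1 / norm x powr a)"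
        unfolding ker_def by (intro mult_left_mono) auto
      also have "\<dots> = 1 / norm (x - y) powr (N + s * p) * (1 / norm x powr (2 * a))"
        by (simp add: powr_add[symmetric])
      finally have 2: "ker x y \<le> 1 / norm (x - y) powr (N + s * p) * (1 / norm x powr (2 * a))" .
      have "\<bar>min \<bar>g x\<bar> \<bar>g y\<bar> * (\<eta> x - \<eta> y)\<bar> powr p * ker x y \<le>
        (\<bar>g x\<bar> powr p * ?m powr p) * (1 / norm (x - y) powr (N + s * p) * (1 / norm x powr (2 * a)))"
        by (rule mult_mono[OF 1 2 _ ker_nonneg]) simp
      also have "\<dots> = (\<bar>g x\<bar> powr p / norm x powr (2 * a)) * (?m powr p / norm (x - y) powr (N + s * p))"
        by simp
      finally have "?F x y \<le> ennreal ((\<bar>g x\<bar> powr p / norm x powr (2 * a)) * (?m powr p / norm (x - y) powr (N + s * p)))"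
        by (rule ennreal_leI)
      also have "\<dots> = ?G x * ?\<Phi> (x - y)"
        using False by (subst ennreal_mult) auto
      finally show ?thesis .
    qed
    have pt: "?F (fst z) (snd z) \<le> ?G (fst z) * ?\<Phi> (fst z - snd z) + ?G (snd z) * ?\<Phi> (snd z - fst z)" for z
    proof (cases "norm (fst z) \<le> norm (snd z)")
      case True
      then show ?thesis by (intro add_increasing2[OF zero_le] half)
    next
      case False
      then have "norm (snd z) \<le> norm (fst z)" by simp
      \<comment> \<open>The minimum and the kernel are symmetric, and the difference of
        \<open>\<eta>\<close> is so up to sign; the other ordering follows by renaming.\<close>
      from half[OF this]
      have "?F (fst z) (snd z) \<le> ?G (snd z) * ?\<Phi> (snd z - fst z)"
        by (simp only: ker_commute[of "fst z"] min.commute[of "\<bar>g (fst z)\<bar>"] abs_mult abs_minus_commute[of "\<eta> (fst z)"])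
      then show ?thesis by (simp only: add_increasing zero_le)
    qed
    have int: "(\<integral>\<^sup>+y. ?G x * ?\<Phi> (x - y) \<partial>lborel) \<le> ?G x * ennreal (C * R powr (- (s * p)))" for x
    proof -
      have "(\<integral>\<^sup>+y. ?G x * ?\<Phi> (x - y) \<partial>lborel) = ?G x * (\<integral>\<^sup>+y. ?\<Phi> (x - y) \<partial>lborel)"
        by (rule nn_integral_cmult) measurable
      also have "(\<integral>\<^sup>+y. ?\<Phi> (x - y) \<partial>lborel) = (\<integral>\<^sup>+y. ?\<Phi> y \<partial>lborel)"
        by (rule nn_integral_lborel_reflect[of ?\<Phi> x]) measurable
      finally show ?thesis by (simp add: mult_left_mono C(2)[OF R])
    qed
    let ?I = "\<integral>\<^sup>+x. ?G x \<partial>lborel"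
    have int2: "(\<integral>\<^sup>+x. \<integral>\<^sup>+y. ?G x * ?\<Phi> (x - y) \<partial>lborel \<partial>lborel) \<le> ?I * ennreal (C * R powr (- (s * p)))"
      by (rule order_trans[OF nn_integral_mono[OF int]]) (subst nn_integral_multc, measurable)
    have "(\<integral>\<^sup>+z. ?F (fst z) (snd z) \<partial>(lborel \<Otimes>\<^sub>M lborel)) \<le>
      (\<integral>\<^sup>+z. ?G (fst z) * ?\<Phi> (fst z - snd z) + ?G (snd z) * ?\<Phi> (snd z - fst z) \<partial>(lborel \<Otimes>\<^sub>M lborel))"
      by (rule nn_integral_mono[OF pt])
    also have "\<dots> = (\<integral>\<^sup>+z. ?G (fst z) * ?\<Phi> (fst z - snd z) \<partial>(lborel \<Otimes>\<^sub>M lborel)) +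
      (\<integral>\<^sup>+z. ?G (snd z) * ?\<Phi> (snd z - fst z) \<partial>(lborel \<Otimes>\<^sub>M lborel))"
      by (rule nn_integral_add) measurable
    also have "(\<integral>\<^sup>+z. ?G (fst z) * ?\<Phi> (fst z - snd z) \<partial>(lborel \<Otimes>\<^sub>M lborel)) = (\<integral>\<^sup>+x. \<integral>\<^sup>+y. ?G x * ?\<Phi> (x - y) \<partial>lborel \<partial>lborel)"
      by (rule lborel_pair_integral_iterated[of "\<lambda>x y. ?G x * ?\<Phi> (x - y)"]) measurable
    also have "(\<integral>\<^sup>+z. ?G (snd z) * ?\<Phi> (snd z - fst z) \<partial>(lborel \<Otimes>\<^sub>M lborel)) = (\<integral>\<^sup>+x. \<integral>\<^sup>+y. ?G x * ?\<Phi> (x - y) \<partial>lborel \<partial>lborel)"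
      by (rule lborel_pair_integral_iterated_swap[of "\<lambda>x y. ?G x * ?\<Phi> (x - y)"]) measurable
    also have "(\<integral>\<^sup>+x. \<integral>\<^sup>+y. ?G x * ?\<Phi> (x - y) \<partial>lborel \<partial>lborel) + (\<integral>\<^sup>+x. \<integral>\<^sup>+y. ?G x * ?\<Phi> (x - y) \<partial>lborel \<partial>lborel)
      \<le> ?I * ennreal (C * R powr (- (s * p))) + ?I * ennreal (C * R powr (- (s * p)))"
      by (intro add_mono int2)
    also have "\<dots> = (ennreal (C * R powr (- (s * p))) + ennreal (C * R powr (- (s * p)))) * ?I"
      by (simp add: distrib_right mult.commute)
    also have "ennreal (C * R powr (- (s * p))) + ennreal (C * R powr (- (s * p))) = ennreal (2 * C * R powr (- (s * p)))"
      using C(1) by (simp add: ennreal_plus[symmetric] del: ennreal_plus)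
    finally show "(\<integral>\<^sup>+z. ?F (fst z) (snd z) \<partial>(lborel \<Otimes>\<^sub>M lborel)) \<le> ennreal (2 * C * R powr (- (s * p))) * ?I" .
  qed (use C in simp)
qed

text \<open>Serves both the cutoff at the origin and the finite energy of test functions;
  \<open>C\<close> depends neither on \<open>g\<close> nor on its bound.\<close>

lemma weighted_power_near:
  obtains C where "0 \<le> C"
    "\<And>R g M. 0 < R \<Longrightarrow> (\<And>x. \<bar>g x\<bar> \<le> M) \<Longrightarrow>
     (\<integral>\<^sup>+x. ennreal (\<bar>g x\<bar> powr p / norm (x :: real ^ 'n) powr (2 * a)) * indicator {x. norm x < R} x \<partial>lborel)
       \<le> ennreal (M powr p * (C * R powr (N - 2 * a)))"
proof -
  have "2 * a < real DIM(real ^ 'n)" unfolding DIM_N using N_sp by simp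
  then obtain C where C: "0 \<le> C"
    "\<And>r. 0 < r \<Longrightarrow> (\<integral>\<^sup>+x. ennreal (1 / norm (x :: real ^ 'n) powr (2 * a)) * indicator {x. norm x < r} x \<partial>lborel)
        \<le> ennreal (C * r powr (N - 2 * a))"
    using nn_integral_norm_powr_near[where 'a="real ^ 'n"] unfolding DIM_N by blast
  show ?thesis
  proof (rule that[OF C(1)])
    fix R M :: real and g :: "real ^ 'n \<Rightarrow> real" assume R: "0 < R" and M: "\<And>x. \<bar>g x\<bar> \<le> M"
    have pt: "ennreal (\<bar>g x\<bar> powr p / norm x powr (2 * a)) * indicator {x. norm x < R} x \<le>
      ennreal (M powr p) * (ennreal (1 / norm x powr (2 * a)) * indicator {x. norm x < R} x)" for x
    proof -
      have "\<bar>g x\<bar> powr p / norm x powr (2 * a) \<le> M powr p * (1 / norm x powr (2 * a))"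
        using M[of x] p by (simp add: divide_right_mono powr_mono2)
      then have "ennreal (\<bar>g x\<bar> powr p / norm x powr (2 * a)) \<le> ennreal (M powr p) * ennreal (1 / norm x powr (2 * a))"
        by (simp add: ennreal_mult[symmetric] ennreal_leI)
      then show ?thesis by (cases "norm x < R") auto
    qed
    have "(\<integral>\<^sup>+x. ennreal (\<bar>g x\<bar> powr p / norm (x :: real ^ 'n) powr (2 * a)) * indicator {x. norm x < R} x \<partial>lborel) \<le>
      ennreal (M powr p) * (\<integral>\<^sup>+x. ennreal (1 / norm (x :: real ^ 'n) powr (2 * a)) * indicator {x. norm x < R} x \<partial>lborel)"
      by (rule order_trans[OF nn_integral_mono[OF pt]]) (subst nn_integral_cmult, measurable)
    also have "\<dots> \<le> ennreal (M powr p) * ennreal (C * R powr (N - 2 * a))"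
      by (intro mult_left_mono C R) simp
    finally show "(\<integral>\<^sup>+x. ennreal (\<bar>g x\<bar> powr p / norm (x :: real ^ 'n) powr (2 * a)) * indicator {x. norm x < R} x \<partial>lborel)
       \<le> ennreal (M powr p * (C * R powr (N - 2 * a)))"
      using C(1) by (simp add: ennreal_mult)
  qed
qed

text \<open>With \<open>R = 1 / real (Suc k)\<close>, the volume factor
  \<open>R powr (N - 2 * a)\<close> beats \<open>R powr (- (s * p))\<close>: the exponent left over,
  \<open>N - 2 * a - s * p\<close>, is positive.\<close>

lemma cutoff_at_zero_tendsto:
  assumes M: "\<And>x. \<bar>u x\<bar> \<le> M" and D: "0 \<le> D"
  shows "(\<lambda>k. ennreal (D * (1 / real (Suc k)) powr (- (s * p))) *
     (\<integral>\<^sup>+x. ennreal (\<bar>u x\<bar> powr p / norm (x :: real ^ 'n) powr (2 * a)) * indicator {x. norm x < 2 * (1 / real (Suc k))} x \<partial>lborel)) \<longlonglongrightarrow> 0"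
proof -
  obtain C where C: "0 \<le> C"
    "\<And>R g M. 0 < R \<Longrightarrow> (\<And>x. \<bar>g x\<bar> \<le> M) \<Longrightarrow>
     (\<integral>\<^sup>+x. ennreal (\<bar>g x\<bar> powr p / norm (x :: real ^ 'n) powr (2 * a)) * indicator {x. norm x < R} x \<partial>lborel)
       \<le> ennreal (M powr p * (C * R powr (N - 2 * a)))"
    using weighted_power_near by blast
  define B where "B = D * (M powr p * (C * 2 powr (N - 2 * a)))"
  have bound: "ennreal (D * R powr (- (s * p))) *
     (\<integral>\<^sup>+x. ennreal (\<bar>u x\<bar> powr p / norm (x :: real ^ 'n) powr (2 * a)) * indicator {x. norm x < 2 * R} x \<partial>lborel)
     \<le> ennreal (B * R powr (N - 2 * a - s * p))" if R: "0 < R" for R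
  proof -
    have "ennreal (D * R powr (- (s * p))) *
     (\<integral>\<^sup>+x. ennreal (\<bar>u x\<bar> powr p / norm (x :: real ^ 'n) powr (2 * a)) * indicator {x. norm x < 2 * R} x \<partial>lborel)
     \<le> ennreal (D * R powr (- (s * p))) * ennreal (M powr p * (C * (2 * R) powr (N - 2 * a)))"
      using R by (intro mult_left_mono C M) auto
    also have "\<dots> = ennreal ((D * R powr (- (s * p))) * (M powr p * (C * (2 * R) powr (N - 2 * a))))"
      using D by (subst ennreal_mult') auto
    also have "(D * R powr (- (s * p))) * (M powr p * (C * (2 * R) powr (N - 2 * a))) =
      B * (R powr (- (s * p)) * R powr (N - 2 * a))"
      using R by (simp add: B_def powr_mult)
    also have "R powr (- (s * p)) * R powr (N - 2 * a) = R powr (N - 2 * a - s * p)"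
      by (simp add: powr_add[symmetric] add.commute)
    finally show ?thesis .
  qed
  have "(\<lambda>k. (1 / real (Suc k)) powr (N - 2 * a - s * p)) \<longlonglongrightarrow> 0 powr (N - 2 * a - s * p)"
    using N_sp LIMSEQ_inverse_real_of_nat
    by (intro tendsto_powr2) (auto simp: inverse_eq_divide)
  then have "(\<lambda>k. B * (1 / real (Suc k)) powr (N - 2 * a - s * p)) \<longlonglongrightarrow> B * 0"
    by (intro tendsto_mult tendsto_const) simp
  then have "(\<lambda>k. ennreal (B * (1 / real (Suc k)) powr (N - 2 * a - s * p))) \<longlonglongrightarrow> ennreal (B * 0)"
    by (rule tendsto_ennrealI)
  then have lim: "(\<lambda>k. ennreal (B * (1 / real (Suc k)) powr (N - 2 * a - s * p))) \<longlonglongrightarrow> 0"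
    by (simp only: mult_zero_right ennreal_0)
  show ?thesis
    by (rule tendsto_ennreal_zero_le[OF lim bound]) (simp only: zero_less_divide_1_iff of_nat_0_less_iff zero_less_Suc)
qed

text \<open>Let \<open>f\<close> be the integrand, so that \<open>f powr (q / p)\<close> is the
  density of \<open>mass\<close>. Over a fixed ball of radius \<open>m\<close> the integral of
  \<open>f\<close> is finite, and the prefactor sends it to 0. Outside that ball,
  \<open>young_threshold\<close> with a threshold adapted to \<open>R\<close> leads to a bound free
  of \<open>R\<close>: a small multiple of a volume plus a possibly large multiple of the tail of
  \<open>mass\<close>.\<close>

lemma cutoff_at_infinity_tendsto:
  assumes u [measurable]: "u \<in> borel_measurable borel" and fin: "mass u < \<infinity>" and D: "0 \<le> D"
  shows "(\<lambda>k. ennreal (D * real (Suc k) powr (- (s * p))) *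
     (\<integral>\<^sup>+x. ennreal (\<bar>u x\<bar> powr p / norm (x :: real ^ 'n) powr (2 * a)) * indicator {x. norm x < 2 * real (Suc k)} x \<partial>lborel)) \<longlonglongrightarrow> 0"
proof -
  define f where "f x = \<bar>u x\<bar> powr p / norm x powr (2 * a)" for x
  have f0: "0 \<le> f x" for x by (simp add: f_def)
  have [measurable]: "f \<in> borel_measurable borel" unfolding f_def[abs_def] by measurable
  \<comment> \<open>The third fact below about \<open>r\<close> is the one by which
    \<open>t powr (1 - r)\<close> will cancel \<open>R powr (- (s * p))\<close>.\<close>
  define r where "r = q / p"
  have r: "1 < r" "p * r = q" "(s * p - N) * (1 - r) = s * p"
  proof -
    show "1 < r" "p * r = q" using q_gt(1) p by (simp_all add: r_def)
    have "r = N / (N - s * p)" using q_gt by (simp add: r_def)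
    then have "(N - s * p) * r = N" using N_sp by simp
    then show "(s * p - N) * (1 - r) = s * p" by (simp add: algebra_simps)
  qed
  have fr: "f x powr r = \<bar>u x\<bar> powr q / norm x powr (2 * a * q / p)" for x
  proof -
    have "f x powr r = \<bar>u x\<bar> powr (p * r) / norm x powr (2 * a * r)"
      by (simp only: f_def powr_divide powr_powr abs_ge_zero powr_ge_zero)
    then show ?thesis by (simp only: r(2)) (simp add: r_def)
  qed
  have T_fin: "(\<integral>\<^sup>+x. ennreal (f x powr r) \<partial>lborel) < \<infinity>"
    using fin by (simp only: mass_def fr)
  define T where "T m = (\<integral>\<^sup>+x. ennreal (f x powr r) * indicator {x. real m \<le> norm x} x \<partial>lborel)" for m :: nat
  have T: "T \<longlonglongrightarrow> 0"
  proof -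
    have "(\<lambda>m. \<integral>\<^sup>+x. ennreal (f x powr r) * indicator {x. real m \<le> norm x} x \<partial>lborel) \<longlonglongrightarrow>
      (\<integral>\<^sup>+x. 0 \<partial>(lborel :: (real ^ 'n) measure))"
    proof (rule nn_integral_dominated_convergence[OF _ _ _ _ T_fin])
      show "AE x in lborel. ennreal (f x powr r) * indicator {x. real m \<le> norm x} x \<le> ennreal (f x powr r)" for m
        by (intro AE_I2) (simp add: indicator_def)
      show "AE x in lborel. (\<lambda>m. ennreal (f x powr r) * indicator {x. real m \<le> norm x} x) \<longlonglongrightarrow> 0"
      proof (rule AE_I2)
        fix x :: "real ^ 'n"
        obtain m where "norm x < real m" using reals_Archimedean2 by blast
        then have "\<forall>\<^sub>F k in sequentially. ennreal (f x powr r) * indicator {x. real k \<le> norm x} x = 0"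
          by (intro eventually_sequentiallyI[of m]) auto
        then show "(\<lambda>m. ennreal (f x powr r) * indicator {x. real m \<le> norm x} x) \<longlonglongrightarrow> 0"
          by (rule tendsto_eventually)
      qed
    qed measurable
    then show ?thesis by (simp add: T_def[abs_def])
  qed
  define I where "I m = (\<integral>\<^sup>+x. ennreal (f x) * indicator {x. norm x < real m} x \<partial>lborel)" for m :: nat
  have I_fin: "I m < \<infinity>" for m
  proof -
    have [measurable]: "ball (0 :: real ^ 'n) (real m) \<in> sets borel" by simp
    \<comment> \<open>For mere finiteness the threshold 1 is enough.\<close>
    have "ennreal (f x) * indicator {x. norm x < real m} x \<le> indicator (ball 0 (real m)) x + ennreal (f x powr r)" for x
    proof (cases "norm x < real m")
      case True
      have "f x \<le> 1 + f x powr r" using young_threshold[OF f0, of 1 r x] r by simp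
      then have "ennreal (f x) \<le> ennreal 1 + ennreal (f x powr r)"
        by (simp add: ennreal_plus[symmetric] ennreal_leI del: ennreal_plus ennreal_1)
      then show ?thesis using True by simp
    qed simp
    then have "I m \<le> (\<integral>\<^sup>+x. indicator (ball (0 :: real ^ 'n) (real m)) x + ennreal (f x powr r) \<partial>lborel)"
      unfolding I_def by (rule nn_integral_mono)
    also have "\<dots> = emeasure lborel (ball (0 :: real ^ 'n) (real m)) + (\<integral>\<^sup>+x. ennreal (f x powr r) \<partial>lborel)"
      by (simp add: nn_integral_add)
    also have "\<dots> < \<infinity>" using T_fin emeasure_lborel_ball_finite[of "0 :: real ^ 'n" "real m"] by simp
    finally show ?thesis .
  qed
  define V where "V = unit_ball_vol N * 2 powr N"
  have V: "0 \<le> V" using N by (simp add: V_def)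
  have ball: "emeasure lborel (ball (0 :: real ^ 'n) (2 * R)) = ennreal (V * R powr N)" if "0 < R" for R
  proof -
    have "(2 * R) ^ CARD('n) = (2 * R) powr N" using that by (simp only: N powr_realpow mult_pos_pos zero_less_numeral)
    then show ?thesis using that by (simp add: emeasure_ball DIM_N V_def powr_mult N)
  qed
  have split: "ennreal (R powr (- (s * p))) * (\<integral>\<^sup>+x. ennreal (f x) * indicator {x. norm x < 2 * R} x \<partial>lborel) \<le>
      ennreal (R powr (- (s * p))) * I m + (ennreal (\<delta> * V) + ennreal (\<delta> powr (1 - r)) * T m)"
    if R: "0 < R" and \<delta>: "0 < \<delta>" for R \<delta> m
  proof -
    have [measurable]: "ball (0 :: real ^ 'n) (2 * R) \<in> sets borel" by simp
    \<comment> \<open>The power \<open>s * p - N\<close> balances the ball volume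
      \<open>V * R powr N\<close> against \<open>R powr (- (s * p))\<close>. The two Young terms
      become \<open>\<delta> * V\<close> and \<open>\<delta> powr (1 - r) * T m\<close>, neither of
      which involves \<open>R\<close>.\<close>
    define t where "t = \<delta> * R powr (s * p - N)"
    have t: "0 < t" using R \<delta> by (simp add: t_def)
    have tr: "t powr (1 - r) = \<delta> powr (1 - r) * R powr (s * p)"
      using R \<delta> by (simp add: t_def powr_mult powr_powr r(3))
    have pt: "ennreal (f x) * indicator {x. norm x < 2 * R} x \<le>
      ennreal (f x) * indicator {x. norm x < real m} x + (ennreal t * indicator (ball 0 (2 * R)) x +
       ennreal (t powr (1 - r)) * (ennreal (f x powr r) * indicator {x. real m \<le> norm x} x))" for x
    proof (cases "norm x < 2 * R \<and> \<not> norm x < real m")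
      case True
      have "ennreal (f x) \<le> ennreal (t + t powr (1 - r) * f x powr r)"
        using r by (intro ennreal_leI young_threshold f0 t) simp
      also have "\<dots> = ennreal t + ennreal (t powr (1 - r)) * ennreal (f x powr r)"
        using t by (simp add: ennreal_mult)
      finally show ?thesis using True by simp
    next
      case False
      then show ?thesis by (cases "norm x < 2 * R") (auto intro: add_increasing2)
    qed
    have "(\<integral>\<^sup>+x. ennreal (f x) * indicator {x. norm x < 2 * R} x \<partial>lborel) \<le>
      I m + (ennreal t * emeasure lborel (ball (0 :: real ^ 'n) (2 * R)) + ennreal (t powr (1 - r)) * T m)"
      by (rule order_trans[OF nn_integral_mono[OF pt]])
        (simp add: nn_integral_add nn_integral_cmult nn_integral_cmult_indicator I_def T_def)
    then have "ennreal (R powr (- (s * p))) * (\<integral>\<^sup>+x. ennreal (f x) * indicator {x. norm x < 2 * R} x \<partial>lborel) \<le>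
      ennreal (R powr (- (s * p))) * (I m + (ennreal t * emeasure lborel (ball (0 :: real ^ 'n) (2 * R)) + ennreal (t powr (1 - r)) * T m))"
      by (rule mult_left_mono) simp
    also have "\<dots> = ennreal (R powr (- (s * p))) * I m + (ennreal (R powr (- (s * p))) * ennreal t * ennreal (V * R powr N) +
       ennreal (R powr (- (s * p))) * ennreal (t powr (1 - r)) * T m)"
      by (simp only: ball[OF R] distrib_left mult.assoc)
    also have "ennreal (R powr (- (s * p))) * ennreal t * ennreal (V * R powr N) = ennreal (\<delta> * V)"
    proof -
      have "R powr (- (s * p)) * t * (V * R powr N) = \<delta> * V * (R powr (- (s * p)) * R powr (s * p - N) * R powr N)"
        by (simp add: t_def)
      also have "R powr (- (s * p)) * R powr (s * p - N) * R powr N = 1"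
        using R by (simp add: powr_add[symmetric])
      finally have eq: "R powr (- (s * p)) * t * (V * R powr N) = \<delta> * V" by simp
      have "ennreal (R powr (- (s * p))) * ennreal t * ennreal (V * R powr N) =
          ennreal (R powr (- (s * p)) * t * (V * R powr N))"
        using t V by (simp only: ennreal_mult[symmetric] mult_nonneg_nonneg powr_ge_zero less_imp_le)
      then show ?thesis unfolding eq .
    qed
    also have "ennreal (R powr (- (s * p))) * ennreal (t powr (1 - r)) = ennreal (\<delta> powr (1 - r))"
    proof -
      have "R powr (- (s * p)) * t powr (1 - r) = \<delta> powr (1 - r) * (R powr (- (s * p)) * R powr (s * p))"
        by (simp add: tr)
      also have "R powr (- (s * p)) * R powr (s * p) = 1" using R by (simp add: powr_add[symmetric])
      finally have eq: "R powr (- (s * p)) * t powr (1 - r) = \<delta> powr (1 - r)" by simp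
      have "ennreal (R powr (- (s * p))) * ennreal (t powr (1 - r)) = ennreal (R powr (- (s * p)) * t powr (1 - r))"
        by (rule ennreal_mult[symmetric]) auto
      then show ?thesis unfolding eq .
    qed
    finally show ?thesis .
  qed
  have lim: "(\<lambda>k. ennreal (real (Suc k) powr (- (s * p))) *
     (\<integral>\<^sup>+x. ennreal (f x) * indicator {x. norm x < 2 * real (Suc k)} x \<partial>lborel)) \<longlonglongrightarrow> 0"
  proof (rule tendsto_ennreal_zeroI)
    fix e :: real assume e: "0 < e"
    \<comment> \<open>The order of choices matters: \<open>\<delta>\<close> fixes the possibly large
      factor \<open>\<delta> powr (1 - r)\<close>, then \<open>m\<close> makes the tail compensate
      it, and only then does \<open>k\<close> grow.\<close>
    define \<delta> where "\<delta> = e / (3 * (V + 1))"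
    have \<delta>: "0 < \<delta>" "\<delta> * V \<le> e / 3" using e V by (auto simp: \<delta>_def field_simps)
    have "0 < ennreal (e / 3 / \<delta> powr (1 - r))" using e \<delta> by simp
    from order_tendstoD(2)[OF T this] obtain m where m: "T m < ennreal (e / 3 / \<delta> powr (1 - r))"
      by (auto simp: eventually_sequentially)
    have 3: "ennreal (\<delta> powr (1 - r)) * T m \<le> ennreal (e / 3)"
    proof -
      have "ennreal (\<delta> powr (1 - r)) * T m \<le> ennreal (\<delta> powr (1 - r)) * ennreal (e / 3 / \<delta> powr (1 - r))"
        using m by (intro mult_left_mono) auto
      also have "\<dots> = ennreal (e / 3)" using \<delta> e by (simp add: ennreal_mult[symmetric])
      finally show ?thesis .
    qed
    obtain i where i: "I m = ennreal i" "0 \<le> i" using I_fin[of m] by (cases "I m") auto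
    have "(\<lambda>k. real (Suc k) powr (- (s * p))) \<longlonglongrightarrow> 0"
      using sp_pos by (intro tendsto_neg_powr filterlim_compose[OF filterlim_real_sequentially filterlim_Suc]) auto
    then have "(\<lambda>k. real (Suc k) powr (- (s * p)) * i) \<longlonglongrightarrow> 0 * i"
      by (intro tendsto_mult tendsto_const)
    then have "\<forall>\<^sub>F k in sequentially. real (Suc k) powr (- (s * p)) * i < e / 3"
      by (rule order_tendstoD(2)) (use e in simp)
    then show "\<forall>\<^sub>F k in sequentially. ennreal (real (Suc k) powr (- (s * p))) *
     (\<integral>\<^sup>+x. ennreal (f x) * indicator {x. norm x < 2 * real (Suc k)} x \<partial>lborel) \<le> ennreal e"
    proof eventually_elim
      case (elim k)
      have "ennreal (real (Suc k) powr (- (s * p))) * I m \<le> ennreal (e / 3)"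
        using elim i by (simp add: ennreal_mult[symmetric] ennreal_leI del: of_nat_Suc)
      have "ennreal (real (Suc k) powr (- (s * p))) * (\<integral>\<^sup>+x. ennreal (f x) * indicator {x. norm x < 2 * real (Suc k)} x \<partial>lborel)
        \<le> ennreal (real (Suc k) powr (- (s * p))) * I m + (ennreal (\<delta> * V) + ennreal (\<delta> powr (1 - r)) * T m)"
        by (rule split) (simp_all only: \<delta> of_nat_0_less_iff zero_less_Suc)
      also have "\<dots> \<le> ennreal (e / 3) + (ennreal (e / 3) + ennreal (e / 3))"
        by (intro add_mono 3 ennreal_leI \<delta>) fact
      also have "\<dots> = ennreal e" using e by (simp add: ennreal_plus[symmetric] del: ennreal_plus)
      finally show ?case .
    qed
  qed
  have eq: "ennreal (D * real (Suc k) powr (- (s * p))) * X = ennreal D * (ennreal (real (Suc k) powr (- (s * p))) * X)" for k X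
    using D by (simp add: ennreal_mult mult.assoc)
  have "(\<lambda>k. ennreal D * (ennreal (real (Suc k) powr (- (s * p))) *
     (\<integral>\<^sup>+x. ennreal (f x) * indicator {x. norm x < 2 * real (Suc k)} x \<partial>lborel))) \<longlonglongrightarrow> ennreal D * 0"
    by (rule ennreal_tendsto_cmult[OF _ lim]) simp
  then show ?thesis unfolding eq f_def by (simp only: mult_zero_right)
qed

text \<open>A difference of \<open>(1 - c k x) * u x\<close> splits into \<open>u x - u y\<close>
  with a factor between 0 and 1, which dominated convergence handles, and a commutator. As
  \<open>c k\<close> is a product of an outer and an inner cutoff, the commutator is bounded by two
  terms, with radii tending to infinity and to 0.\<close>

lemma annular_cutoff_tendsto:
  assumes u [measurable]: "u \<in> borel_measurable borel" and M: "\<And>x. \<bar>u x\<bar> \<le> M"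
    and fin: "energy u < \<infinity>" "mass u < \<infinity>"
  defines "c \<equiv> \<lambda>k x. radial_cutoff (real (Suc k)) x * (1 - radial_cutoff (1 / real (Suc k)) x)"
  shows "(\<lambda>k. energy (\<lambda>x. u x - c k x * u x)) \<longlonglongrightarrow> 0"
    and "(\<lambda>k. mass (\<lambda>x. u x - c k x * u x)) \<longlonglongrightarrow> 0"
proof -
  let ?R = "\<lambda>k. real (Suc k)" and ?r = "\<lambda>k. 1 / real (Suc k)"
  have Rr: "0 < ?R k" "0 < ?r k" for k by simp_all
  have [measurable]: "c k \<in> borel_measurable borel" for k
    unfolding c_def by measurable
  have c01: "0 \<le> c k x" "c k x \<le> 1" for k x
    using radial_cutoff_bounds[of "?R k" x] radial_cutoff_bounds[of "?r k" x]
    by (simp_all add: c_def mult_le_one)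
  have c_lim: "(\<lambda>k. 1 - c k x) \<longlonglongrightarrow> 0" if x: "x \<noteq> 0" for x :: "real ^ 'n"
  proof (rule tendsto_eventually)
    obtain m where m: "norm x < real m" using reals_Archimedean2 by blast
    obtain j where j: "2 / norm x < real j" using reals_Archimedean2 by blast
    show "\<forall>\<^sub>F k in sequentially. 1 - c k x = 0"
    proof (rule eventually_sequentiallyI[of "max m j"])
      fix k assume "max m j \<le> k"
      then have k: "real m \<le> real k" "real j \<le> real k" by simp_all
      have "radial_cutoff (?R k) x = 1" using m k by (intro radial_cutoff_eq_1) auto
      moreover have "2 * ?r k \<le> norm x"
      proof -
        have "2 / norm x \<le> ?R k" using j k by simp
        then show ?thesis using x by (simp add: field_simps del: of_nat_Suc)
      qed
      then have "radial_cutoff (?r k) x = 0" by (intro radial_cutoff_eq_0 Rr)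
      ultimately show "1 - c k x = 0" by (simp add: c_def)
    qed
  qed
  show "(\<lambda>k. mass (\<lambda>x. u x - c k x * u x)) \<longlonglongrightarrow> 0"
  proof (rule mass_tendsto_0[OF u _ fin(2)])
    fix k x
    have "u x - c k x * u x = (1 - c k x) * u x" by (simp add: algebra_simps)
    then show "\<bar>u x - c k x * u x\<bar> \<le> \<bar>u x\<bar>"
      using c01[of k x] by (simp add: abs_mult mult_left_le_one_le)
  next
    fix x :: "real ^ 'n" assume "x \<noteq> 0"
    from tendsto_mult[OF c_lim[OF this] tendsto_const[of "u x"]]
    show "(\<lambda>k. u x - c k x * u x) \<longlonglongrightarrow> 0" by (simp add: algebra_simps)
  qed measurable
  obtain C where C: "0 \<le> C"
    "\<And>R g \<eta>. 0 < R \<Longrightarrow> g \<in> borel_measurable borel \<Longrightarrow> \<eta> \<in> borel_measurable borel \<Longrightarrow>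
      (\<And>x y. \<bar>\<eta> x - \<eta> y\<bar> \<le> min 1 (norm (x - y) / R)) \<Longrightarrow> (\<And>x. 2 * R \<le> norm x \<Longrightarrow> \<eta> x = 0) \<Longrightarrow>
      (\<integral>\<^sup>+z. ennreal (\<bar>min \<bar>g (fst z)\<bar> \<bar>g (snd z)\<bar> * (\<eta> (fst z) - \<eta> (snd z))\<bar> powr p * ker (fst z) (snd z)) \<partial>(lborel \<Otimes>\<^sub>M lborel))
      \<le> ennreal (C * R powr (- (s * p))) *
         (\<integral>\<^sup>+x. ennreal (\<bar>g x\<bar> powr p / norm x powr (2 * a)) * indicator {x. norm x < 2 * R} x \<partial>lborel)"
    using cutoff_energy by blast
  define P where "P f = (\<integral>\<^sup>+z. ennreal (\<bar>f z\<bar> powr p * ker (fst z) (snd z)) \<partial>(lborel \<Otimes>\<^sub>M lborel))"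
    for f :: "(real ^ 'n) \<times> (real ^ 'n) \<Rightarrow> real"
  \<comment> \<open>The maximum makes the bound symmetric: the point at which \<open>1 - c k\<close>
    multiplies \<open>u x - u y\<close> depends on which of the two values of \<open>u\<close> is
    smaller in modulus.\<close>
  define A where "A k z = max (1 - c k (fst z)) (1 - c k (snd z)) * (u (fst z) - u (snd z))" for k z
  define B where "B R z = min \<bar>u (fst z)\<bar> \<bar>u (snd z)\<bar> * (radial_cutoff R (fst z) - radial_cutoff R (snd z))" for R z
  have [measurable]: "A k \<in> borel_measurable (borel \<Otimes>\<^sub>M borel)" "B R \<in> borel_measurable (borel \<Otimes>\<^sub>M borel)" for k R
    unfolding A_def[abs_def] B_def[abs_def] by measurable
  have lim_A: "(\<lambda>k. P (A k)) \<longlonglongrightarrow> 0"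
    unfolding P_def
  proof (rule pair_integral_tendsto_0[OF u _ fin(1)])
    fix k z
    have "\<bar>max (1 - c k (fst z)) (1 - c k (snd z))\<bar> \<le> 1"
      using c01[of k "fst z"] c01[of k "snd z"] by simp
    then show "\<bar>A k z\<bar> \<le> \<bar>u (fst z) - u (snd z)\<bar>"
      unfolding A_def abs_mult by (intro mult_left_le_one_le) auto
  next
    fix z :: "(real ^ 'n) \<times> (real ^ 'n)" assume z: "fst z \<noteq> 0" "snd z \<noteq> 0"
    have "(\<lambda>k. max (1 - c k (fst z)) (1 - c k (snd z)) * (u (fst z) - u (snd z))) \<longlonglongrightarrow> max 0 0 * (u (fst z) - u (snd z))"
      by (intro tendsto_mult tendsto_const tendsto_max c_lim z)
    then show "(\<lambda>k. A k z) \<longlonglongrightarrow> 0" by (simp add: A_def)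
  qed measurable
  \<comment> \<open>Differences of \<open>1 - radial_cutoff R x\<close> are those of
    \<open>radial_cutoff R x\<close> up to sign, so one estimate serves the outer and the inner
    radius.\<close>
  have P_B: "P (B R) \<le> ennreal (C * R powr (- (s * p))) *
         (\<integral>\<^sup>+x. ennreal (\<bar>u x\<bar> powr p / norm x powr (2 * a)) * indicator {x. norm x < 2 * R} x \<partial>lborel)" if "0 < R" for R
    unfolding P_def B_def
    by (rule C(2)[OF that u radial_cutoff_measurable radial_cutoff_diff[OF that] radial_cutoff_eq_0[OF that]])
  have lim_R: "(\<lambda>k. P (B (?R k))) \<longlonglongrightarrow> 0"
    by (rule tendsto_ennreal_zero_le[OF cutoff_at_infinity_tendsto[OF u fin(2) C(1)] P_B[OF Rr(1)]])
  have lim_r: "(\<lambda>k. P (B (?r k))) \<longlonglongrightarrow> 0"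
    by (rule tendsto_ennreal_zero_le[OF cutoff_at_zero_tendsto[OF M C(1)] P_B[OF Rr(2)]])
  have pt: "\<bar>(u x - c k x * u x) - (u y - c k y * u y)\<bar> \<le> \<bar>A k (x, y)\<bar> + (\<bar>B (?R k) (x, y)\<bar> + \<bar>B (?r k) (x, y)\<bar>)" for k x y
  proof -
    let ?b = "\<lambda>x. 1 - c k x" and ?D = "\<lambda>R. \<bar>radial_cutoff R x - radial_cutoff R y\<bar>"
    have cd: "\<bar>c k x - c k y\<bar> \<le> ?D (?R k) + ?D (?r k)"
    proof -
      \<comment> \<open>Product rule for differences, with one cutoff evaluated at \<open>x\<close>
        and the other at \<open>y\<close>; the factors that remain are at most 1.\<close>
      have "c k x - c k y = (radial_cutoff (?R k) x - radial_cutoff (?R k) y) * (1 - radial_cutoff (?r k) x)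
         - radial_cutoff (?R k) y * (radial_cutoff (?r k) x - radial_cutoff (?r k) y)"
        by (simp add: c_def algebra_simps)
      also have "\<bar>\<dots>\<bar> \<le> ?D (?R k) * \<bar>1 - radial_cutoff (?r k) x\<bar> + \<bar>radial_cutoff (?R k) y\<bar> * ?D (?r k)"
        by (simp only: abs_mult[symmetric] abs_triangle_ineq4)
      also have "\<dots> \<le> ?D (?R k) + ?D (?r k)"
        using radial_cutoff_bounds[of "?R k" y] radial_cutoff_bounds[of "?r k" x]
        by (intro add_mono mult_right_le_one_le mult_left_le_one_le) auto
      finally show ?thesis .
    qed
    have half: "\<bar>?b x * u x - ?b y * u y\<bar> \<le> max (?b x) (?b y) * \<bar>u x - u y\<bar> + min \<bar>u x\<bar> \<bar>u y\<bar> * \<bar>c k x - c k y\<bar>"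
    proof (cases "\<bar>u x\<bar> \<le> \<bar>u y\<bar>")
      case True
      \<comment> \<open>The product rule is arranged so that the value of \<open>u\<close> in front
        of \<open>c k y - c k x\<close> is the smaller one.\<close>
      have "?b x * u x - ?b y * u y = ?b y * (u x - u y) + u x * (c k y - c k x)"
        by (simp add: algebra_simps)
      then have "\<bar>?b x * u x - ?b y * u y\<bar> \<le> \<bar>?b y * (u x - u y)\<bar> + \<bar>u x * (c k y - c k x)\<bar>"
        by (simp only: abs_triangle_ineq)
      also have "\<dots> = ?b y * \<bar>u x - u y\<bar> + \<bar>u x\<bar> * \<bar>c k x - c k y\<bar>"
        using c01[of k y] by (simp add: abs_mult abs_minus_commute)
      also have "\<dots> \<le> max (?b x) (?b y) * \<bar>u x - u y\<bar> + min \<bar>u x\<bar> \<bar>u y\<bar> * \<bar>c k x - c k y\<bar>"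
        using True by (intro add_mono mult_right_mono) auto
      finally show ?thesis .
    next
      case False
      have "?b x * u x - ?b y * u y = ?b x * (u x - u y) + u y * (c k y - c k x)"
        by (simp add: algebra_simps)
      then have "\<bar>?b x * u x - ?b y * u y\<bar> \<le> \<bar>?b x * (u x - u y)\<bar> + \<bar>u y * (c k y - c k x)\<bar>"
        by (simp only: abs_triangle_ineq)
      also have "\<dots> = ?b x * \<bar>u x - u y\<bar> + \<bar>u y\<bar> * \<bar>c k x - c k y\<bar>"
        using c01[of k x] by (simp add: abs_mult abs_minus_commute)
      also have "\<dots> \<le> max (?b x) (?b y) * \<bar>u x - u y\<bar> + min \<bar>u x\<bar> \<bar>u y\<bar> * \<bar>c k x - c k y\<bar>"
        using False by (intro add_mono mult_right_mono) auto
      finally show ?thesis .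
    qed
    have m0: "0 \<le> min \<bar>u x\<bar> \<bar>u y\<bar>" "0 \<le> max (?b x) (?b y)" using c01[of k x] by auto
    have "min \<bar>u x\<bar> \<bar>u y\<bar> * \<bar>c k x - c k y\<bar> \<le> min \<bar>u x\<bar> \<bar>u y\<bar> * (?D (?R k) + ?D (?r k))"
      by (rule mult_left_mono[OF cd m0(1)])
    with half have "\<bar>?b x * u x - ?b y * u y\<bar> \<le> max (?b x) (?b y) * \<bar>u x - u y\<bar> +
       (min \<bar>u x\<bar> \<bar>u y\<bar> * ?D (?R k) + min \<bar>u x\<bar> \<bar>u y\<bar> * ?D (?r k))"
      by (simp only: distrib_left)
    also have "\<dots> = \<bar>A k (x, y)\<bar> + (\<bar>B (?R k) (x, y)\<bar> + \<bar>B (?r k) (x, y)\<bar>)"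
      by (simp only: A_def B_def abs_mult fst_conv snd_conv abs_of_nonneg[OF m0(1)] abs_of_nonneg[OF m0(2)])
    finally show ?thesis by (simp add: algebra_simps)
  qed
  have bound: "energy (\<lambda>x. u x - c k x * u x) \<le>
     ennreal (2 powr p) * (P (A k) + ennreal (2 powr p) * (P (B (?R k)) + P (B (?r k))))" for k
  proof -
    have "energy (\<lambda>x. u x - c k x * u x) \<le> ennreal (2 powr p) * (P (A k) + P (\<lambda>z. \<bar>B (?R k) z\<bar> + \<bar>B (?r k) z\<bar>))"
      unfolding energy_def P_def
    proof (rule pair_integral_add_le)
      fix z
      show "\<bar>u (fst z) - c k (fst z) * u (fst z) - (u (snd z) - c k (snd z) * u (snd z))\<bar> \<le>
        \<bar>A k z\<bar> + \<bar>\<bar>B (?R k) z\<bar> + \<bar>B (?r k) z\<bar>\<bar>"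
        using pt[where x="fst z" and y="snd z" and k=k] by simp
    qed measurable
    also have "P (\<lambda>z. \<bar>B (?R k) z\<bar> + \<bar>B (?r k) z\<bar>) \<le> ennreal (2 powr p) * (P (B (?R k)) + P (B (?r k)))"
      unfolding P_def by (rule pair_integral_add_le) simp_all
    finally show ?thesis by (simp add: mult_left_mono add_left_mono)
  qed
  have "(\<lambda>k. ennreal (2 powr p) * (P (A k) + ennreal (2 powr p) * (P (B (?R k)) + P (B (?r k))))) \<longlonglongrightarrow>
     ennreal (2 powr p) * (0 + ennreal (2 powr p) * (0 + 0))"
    by (intro ennreal_tendsto_cmult tendsto_add lim_A lim_R lim_r) simp_all
  then have "(\<lambda>k. ennreal (2 powr p) * (P (A k) + ennreal (2 powr p) * (P (B (?R k)) + P (B (?r k))))) \<longlonglongrightarrow> 0"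
    by simp
  then show "(\<lambda>k. energy (\<lambda>x. u x - c k x * u x)) \<longlonglongrightarrow> 0"
    by (rule tendsto_ennreal_zero_le[OF _ bound])
qed

section \<open>Combining truncation and cutoff\<close>

lemma energy_diff_commute: "energy (\<lambda>x. u x - v x) = energy (\<lambda>x. v x - u x)"
  by (intro antisym energy_mono) (simp_all add: abs_if)

lemma mass_diff_commute: "mass (\<lambda>x. u x - v x) = mass (\<lambda>x. v x - u x)"
  by (intro antisym mass_mono) (simp_all add: abs_minus_commute)

text \<open>One tolerance is used for energy and mass alike: since \<open>p < q\<close>, the
  constant \<open>2 powr q\<close> also covers the triangle inequality of the energy.\<close>

lemma energy_diff_le:
  assumes [measurable]: "u \<in> borel_measurable borel" "v \<in> borel_measurable borel" "w \<in> borel_measurable borel"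
    and e: "0 < e" "energy (\<lambda>x. u x - v x) \<le> ennreal (e / (2 * 2 powr q))" "energy (\<lambda>x. v x - w x) \<le> ennreal (e / (2 * 2 powr q))"
  shows "energy (\<lambda>x. u x - w x) \<le> ennreal e"
proof -
  have "energy (\<lambda>x. u x - w x) \<le> ennreal (2 powr p) * (energy (\<lambda>x. u x - v x) + energy (\<lambda>x. v x - w x))"
    by (rule energy_triangle) measurable
  also have "\<dots> \<le> ennreal (2 powr q) * (ennreal (e / (2 * 2 powr q)) + ennreal (e / (2 * 2 powr q)))"
    using q_gt by (intro mult_mono add_mono ennreal_leI powr_mono e) auto
  also have "\<dots> = ennreal (2 powr q * (e / (2 * 2 powr q) + e / (2 * 2 powr q)))"
    using e(1) by (simp add: ennreal_mult[symmetric] ennreal_plus[symmetric] del: ennreal_plus)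
  also have "2 powr q * (e / (2 * 2 powr q) + e / (2 * 2 powr q)) = e" by (simp add: field_simps)
  finally show ?thesis .
qed

lemma mass_diff_le:
  assumes [measurable]: "u \<in> borel_measurable borel" "v \<in> borel_measurable borel" "w \<in> borel_measurable borel"
    and e: "0 < e" "mass (\<lambda>x. u x - v x) \<le> ennreal (e / (2 * 2 powr q))" "mass (\<lambda>x. v x - w x) \<le> ennreal (e / (2 * 2 powr q))"
  shows "mass (\<lambda>x. u x - w x) \<le> ennreal e"
proof -
  have "mass (\<lambda>x. u x - w x) \<le> ennreal (2 powr q) * (mass (\<lambda>x. u x - v x) + mass (\<lambda>x. v x - w x))"
    by (rule mass_triangle) measurable
  also have "\<dots> \<le> ennreal (2 powr q) * (ennreal (e / (2 * 2 powr q)) + ennreal (e / (2 * 2 powr q)))"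
    by (intro mult_left_mono add_mono e) auto
  also have "\<dots> = ennreal (2 powr q * (e / (2 * 2 powr q) + e / (2 * 2 powr q)))"
    using e(1) by (simp add: ennreal_mult[symmetric] ennreal_plus[symmetric] del: ennreal_plus)
  also have "2 powr q * (e / (2 * 2 powr q) + e / (2 * 2 powr q)) = e" by (simp add: field_simps)
  finally show ?thesis .
qed

lemma approx_bounded_annular:
  assumes u [measurable]: "u \<in> borel_measurable borel" and fin: "energy u < \<infinity>" "mass u < \<infinity>" and e: "0 < e"
  obtains v M \<rho> R where "v \<in> borel_measurable borel" "\<And>x. \<bar>v x\<bar> \<le> M" "0 < \<rho>" "0 < R"
    "\<And>x. norm x \<le> \<rho> \<Longrightarrow> v x = 0" "\<And>x. R \<le> norm x \<Longrightarrow> v x = 0" "energy v < \<infinity>"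
    "energy (\<lambda>x. u x - v x) \<le> ennreal e" "mass (\<lambda>x. u x - v x) \<le> ennreal e"
proof -
  define e' where "e' = e / (2 * 2 powr q)"
  have e': "0 < ennreal e'" using e by (simp add: e'_def)
  have "\<forall>\<^sub>F k in sequentially. energy (\<lambda>x. u x - max (- real k) (min (real k) (u x))) < ennreal e' \<and>
      mass (\<lambda>x. u x - max (- real k) (min (real k) (u x))) < ennreal e'"
    by (intro eventually_conj order_tendstoD(2)[OF truncation_tendsto(1)[OF u fin] e']
        order_tendstoD(2)[OF truncation_tendsto(2)[OF u fin] e'])
  then obtain k where k: "energy (\<lambda>x. u x - max (- real k) (min (real k) (u x))) < ennreal e'"
      "mass (\<lambda>x. u x - max (- real k) (min (real k) (u x))) < ennreal e'"
    by (auto simp: eventually_sequentially)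
  define w where "w x = max (- real k) (min (real k) (u x))" for x
  have w [measurable]: "w \<in> borel_measurable borel" unfolding w_def[abs_def] by measurable
  have wM: "\<bar>w x\<bar> \<le> real k" for x by (simp add: w_def abs_le_iff)
  have "energy w \<le> energy u" unfolding w_def by (intro energy_mono clamp_diff)
  with fin have w_energy: "energy w < \<infinity>" by (simp add: le_less_trans)
  have "mass w \<le> mass u" unfolding w_def by (intro mass_mono clamp_le) simp
  with fin have w_mass: "mass w < \<infinity>" by (simp add: le_less_trans)
  define c :: "nat \<Rightarrow> real ^ 'n \<Rightarrow> real"
    where "c j x = radial_cutoff (real (Suc j)) x * (1 - radial_cutoff (1 / real (Suc j)) x)" for j x
  have c_meas [measurable]: "c j \<in> borel_measurable borel" for j unfolding c_def[abs_def] by measurable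
  note lim = annular_cutoff_tendsto[OF w wM w_energy w_mass, folded c_def]
  have "\<forall>\<^sub>F j in sequentially. energy (\<lambda>x. w x - c j x * w x) < ennreal e' \<and> mass (\<lambda>x. w x - c j x * w x) < ennreal e'"
    by (intro eventually_conj order_tendstoD(2)[OF lim(1) e'] order_tendstoD(2)[OF lim(2) e'])
  then obtain j where j: "energy (\<lambda>x. w x - c j x * w x) < ennreal e'" "mass (\<lambda>x. w x - c j x * w x) < ennreal e'"
    by (auto simp: eventually_sequentially)
  define v where "v x = c j x * w x" for x
  have v [measurable]: "v \<in> borel_measurable borel" unfolding v_def[abs_def] by measurable
  show ?thesis
  \<comment> \<open>Up to norm \<open>1 / real (Suc j)\<close> the inner cutoff is 1 and its
    complement vanishes; from norm \<open>2 * real (Suc j)\<close> on the outer cutoff is 0.\<close>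
  proof (rule that[of v "real k" "1 / real (Suc j)" "2 * real (Suc j)"])
    have c01: "0 \<le> c j x" "c j x \<le> 1" for x
      using radial_cutoff_bounds[of "real (Suc j)" x] radial_cutoff_bounds[of "1 / real (Suc j)" x]
      by (simp_all add: c_def mult_le_one)
    fix x
    have "\<bar>v x\<bar> \<le> \<bar>w x\<bar>" using c01[of x] by (simp add: v_def abs_mult mult_left_le_one_le)
    then show "\<bar>v x\<bar> \<le> real k" using wM[of x] by linarith
  next
    fix x :: "real ^ 'n" assume "norm x \<le> 1 / real (Suc j)"
    then have "radial_cutoff (1 / real (Suc j)) x = 1" by (intro radial_cutoff_eq_1) simp_all
    then show "v x = 0" by (simp add: v_def c_def)
  next
    fix x :: "real ^ 'n" assume "2 * real (Suc j) \<le> norm x"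
    then have "radial_cutoff (real (Suc j)) x = 0" by (intro radial_cutoff_eq_0) simp_all
    then show "v x = 0" by (simp add: v_def c_def)
  next
    \<comment> \<open>Since \<open>v - w\<close> has finite energy, finiteness passes from
      \<open>w\<close> to \<open>v\<close>.\<close>
    have "energy (\<lambda>x. v x - w x) < ennreal e'"
      using j(1) energy_diff_commute[of v w] by (simp add: v_def)
    then have "energy (\<lambda>x. v x - w x) < \<infinity>"
      by (rule less_le_trans) simp
    then have lt: "energy (\<lambda>x. v x - w x) + energy (\<lambda>x. w x - 0) < \<infinity>" using w_energy by simp
    have "energy (\<lambda>x. v x - 0) \<le> ennreal (2 powr p) * (energy (\<lambda>x. v x - w x) + energy (\<lambda>x. w x - 0))"
      by (rule energy_triangle) measurable
    also have "\<dots> < \<infinity>"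
      using lt by (simp only: ennreal_mult_less_top infinity_ennreal_def ennreal_less_top simp_thms)
    finally show "energy v < \<infinity>" by simp
  next
    show "energy (\<lambda>x. u x - v x) \<le> ennreal e"
      by (rule energy_diff_le[OF u w v e]) (use k j in \<open>simp_all add: v_def w_def e'_def less_imp_le\<close>)
    show "mass (\<lambda>x. u x - v x) \<le> ennreal e"
      by (rule mass_diff_le[OF u w v e]) (use k j in \<open>simp_all add: v_def w_def e'_def less_imp_le\<close>)
  qed (use v in simp_all)
qed

section \<open>Translation and mollification in the weighted seminorms\<close>

text \<open>The bound is uniform in \<open>x\<close> because the two factors are handled on separate
  regions: for \<open>norm y < 1\<close> the kernel is at most
  \<open>1 / \<delta> powr (N + s * p)\<close> and the weight is integrable; for larger
  \<open>norm y\<close> the weight is at most 1 and the tail of the kernel is integrable.\<close>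

lemma far_kernel_integral:
  assumes \<delta>: "0 < \<delta>"
  obtains K where "0 \<le> K"
    "\<And>x :: real ^ 'n. (\<integral>\<^sup>+y. ennreal (1 / norm (x - y) powr (N + s * p) * (1 / norm y powr a)) * indicator {y. \<delta> \<le> norm (x - y)} y \<partial>lborel) \<le> ennreal K"
proof -
  let ?c = "N + s * p"
  have "a < real DIM(real ^ 'n)" unfolding DIM_N using N_sp by simp
  then obtain C1 where C1: "0 \<le> C1"
    "\<And>r. 0 < r \<Longrightarrow> (\<integral>\<^sup>+x. ennreal (1 / norm (x :: real ^ 'n) powr a) * indicator {x. norm x < r} x \<partial>lborel)
        \<le> ennreal (C1 * r powr (N - a))"
    using nn_integral_norm_powr_near[where 'a="real ^ 'n"] unfolding DIM_N by blast
  have "real DIM(real ^ 'n) < ?c" unfolding DIM_N using sp_pos by simp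
  then obtain C2 where C2: "0 \<le> C2"
    "\<And>r. 0 < r \<Longrightarrow> (\<integral>\<^sup>+x. ennreal (1 / norm (x :: real ^ 'n) powr ?c) * indicator {x. r \<le> norm x} x \<partial>lborel)
        \<le> ennreal (C2 * r powr (N - ?c))"
    using nn_integral_norm_powr_far[where 'a="real ^ 'n"] unfolding DIM_N by blast
  show ?thesis
  proof (rule that[of "1 / \<delta> powr ?c * C1 + C2 * \<delta> powr (N - ?c)"])
    show "0 \<le> 1 / \<delta> powr ?c * C1 + C2 * \<delta> powr (N - ?c)" using C1(1) C2(1) by simp
    fix x :: "real ^ 'n"
    let ?h = "\<lambda>y :: real ^ 'n. ennreal (1 / norm y powr ?c) * indicator {y. \<delta> \<le> norm y} y"
    have pt: "ennreal (1 / norm (x - y) powr ?c * (1 / norm y powr a)) * indicator {y. \<delta> \<le> norm (x - y)} y \<le>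
      ennreal (1 / \<delta> powr ?c) * (ennreal (1 / norm y powr a) * indicator {y. norm y < 1} y) + ?h (x - y)" for y
    proof (cases "\<delta> \<le> norm (x - y)")
      case far: True
      show ?thesis
      proof (cases "norm y < 1")
        case True
        have "1 / norm (x - y) powr ?c \<le> 1 / \<delta> powr ?c"
          using far \<delta> sp_pos N by (intro divide_left_mono powr_mono2 mult_pos_pos) auto
        then have "1 / norm (x - y) powr ?c * (1 / norm y powr a) \<le> 1 / \<delta> powr ?c * (1 / norm y powr a)"
          by (rule mult_right_mono) simp
        then have "ennreal (1 / norm (x - y) powr ?c * (1 / norm y powr a)) \<le> ennreal (1 / \<delta> powr ?c) * ennreal (1 / norm y powr a)"
          by (simp add: ennreal_mult[symmetric] ennreal_leI)
        then show ?thesis using True far by (simp add: add_increasing2)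
      next
        case False
        have "1 \<le> norm y powr a"
          using False a(1) by (intro ge_one_powr_ge_zero) simp_all
        then have "1 / norm y powr a \<le> 1"
          by (subst divide_le_eq_1_pos) linarith+
        then have "1 / norm (x - y) powr ?c * (1 / norm y powr a) \<le> 1 / norm (x - y) powr ?c * 1"
          by (rule mult_left_mono) simp
        then show ?thesis using False far by (simp add: ennreal_leI)
      qed
    qed simp
    have "(\<integral>\<^sup>+y. ennreal (1 / norm (x - y) powr ?c * (1 / norm y powr a)) * indicator {y. \<delta> \<le> norm (x - y)} y \<partial>lborel) \<le>
      ennreal (1 / \<delta> powr ?c) * (\<integral>\<^sup>+y. ennreal (1 / norm (y :: real ^ 'n) powr a) * indicator {y. norm y < 1} y \<partial>lborel) + (\<integral>\<^sup>+y. ?h (x - y) \<partial>lborel)"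
      by (rule order_trans[OF nn_integral_mono[OF pt]]) (simp add: nn_integral_add nn_integral_cmult)
    also have "(\<integral>\<^sup>+y. ?h (x - y) \<partial>lborel) = (\<integral>\<^sup>+y. ?h y \<partial>lborel)"
      by (rule nn_integral_lborel_reflect[of ?h x]) measurable
    also have "ennreal (1 / \<delta> powr ?c) * (\<integral>\<^sup>+y. ennreal (1 / norm (y :: real ^ 'n) powr a) * indicator {y. norm y < 1} y \<partial>lborel) + (\<integral>\<^sup>+y. ?h y \<partial>lborel)
      \<le> ennreal (1 / \<delta> powr ?c) * ennreal (C1 * 1 powr (N - a)) + ennreal (C2 * \<delta> powr (N - ?c))"
      by (intro add_mono mult_left_mono C1 C2 \<delta>) simp_all
    also have "\<dots> = ennreal (1 / \<delta> powr ?c * C1 + C2 * \<delta> powr (N - ?c))"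
      using C1(1) C2(1) by (simp add: ennreal_mult[symmetric] ennreal_plus[symmetric] del: ennreal_plus)
    finally show "(\<integral>\<^sup>+y. ennreal (1 / norm (x - y) powr ?c * (1 / norm y powr a)) * indicator {y. \<delta> \<le> norm (x - y)} y \<partial>lborel)
      \<le> ennreal (1 / \<delta> powr ?c * C1 + C2 * \<delta> powr (N - ?c))" .
  qed
qed

text \<open>Away from the diagonal no cancellation is required, and \<open>w x\<close> and
  \<open>w y\<close> are estimated one at a time. Integration in the other variable consumes its
  weight, so the weight that remains is \<open>norm x powr a\<close> and not
  \<open>norm x powr (2 * a)\<close>.\<close>

lemma far_energy:
  assumes \<delta>: "0 < \<delta>"
  obtains K where "0 \<le> K"
    "\<And>w. w \<in> borel_measurable borel \<Longrightarrow>
      (\<integral>\<^sup>+z. ennreal (\<bar>(w (fst z) - w (snd z)) * indicator {z. \<delta> \<le> norm (fst z - snd z)} z\<bar> powr p * ker (fst z) (snd z)) \<partial>(lborel \<Otimes>\<^sub>M lborel))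
      \<le> ennreal K * (\<integral>\<^sup>+x. ennreal (\<bar>w x\<bar> powr p / norm x powr a) \<partial>lborel)"
proof -
  let ?c = "N + s * p"
  obtain K where K: "0 \<le> K"
    "\<And>x :: real ^ 'n. (\<integral>\<^sup>+y. ennreal (1 / norm (x - y) powr ?c * (1 / norm y powr a)) * indicator {y. \<delta> \<le> norm (x - y)} y \<partial>lborel) \<le> ennreal K"
    using far_kernel_integral[OF \<delta>] by blast
  show ?thesis
  proof (rule that[of "2 powr p * (2 * K)"])
    fix w :: "real ^ 'n \<Rightarrow> real" assume [measurable]: "w \<in> borel_measurable borel"
    let ?I = "\<integral>\<^sup>+x. ennreal (\<bar>w x\<bar> powr p / norm x powr a) \<partial>lborel"
    let ?k = "\<lambda>x y :: real ^ 'n. ennreal (1 / norm (x - y) powr ?c * (1 / norm y powr a)) * indicator {y. \<delta> \<le> norm (x - y)} y"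
    define f where "f x y = \<bar>w x * indicator {z. \<delta> \<le> norm (fst z - snd z)} (x, y)\<bar> powr p * ker x y" for x y
    have [measurable]: "(\<lambda>z. f (g z) (h z)) \<in> borel_measurable M"
      if [measurable]: "g \<in> M \<rightarrow>\<^sub>M borel" "h \<in> M \<rightarrow>\<^sub>M borel" for g h and M :: "'z measure"
      unfolding f_def indicator_def by measurable
    have f_eq: "ennreal (f x y) = ennreal (\<bar>w x\<bar> powr p / norm x powr a) * ?k x y" for x y
      by (cases "\<delta> \<le> norm (x - y)") (simp_all add: f_def ker_def ennreal_mult[symmetric] mult.assoc)
    have int: "(\<integral>\<^sup>+x. \<integral>\<^sup>+y. ennreal (f x y) \<partial>lborel \<partial>lborel) \<le> ennreal K * ?I"
    proof -
      have "(\<integral>\<^sup>+y. ennreal (f x y) \<partial>lborel) \<le> ennreal (\<bar>w x\<bar> powr p / norm x powr a) * ennreal K" for x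
      proof -
        have "(\<integral>\<^sup>+y. ennreal (f x y) \<partial>lborel) = ennreal (\<bar>w x\<bar> powr p / norm x powr a) * (\<integral>\<^sup>+y. ?k x y \<partial>lborel)"
          unfolding f_eq by (rule nn_integral_cmult) measurable
        then show ?thesis using K(2)[of x] by (simp add: mult_left_mono)
      qed
      then have "(\<integral>\<^sup>+x. \<integral>\<^sup>+y. ennreal (f x y) \<partial>lborel \<partial>lborel) \<le> (\<integral>\<^sup>+x. ennreal (\<bar>w x\<bar> powr p / norm x powr a) * ennreal K \<partial>lborel)"
        by (rule nn_integral_mono)
      also have "\<dots> = ?I * ennreal K" by (rule nn_integral_multc) measurable
      finally show ?thesis by (simp add: mult.commute)
    qed
    have "(\<integral>\<^sup>+z. ennreal (\<bar>(w (fst z) - w (snd z)) * indicator {z. \<delta> \<le> norm (fst z - snd z)} z\<bar> powr p * ker (fst z) (snd z)) \<partial>(lborel \<Otimes>\<^sub>M lborel)) \<le>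
      ennreal (2 powr p) *
       ((\<integral>\<^sup>+z. ennreal (\<bar>w (fst z) * indicator {z. \<delta> \<le> norm (fst z - snd z)} z\<bar> powr p * ker (fst z) (snd z)) \<partial>(lborel \<Otimes>\<^sub>M lborel)) +
        (\<integral>\<^sup>+z. ennreal (\<bar>w (snd z) * indicator {z. \<delta> \<le> norm (fst z - snd z)} z\<bar> powr p * ker (fst z) (snd z)) \<partial>(lborel \<Otimes>\<^sub>M lborel)))"
    proof (rule pair_integral_add_le)
      fix z :: "(real ^ 'n) \<times> (real ^ 'n)"
      show "\<bar>(w (fst z) - w (snd z)) * indicator {z. \<delta> \<le> norm (fst z - snd z)} z\<bar> \<le>
        \<bar>w (fst z) * indicator {z. \<delta> \<le> norm (fst z - snd z)} z\<bar> + \<bar>w (snd z) * indicator {z. \<delta> \<le> norm (fst z - snd z)} z\<bar>"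
        by (cases "\<delta> \<le> norm (fst z - snd z)") (simp_all add: abs_triangle_ineq4)
    qed measurable
    also have "(\<integral>\<^sup>+z. ennreal (\<bar>w (fst z) * indicator {z. \<delta> \<le> norm (fst z - snd z)} z\<bar> powr p * ker (fst z) (snd z)) \<partial>(lborel \<Otimes>\<^sub>M lborel)) =
       (\<integral>\<^sup>+z. ennreal (f (fst z) (snd z)) \<partial>(lborel \<Otimes>\<^sub>M lborel))"
      by (simp add: f_def)
    also have "\<dots> = (\<integral>\<^sup>+x. \<integral>\<^sup>+y. ennreal (f x y) \<partial>lborel \<partial>lborel)"
      by (rule lborel_pair_integral_iterated[of "\<lambda>x y. ennreal (f x y)"]) measurable
    \<comment> \<open>Kernel and indicator are symmetric, so this summand is the first one with the
      variables exchanged.\<close>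
    also have "(\<integral>\<^sup>+z. ennreal (\<bar>w (snd z) * indicator {z. \<delta> \<le> norm (fst z - snd z)} z\<bar> powr p * ker (fst z) (snd z)) \<partial>(lborel \<Otimes>\<^sub>M lborel)) =
       (\<integral>\<^sup>+z. ennreal (f (snd z) (fst z)) \<partial>(lborel \<Otimes>\<^sub>M lborel))"
      by (intro nn_integral_cong) (simp add: f_def ker_commute[of "fst _"] indicator_def norm_minus_commute[of "fst _"])
    also have "\<dots> = (\<integral>\<^sup>+x. \<integral>\<^sup>+y. ennreal (f x y) \<partial>lborel \<partial>lborel)"
      by (rule lborel_pair_integral_iterated_swap[of "\<lambda>x y. ennreal (f x y)"]) measurable
    also have "ennreal (2 powr p) * ((\<integral>\<^sup>+x. \<integral>\<^sup>+y. ennreal (f x y) \<partial>lborel \<partial>lborel) + (\<integral>\<^sup>+x. \<integral>\<^sup>+y. ennreal (f x y) \<partial>lborel \<partial>lborel)) \<le>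
      ennreal (2 powr p) * (ennreal K * ?I + ennreal K * ?I)"
      by (intro mult_left_mono add_mono int) simp
    also have "\<dots> = ennreal (2 powr p * (2 * K)) * ?I"
    proof -
      have "ennreal (2 powr p * (2 * K)) = ennreal (2 powr p) * (ennreal K + ennreal K)"
        using K(1) by (simp add: ennreal_mult[symmetric] ennreal_plus[symmetric] del: ennreal_plus)
      then show ?thesis by (simp only: distrib_right mult.assoc)
    qed
    finally show "(\<integral>\<^sup>+z. ennreal (\<bar>(w (fst z) - w (snd z)) * indicator {z. \<delta> \<le> norm (fst z - snd z)} z\<bar> powr p * ker (fst z) (snd z)) \<partial>(lborel \<Otimes>\<^sub>M lborel))
      \<le> ennreal (2 powr p * (2 * K)) * ?I" .
  qed (use K in simp)
qed

text \<open>Close to the diagonal and away from the origin, a small translation changes the weights by a bounded factor only.\<close>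

lemma near_energy_translate:
  assumes v [measurable]: "v \<in> borel_measurable borel" and \<rho>: "0 < \<rho>" "\<And>x. norm x \<le> \<rho> \<Longrightarrow> v x = 0"
    and \<delta>: "\<delta> \<le> \<rho> / 2" and z: "norm z \<le> \<rho> / 4"
  shows "(\<integral>\<^sup>+y. ennreal (\<bar>(v (fst y - z) - v (snd y - z)) * indicator {y. norm (fst y - snd y) < \<delta>} y\<bar> powr p * ker (fst y) (snd y)) \<partial>(lborel \<Otimes>\<^sub>M lborel))
    \<le> ennreal (4 powr a) * (\<integral>\<^sup>+y. ennreal (\<bar>(v (fst y) - v (snd y)) * indicator {y. norm (fst y - snd y) < \<delta>} y\<bar> powr p * ker (fst y) (snd y)) \<partial>(lborel \<Otimes>\<^sub>M lborel))"
proof -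
  let ?F = "\<lambda>y. ennreal (\<bar>(v (fst y - z) - v (snd y - z)) * indicator {y. norm (fst y - snd y) < \<delta>} y\<bar> powr p * ker (fst y) (snd y))"
  \<comment> \<open>Both variables are shifted by the same \<open>z\<close>; their distance stays
    fixed and only the two weights move.\<close>
  have "(\<integral>\<^sup>+y. ?F y \<partial>(lborel \<Otimes>\<^sub>M lborel)) = (\<integral>\<^sup>+y. ?F ((z, z) + y) \<partial>(lborel \<Otimes>\<^sub>M lborel))"
    unfolding lborel_prod by (rule nn_integral_lborel_translate[symmetric]) (simp add: borel_prod[symmetric])
  also have "\<dots> = (\<integral>\<^sup>+y. ennreal (\<bar>(v (fst y) - v (snd y)) * indicator {y. norm (fst y - snd y) < \<delta>} y\<bar> powr p * ker (z + fst y) (z + snd y)) \<partial>(lborel \<Otimes>\<^sub>M lborel))"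
    by (intro nn_integral_cong) (simp add: indicator_def)
  also have "\<dots> \<le> (\<integral>\<^sup>+y. ennreal (4 powr a) * ennreal (\<bar>(v (fst y) - v (snd y)) * indicator {y. norm (fst y - snd y) < \<delta>} y\<bar> powr p * ker (fst y) (snd y)) \<partial>(lborel \<Otimes>\<^sub>M lborel))"
  proof (rule nn_integral_mono)
    fix y :: "(real ^ 'n) \<times> (real ^ 'n)"
    obtain x x' where y: "y = (x, x')" by (cases y)
    show "ennreal (\<bar>(v (fst y) - v (snd y)) * indicator {y. norm (fst y - snd y) < \<delta>} y\<bar> powr p * ker (z + fst y) (z + snd y)) \<le>
      ennreal (4 powr a) * ennreal (\<bar>(v (fst y) - v (snd y)) * indicator {y. norm (fst y - snd y) < \<delta>} y\<bar> powr p * ker (fst y) (snd y))"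
    proof (cases "norm (x - x') < \<delta> \<and> (v x \<noteq> 0 \<or> v x' \<noteq> 0)")
      case True
      \<comment> \<open>Where a value of \<open>v\<close> is nonzero the norm exceeds
        \<open>\<rho>\<close>; the other point is closer than \<open>\<rho> / 2\<close>, so its norm
        exceeds \<open>\<rho> / 2\<close>.\<close>
      have "\<rho> < norm x \<or> \<rho> < norm x'" using True \<rho>(2)[of x] \<rho>(2)[of x'] by linarith
      moreover have "\<bar>norm x - norm x'\<bar> < \<rho> / 2" using norm_triangle_ineq3[of x x'] True \<delta> by linarith
      ultimately have big: "\<rho> / 2 < norm x" "\<rho> / 2 < norm x'" by linarith+
      \<comment> \<open>Since \<open>norm z \<le> \<rho> / 4 < norm t / 2\<close>, the shift at
        worst halves the norm. Each weight grows by at most \<open>2 powr a\<close>, both together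
        by \<open>4 powr a\<close>.\<close>
      have comp: "1 / norm (z + t) powr a \<le> 2 powr a * (1 / norm t powr a)" if "\<rho> / 2 < norm t" for t
      proof -
        have "norm t \<le> norm (z + t) + norm z" using norm_triangle_ineq4[of "z + t" z] by simp
        then have "norm t / 2 \<le> norm (z + t)" using z that by linarith
        then have "(norm t / 2) powr a \<le> norm (z + t) powr a" using a by (intro powr_mono2) auto
        moreover have "0 < norm t" using that \<rho> by linarith
        ultimately have "1 / norm (z + t) powr a \<le> 1 / (norm t / 2) powr a"
          by (intro divide_left_mono mult_pos_pos) (auto intro: less_le_trans[rotated])
        then show ?thesis by (simp add: powr_divide)
      qed
      have "ker (z + x) (z + x') \<le> 1 / norm (x - x') powr (N + s * p) * (2 powr a * (1 / norm x powr a)) * (2 powr a * (1 / norm x' powr a))"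
        unfolding ker_def by (simp only: add_diff_cancel_left, intro mult_mono order_refl comp big) auto
      also have "\<dots> = (2 powr a * 2 powr a) * ker x x'" by (simp add: ker_def)
      also have "2 powr a * 2 powr a = (4 powr a :: real)"
        using powr_mult[of 2 2 a] by simp
      finally have "\<bar>v x - v x'\<bar> powr p * ker (z + x) (z + x') \<le> \<bar>v x - v x'\<bar> powr p * (4 powr a * ker x x')"
        by (rule mult_left_mono) simp
      then have "\<bar>v x - v x'\<bar> powr p * ker (z + x) (z + x') \<le> 4 powr a * (\<bar>v x - v x'\<bar> powr p * ker x x')"
        by (simp only: mult.left_commute)
      then have "ennreal (\<bar>v x - v x'\<bar> powr p * ker (z + x) (z + x')) \<le> ennreal (4 powr a * (\<bar>v x - v x'\<bar> powr p * ker x x'))"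
        by (rule ennreal_leI)
      also have "\<dots> = ennreal (4 powr a) * ennreal (\<bar>v x - v x'\<bar> powr p * ker x x')"
        by (rule ennreal_mult) (simp_all add: ker_nonneg)
      finally show ?thesis using True by (simp add: y)
    next
      case False
      then show ?thesis by (auto simp: y)
    qed
  qed
  also have "\<dots> = ennreal (4 powr a) * (\<integral>\<^sup>+y. ennreal (\<bar>(v (fst y) - v (snd y)) * indicator {y. norm (fst y - snd y) < \<delta>} y\<bar> powr p * ker (fst y) (snd y)) \<partial>(lborel \<Otimes>\<^sub>M lborel))"
    by (rule nn_integral_cmult) measurable
  finally show ?thesis .
qed

text \<open>The distance \<open>\<delta>\<close> from the diagonal is fixed first, through the
  smallness of the energy of \<open>v\<close> itself near the diagonal; the near part is then small
  for all shifts up to \<open>\<rho> / 4\<close>. The far part has a constant that depends on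
  \<open>\<delta>\<close>, and it alone calls for a smaller shift.\<close>

lemma energy_translate_small:
  assumes v [measurable]: "v \<in> borel_measurable borel" and M: "\<And>x. \<bar>v x\<bar> \<le> M"
    and \<rho>: "0 < \<rho>" "\<And>x. norm x \<le> \<rho> \<Longrightarrow> v x = 0" and R: "0 < R" "\<And>x. R \<le> norm x \<Longrightarrow> v x = 0"
    and fin: "energy v < \<infinity>" and e: "0 < e"
  obtains d where "0 < d" "\<And>z. norm z < d \<Longrightarrow> energy (\<lambda>x. v (x - z) - v x) \<le> ennreal e"
proof -
  define P where "P f = (\<integral>\<^sup>+z. ennreal (\<bar>f z\<bar> powr p * ker (fst z) (snd z)) \<partial>(lborel \<Otimes>\<^sub>M lborel))"
    for f :: "(real ^ 'n) \<times> (real ^ 'n) \<Rightarrow> real"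
  define near where "near \<delta> w y = (w (fst y) - w (snd y)) * indicator {y. norm (fst y - snd y) < \<delta>} y"
    for \<delta> :: real and w :: "real ^ 'n \<Rightarrow> real" and y :: "(real ^ 'n) \<times> (real ^ 'n)"
  define far where "far \<delta> w y = (w (fst y) - w (snd y)) * indicator {y. \<delta> \<le> norm (fst y - snd y)} y"
    for \<delta> :: real and w :: "real ^ 'n \<Rightarrow> real" and y :: "(real ^ 'n) \<times> (real ^ 'n)"
  have [measurable]: "near \<delta> w \<in> borel_measurable (borel \<Otimes>\<^sub>M borel)" "far \<delta> w \<in> borel_measurable (borel \<Otimes>\<^sub>M borel)"
    if [measurable]: "w \<in> borel_measurable borel" for \<delta> w
    unfolding near_def[abs_def] far_def[abs_def] by measurable
  have P_add: "P f \<le> ennreal (2 powr p) * (P g + P h)"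
    if "g \<in> borel_measurable (borel \<Otimes>\<^sub>M borel)" "h \<in> borel_measurable (borel \<Otimes>\<^sub>M borel)"
      "\<And>z. \<bar>f z\<bar> \<le> \<bar>g z\<bar> + \<bar>h z\<bar>" for f g h
    unfolding P_def by (rule pair_integral_add_le[OF that])
  have lim_near: "(\<lambda>k. P (near (1 / real (Suc k)) v)) \<longlonglongrightarrow> 0"
    unfolding P_def
  proof (rule pair_integral_tendsto_0[OF v _ fin])
    show "\<bar>near (1 / real (Suc k)) v z\<bar> \<le> \<bar>v (fst z) - v (snd z)\<bar>" for k z
      by (simp add: near_def indicator_def)
    fix z :: "(real ^ 'n) \<times> (real ^ 'n)" assume "fst z \<noteq> snd z"
    then have "0 < norm (fst z - snd z)" by simp
    from nat_approx_posE[OF this] obtain m where m: "1 / real (Suc m) < norm (fst z - snd z)" by blast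
    have "\<forall>\<^sub>F k in sequentially. near (1 / real (Suc k)) v z = 0"
    proof (rule eventually_sequentiallyI[of m])
      fix k assume "m \<le> k"
      then have "1 / real (Suc k) \<le> 1 / real (Suc m)" by (intro divide_left_mono) simp_all
      then show "near (1 / real (Suc k)) v z = 0" using m by (simp add: near_def del: of_nat_Suc)
    qed
    then show "(\<lambda>k. near (1 / real (Suc k)) v z) \<longlonglongrightarrow> 0" by (rule tendsto_eventually)
  qed measurable
  \<comment> \<open>Losses of the near part: one factor \<open>2 powr p\<close> for separating near
    from far, another for separating the shifted function from \<open>v\<close>, and
    \<open>4 powr a + 1\<close> for the energies of these two.\<close>
  define A where "A = 2 powr p * (2 powr p * (4 powr a + 1))"
  have A: "0 < A" by (simp add: A_def add_pos_pos)
  have "\<forall>\<^sub>F k in sequentially. P (near (1 / real (Suc k)) v) < ennreal (e / (2 * A))"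
    by (rule order_tendstoD(2)[OF lim_near]) (use A e in simp)
  moreover have "\<forall>\<^sub>F k in sequentially. 1 / real (Suc k) < \<rho> / 2"
    using order_tendstoD(2)[OF LIMSEQ_inverse_real_of_nat, of "\<rho> / 2"] \<rho> by (simp add: inverse_eq_divide)
  ultimately have "\<forall>\<^sub>F k in sequentially. P (near (1 / real (Suc k)) v) < ennreal (e / (2 * A)) \<and> 1 / real (Suc k) < \<rho> / 2"
    by (rule eventually_conj)
  then obtain k where k: "P (near (1 / real (Suc k)) v) < ennreal (e / (2 * A))" "1 / real (Suc k) < \<rho> / 2"
    by (auto simp: eventually_sequentially)
  define \<delta> where "\<delta> = 1 / real (Suc k)"
  have \<delta>: "0 < \<delta>" "\<delta> \<le> \<rho> / 2" "P (near \<delta> v) \<le> ennreal (e / (2 * A))" using k by (simp_all add: \<delta>_def)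
  obtain K where K: "0 \<le> K"
    "\<And>w. w \<in> borel_measurable borel \<Longrightarrow> P (far \<delta> w) \<le> ennreal K * (\<integral>\<^sup>+x. ennreal (\<bar>w x\<bar> powr p / norm x powr a) \<partial>lborel)"
    using far_energy[OF \<delta>(1)] unfolding P_def far_def by blast
  define B where "B = 2 powr p * K"
  have B: "0 \<le> B" using K by (simp add: B_def)
  have "0 < e / (2 * (B + 1))" using e B by simp
  moreover have "a < real DIM(real ^ 'n)" unfolding DIM_N using N_sp by simp
  moreover have "1 \<le> p" using p by simp
  ultimately obtain d where d: "0 < d"
    "\<And>z. norm z < d \<Longrightarrow> (\<integral>\<^sup>+x. ennreal (\<bar>v (x - z) - v x\<bar> powr p / norm x powr a) \<partial>lborel) \<le> ennreal (e / (2 * (B + 1)))"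
    using nn_integral_weighted_translate_diff_small[OF v M R a(1)] by blast
  show ?thesis
  \<comment> \<open>The cap \<open>\<rho> / 4\<close> keeps the shift in the range where the weights
    are comparable.\<close>
  proof (rule that[of "min d (\<rho> / 4)"])
    show "0 < min d (\<rho> / 4)" using d \<rho> by simp
    fix z :: "real ^ 'n" assume z: "norm z < min d (\<rho> / 4)"
    let ?w = "\<lambda>x. v (x - z) - v x"
    have near_w: "P (near \<delta> ?w) \<le> ennreal (2 powr p * (4 powr a + 1)) * P (near \<delta> v)"
    proof -
      have "P (near \<delta> ?w) \<le> ennreal (2 powr p) * (P (near \<delta> (\<lambda>x. v (x - z))) + P (near \<delta> v))"
      proof (rule P_add)
        fix y :: "(real ^ 'n) \<times> (real ^ 'n)"
        have "near \<delta> ?w y = near \<delta> (\<lambda>x. v (x - z)) y - near \<delta> v y" by (simp add: near_def algebra_simps)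
        then show "\<bar>near \<delta> ?w y\<bar> \<le> \<bar>near \<delta> (\<lambda>x. v (x - z)) y\<bar> + \<bar>near \<delta> v y\<bar>" by (simp only: abs_triangle_ineq4)
      qed measurable
      also have "\<dots> \<le> ennreal (2 powr p) * (ennreal (4 powr a) * P (near \<delta> v) + P (near \<delta> v))"
        unfolding P_def near_def using z
        by (intro mult_left_mono add_right_mono near_energy_translate[OF v \<rho> \<delta>(2)]) simp_all
      also have "\<dots> = ennreal (2 powr p) * ((ennreal (4 powr a) + 1) * P (near \<delta> v))"
        by (simp only: distrib_right mult_1_left)
      also have "ennreal (4 powr a) + 1 = ennreal (4 powr a + 1)" by simp
      finally show ?thesis
        by (simp only: ennreal_mult[of "2 powr p" "4 powr a + 1", OF powr_ge_zero add_nonneg_nonneg[OF powr_ge_zero zero_le_one]] mult.assoc)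
    qed
    have "energy ?w \<le> ennreal (2 powr p) * (P (near \<delta> ?w) + P (far \<delta> ?w))"
      unfolding energy_def P_def[symmetric]
    proof (rule P_add)
      fix y :: "(real ^ 'n) \<times> (real ^ 'n)"
      show "\<bar>?w (fst y) - ?w (snd y)\<bar> \<le> \<bar>near \<delta> ?w y\<bar> + \<bar>far \<delta> ?w y\<bar>"
        by (cases "norm (fst y - snd y) < \<delta>") (simp_all add: near_def far_def)
    qed measurable
    also have "\<dots> \<le> ennreal (2 powr p) * (ennreal (2 powr p * (4 powr a + 1)) * ennreal (e / (2 * A)) + ennreal K * ennreal (e / (2 * (B + 1))))"
    proof (intro mult_left_mono add_mono)
      show "P (near \<delta> ?w) \<le> ennreal (2 powr p * (4 powr a + 1)) * ennreal (e / (2 * A))"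
        by (rule order_trans[OF near_w]) (rule mult_left_mono[OF \<delta>(3)], simp)
      show "P (far \<delta> ?w) \<le> ennreal K * ennreal (e / (2 * (B + 1)))"
        by (rule order_trans[OF K(2)]) (measurable, rule mult_left_mono[OF d(2)], use z in simp_all)
    qed simp
    also have "\<dots> = ennreal (A * (e / (2 * A)) + B * (e / (2 * (B + 1))))"
    proof -
      have "2 powr p * ((2 powr p * (4 powr a + 1)) * X + K * Y) = A * X + B * Y" for X Y
        by (simp only: A_def B_def distrib_left distrib_right mult.assoc)
      moreover have "ennreal \<alpha> * (ennreal \<beta> * ennreal X + ennreal K * ennreal Y) = ennreal (\<alpha> * (\<beta> * X + K * Y))"
        if "0 \<le> \<alpha>" "0 \<le> \<beta>" "0 \<le> X" "0 \<le> Y" for \<alpha> \<beta> X Y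
        using that K(1) by (simp add: ennreal_mult[symmetric] ennreal_plus[symmetric] del: ennreal_plus)
      moreover have "0 \<le> 2 powr p * (4 powr a + 1)" "0 \<le> e / (2 * A)" "0 \<le> e / (2 * (B + 1))"
        using A B e by simp_all
      ultimately show ?thesis by (simp only: powr_ge_zero)
    qed
    also have "\<dots> \<le> ennreal e"
    proof (rule ennreal_leI)
      have "A * (e / (2 * A)) = e / 2" using A by simp
      moreover have "B * (e / (2 * (B + 1))) = (B / (B + 1)) * (e / 2)" by simp
      moreover have "(B / (B + 1)) * (e / 2) \<le> 1 * (e / 2)" using e B by (intro mult_right_mono) (auto simp: field_simps)
      ultimately show "A * (e / (2 * A)) + B * (e / (2 * (B + 1))) \<le> e" by linarith
    qed
    finally show "energy ?w \<le> ennreal e" .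
  qed
qed

text \<open>The function \<open>m x - v x\<close> is the \<open>\<phi>\<close>-average of
  \<open>v (x - z) - v x\<close> over \<open>z\<close>. Jensen's inequality at each point, or pair
  of points, followed by an exchange of integrals bounds its energy and mass by averages of those of
  the translation differences, and only shifts with \<open>norm z < d\<close> carry any
  weight.\<close>

lemma mollification_diff:
  assumes v [measurable]: "v \<in> borel_measurable borel" and M: "\<And>x. \<bar>v x\<bar> \<le> M"
    and \<phi> [measurable]: "\<phi> \<in> borel_measurable borel" and \<phi>0: "\<And>z. 0 \<le> \<phi> z" and \<phi>1: "(\<integral>\<^sup>+z. ennreal (\<phi> z) \<partial>lborel) = 1"
    and supp: "\<And>z. d \<le> norm z \<Longrightarrow> \<phi> z = 0"
  defines "m \<equiv> \<lambda>x. \<integral>z. \<phi> z * v (x - z) \<partial>lborel"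
  shows mollification_measurable: "m \<in> borel_measurable borel"
    and energy_mollification_diff_le:
      "(\<And>z. norm z < d \<Longrightarrow> energy (\<lambda>x. v (x - z) - v x) \<le> ennreal e) \<Longrightarrow> energy (\<lambda>x. m x - v x) \<le> ennreal e"
    and mass_mollification_diff_le:
      "(\<And>z. norm z < d \<Longrightarrow> mass (\<lambda>x. v (x - z) - v x) \<le> ennreal e) \<Longrightarrow> mass (\<lambda>x. m x - v x) \<le> ennreal e"
proof -
  show m [measurable]: "m \<in> borel_measurable borel" unfolding m_def by measurable
  have \<phi>i: "integrable lborel \<phi>" "(\<integral>z. \<phi> z \<partial>lborel) = 1"
    using \<phi>0 \<phi>1 integral_eq_nn_integral[of \<phi> lborel] by (auto intro!: integrableI_nonneg)
  have int: "integrable lborel (\<lambda>z. \<phi> z * v (x - z))" for x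
  proof (rule Bochner_Integration.integrable_bound[of lborel "\<lambda>z. M * \<phi> z"])
    show "AE z in lborel. norm (\<phi> z * v (x - z)) \<le> norm (M * \<phi> z)"
    proof (intro AE_I2)
      fix z
      have "\<phi> z * \<bar>v (x - z)\<bar> \<le> \<phi> z * \<bar>M\<bar>"
        using M[of "x - z"] \<phi>0[of z] by (intro mult_left_mono) auto
      then show "norm (\<phi> z * v (x - z)) \<le> norm (M * \<phi> z)"
        using \<phi>0[of z] by (simp add: abs_mult mult.commute)
    qed
  qed (use \<phi>i in simp_all)
  have m_diff: "m x - v x = (\<integral>z. \<phi> z * (v (x - z) - v x) \<partial>lborel)" for x
  proof -
    have "(\<integral>z. \<phi> z * (v (x - z) - v x) \<partial>lborel) = (\<integral>z. \<phi> z * v (x - z) - \<phi> z * v x \<partial>lborel)"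
      by (simp only: right_diff_distrib)
    also have "\<dots> = m x - v x" using \<phi>i int by (simp add: m_def)
    finally show ?thesis ..
  qed
  have int': "integrable lborel (\<lambda>z. \<phi> z * (v (x - z) - v x))" for x
    using \<phi>i int by (simp add: right_diff_distrib)
  have le_e: "(\<integral>\<^sup>+z. ennreal (\<phi> z) * G z \<partial>lborel) \<le> ennreal e" if "\<And>z. norm z < d \<Longrightarrow> G z \<le> ennreal e" for G
  proof -
    have "(\<integral>\<^sup>+z. ennreal (\<phi> z) * G z \<partial>lborel) \<le> (\<integral>\<^sup>+z. ennreal (\<phi> z) * ennreal e \<partial>lborel)"
    proof (rule nn_integral_mono)
      fix z show "ennreal (\<phi> z) * G z \<le> ennreal (\<phi> z) * ennreal e"
        using that[of z] supp[of z] by (cases "norm z < d") (simp_all add: mult_left_mono)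
    qed
    also have "\<dots> = ennreal e" by (simp add: nn_integral_multc \<phi>1)
    finally show ?thesis .
  qed
  show "energy (\<lambda>x. m x - v x) \<le> ennreal e" if e: "\<And>z. norm z < d \<Longrightarrow> energy (\<lambda>x. v (x - z) - v x) \<le> ennreal e"
  proof -
    define D where "D y z = (v (fst y - z) - v (fst y)) - (v (snd y - z) - v (snd y))" for y z
    have [measurable]: "(\<lambda>w. D (f w) (g w)) \<in> borel_measurable L"
      if [measurable]: "f \<in> L \<rightarrow>\<^sub>M borel \<Otimes>\<^sub>M borel" "g \<in> L \<rightarrow>\<^sub>M borel" for f g and L :: "'z measure"
      unfolding D_def by measurable
    have Dz: "D y \<in> borel_measurable lborel" for y
      unfolding D_def[abs_def] by measurable
    have pt: "ennreal (\<bar>(m (fst y) - v (fst y)) - (m (snd y) - v (snd y))\<bar> powr p * ker (fst y) (snd y)) \<le>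
      (\<integral>\<^sup>+z. ennreal (\<phi> z) * ennreal (\<bar>D y z\<bar> powr p * ker (fst y) (snd y)) \<partial>lborel)" for y
    proof -
      have "(m (fst y) - v (fst y)) - (m (snd y) - v (snd y)) = (\<integral>z. \<phi> z * D y z \<partial>lborel)"
        using int' by (simp add: m_diff D_def right_diff_distrib[of "\<phi> _" "v (fst y - _) - v (fst y)"])
      then have "ennreal (\<bar>(m (fst y) - v (fst y)) - (m (snd y) - v (snd y))\<bar> powr p * ker (fst y) (snd y)) =
         ennreal (\<bar>\<integral>z. \<phi> z * D y z \<partial>lborel\<bar> powr p) * ennreal (ker (fst y) (snd y))"
        by (simp add: ennreal_mult ker_nonneg)
      also have "\<dots> \<le> (\<integral>\<^sup>+z. ennreal (\<phi> z) * ennreal (\<bar>D y z\<bar> powr p) \<partial>lborel) * ennreal (ker (fst y) (snd y))"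
      proof (intro mult_right_mono powr_integral_mean_le[where B="4 * M"] p \<phi>0 \<phi>1)
        fix z show "\<bar>D y z\<bar> \<le> 4 * M"
          using M[of "fst y - z"] M[of "fst y"] M[of "snd y - z"] M[of "snd y"] unfolding D_def by linarith
      qed (use Dz in simp_all)
      also have "\<dots> = (\<integral>\<^sup>+z. ennreal (\<phi> z) * ennreal (\<bar>D y z\<bar> powr p) * ennreal (ker (fst y) (snd y)) \<partial>lborel)"
        by (rule nn_integral_multc[symmetric]) (use Dz in simp)
      also have "\<dots> = (\<integral>\<^sup>+z. ennreal (\<phi> z) * ennreal (\<bar>D y z\<bar> powr p * ker (fst y) (snd y)) \<partial>lborel)"
        by (simp add: ennreal_mult ker_nonneg mult.assoc)
      finally show ?thesis .
    qed
    have "energy (\<lambda>x. m x - v x) \<le>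
      (\<integral>\<^sup>+y. \<integral>\<^sup>+z. ennreal (\<phi> z) * ennreal (\<bar>D y z\<bar> powr p * ker (fst y) (snd y)) \<partial>lborel \<partial>(lborel \<Otimes>\<^sub>M lborel))"
      unfolding energy_def by (rule nn_integral_mono[OF pt])
    \<comment> \<open>With the pair measure rewritten as \<open>lborel\<close> on the product space,
      this is an exchange between two measures of the form \<open>lborel\<close>.\<close>
    also have "\<dots> = (\<integral>\<^sup>+z. \<integral>\<^sup>+y. ennreal (\<phi> z) * ennreal (\<bar>D y z\<bar> powr p * ker (fst y) (snd y)) \<partial>(lborel \<Otimes>\<^sub>M lborel) \<partial>lborel)"
      unfolding lborel_prod
      by (rule lborel_pair.Fubini'[symmetric])
        (subst measurable_cong_sets[OF sets_pair_measure_cong[OF sets_lborel sets_lborel] refl],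
         simp add: borel_prod[symmetric] split_beta')
    also have "\<dots> = (\<integral>\<^sup>+z. ennreal (\<phi> z) * energy (\<lambda>x. v (x - z) - v x) \<partial>lborel)"
      unfolding energy_def D_def[symmetric]
      by (intro nn_integral_cong nn_integral_cmult) (simp add: D_def)
    also have "\<dots> \<le> ennreal e" by (rule le_e[OF e])
    finally show ?thesis .
  qed
  show "mass (\<lambda>x. m x - v x) \<le> ennreal e" if e: "\<And>z. norm z < d \<Longrightarrow> mass (\<lambda>x. v (x - z) - v x) \<le> ennreal e"
  proof -
    let ?b = "2 * a * q / p"
    have pt: "ennreal (\<bar>m x - v x\<bar> powr q / norm x powr ?b) \<le>
      (\<integral>\<^sup>+z. ennreal (\<phi> z) * ennreal (\<bar>v (x - z) - v x\<bar> powr q / norm x powr ?b) \<partial>lborel)" for x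
    proof -
      have "ennreal (\<bar>m x - v x\<bar> powr q / norm x powr ?b) =
         ennreal (\<bar>\<integral>z. \<phi> z * (v (x - z) - v x) \<partial>lborel\<bar> powr q) * ennreal (1 / norm x powr ?b)"
        by (simp add: m_diff ennreal_mult[symmetric])
      also have "\<dots> \<le> (\<integral>\<^sup>+z. ennreal (\<phi> z) * ennreal (\<bar>v (x - z) - v x\<bar> powr q) \<partial>lborel) * ennreal (1 / norm x powr ?b)"
      proof (intro mult_right_mono powr_integral_mean_le[where B="2 * M"] q_gt \<phi>0 \<phi>1)
        fix z show "\<bar>v (x - z) - v x\<bar> \<le> 2 * M"
          using M[of "x - z"] M[of x] by linarith
      qed simp_all
      also have "\<dots> = (\<integral>\<^sup>+z. ennreal (\<phi> z) * ennreal (\<bar>v (x - z) - v x\<bar> powr q) * ennreal (1 / norm x powr ?b) \<partial>lborel)"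
        by (rule nn_integral_multc[symmetric]) measurable
      also have "\<dots> = (\<integral>\<^sup>+z. ennreal (\<phi> z) * ennreal (\<bar>v (x - z) - v x\<bar> powr q / norm x powr ?b) \<partial>lborel)"
        by (simp add: ennreal_mult[symmetric] mult.assoc)
      finally show ?thesis .
    qed
    have "mass (\<lambda>x. m x - v x) \<le>
      (\<integral>\<^sup>+x. \<integral>\<^sup>+z. ennreal (\<phi> z) * ennreal (\<bar>v (x - z) - v x\<bar> powr q / norm x powr ?b) \<partial>lborel \<partial>lborel)"
      unfolding mass_def by (rule nn_integral_mono[OF pt])
    also have "\<dots> = (\<integral>\<^sup>+z. \<integral>\<^sup>+x. ennreal (\<phi> z) * ennreal (\<bar>v (x - z) - v x\<bar> powr q / norm x powr ?b) \<partial>lborel \<partial>lborel)"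
      by (rule lborel_pair.Fubini'[symmetric]) measurable
    also have "\<dots> = (\<integral>\<^sup>+z. ennreal (\<phi> z) * mass (\<lambda>x. v (x - z) - v x) \<partial>lborel)"
      unfolding mass_def by (intro nn_integral_cong nn_integral_cmult) simp
    also have "\<dots> \<le> ennreal e" by (rule le_e[OF e])
    finally show ?thesis .
  qed
qed

text \<open>The radius \<open>d\<close> is found before \<open>\<phi>\<close>: every probability
  density supported in the ball of radius \<open>d\<close> will do, so a smooth one can be chosen
  afterwards.\<close>

lemma mollification_small:
  assumes v: "v \<in> borel_measurable borel" and M: "\<And>x. \<bar>v x\<bar> \<le> M"
    and \<rho>: "0 < \<rho>" "\<And>x. norm x \<le> \<rho> \<Longrightarrow> v x = 0" and R: "0 < R" "\<And>x. R \<le> norm x \<Longrightarrow> v x = 0"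
    and fin: "energy v < \<infinity>" and e: "0 < e"
  obtains d where "0 < d"
    "\<And>\<phi>. \<phi> \<in> borel_measurable borel \<Longrightarrow> (\<And>z. 0 \<le> \<phi> z) \<Longrightarrow> (\<integral>\<^sup>+z. ennreal (\<phi> z) \<partial>lborel) = 1 \<Longrightarrow>
      (\<And>z. d \<le> norm z \<Longrightarrow> \<phi> z = 0) \<Longrightarrow>
      energy (\<lambda>x. (\<integral>z. \<phi> z * v (x - z) \<partial>lborel) - v x) \<le> ennreal e \<and>
      mass (\<lambda>x. (\<integral>z. \<phi> z * v (x - z) \<partial>lborel) - v x) \<le> ennreal e"
proof -
  obtain d1 where d1: "0 < d1" "\<And>z. norm z < d1 \<Longrightarrow> energy (\<lambda>x. v (x - z) - v x) \<le> ennreal e"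
    using energy_translate_small[OF v M \<rho> R fin e] by blast
  have "2 * a * q / p < real DIM(real ^ 'n)" unfolding DIM_N by (rule mass_exponent)
  moreover have "1 \<le> q" using q_gt by simp
  ultimately obtain d2 where d2: "0 < d2" "\<And>z. norm z < d2 \<Longrightarrow> mass (\<lambda>x. v (x - z) - v x) \<le> ennreal e"
    using nn_integral_weighted_translate_diff_small[OF v M R mass_exponent(1) _ _ e]
    unfolding mass_def by blast
  show ?thesis
  proof (rule that[of "min d1 d2"], use d1 d2 in simp, intro conjI)
    fix \<phi> :: "real ^ 'n \<Rightarrow> real"
    assume \<phi>: "\<phi> \<in> borel_measurable borel" "\<And>z. 0 \<le> \<phi> z" "(\<integral>\<^sup>+z. ennreal (\<phi> z) \<partial>lborel) = 1"
      "\<And>z. min d1 d2 \<le> norm z \<Longrightarrow> \<phi> z = 0"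
    show "energy (\<lambda>x. (\<integral>z. \<phi> z * v (x - z) \<partial>lborel) - v x) \<le> ennreal e"
      by (rule energy_mollification_diff_le[OF v M \<phi>], simp, rule d1, simp)
    show "mass (\<lambda>x. (\<integral>z. \<phi> z * v (x - z) \<partial>lborel) - v x) \<le> ennreal e"
      by (rule mass_mollification_diff_le[OF v M \<phi>], simp, rule d2, simp)
  qed
qed

end

section \<open>Smooth bump functions and convolutions\<close>

text \<open>For \<open>P = 1\<close> this is the classical flat function. Allowing polynomials in
  \<open>1 / t\<close> in front makes the family closed under differentiation.\<close>

definition flat_exp :: "real poly \<Rightarrow> real \<Rightarrow> real" where
  "flat_exp P t = (if t \<le> 0 then 0 else poly P (1 / t) * exp (- (1 / t)))"

lemma poly_div_exp_tendsto_0: "((\<lambda>x. poly P x / exp x) \<longlongrightarrow> (0::real)) at_top"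
proof -
  have "((\<lambda>x. \<Sum>i\<le>degree P. coeff P i * (x ^ i / exp x)) \<longlongrightarrow> (\<Sum>i\<le>degree P. coeff P i * 0)) at_top"
    by (intro tendsto_sum tendsto_mult tendsto_const tendsto_power_div_exp_0)
  then show ?thesis by (simp add: poly_altdef sum_divide_distrib)
qed

text \<open>For \<open>t > 0\<close> the chain rule brings out the square of \<open>1 / t\<close>,
  times \<open>P - pderiv P\<close> at \<open>1 / t\<close>; multiplication by that square is the
  polynomial factor \<open>[:0, 0, 1:]\<close>.\<close>

lemma flat_exp_has_derivative:
  "(flat_exp P has_real_derivative flat_exp ([:0, 0, 1:] * (P - pderiv P)) t) (at t)"
proof -
  consider "t < 0" | "t = 0" | "0 < t" by linarith
  then show ?thesis
  proof cases
    case 1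
    have "((\<lambda>_. 0) has_real_derivative 0) (at t)" by simp
    then have "(flat_exp P has_real_derivative 0) (at t)"
      by (rule has_field_derivative_transform_within_open[where S="{..<0}"]) (use 1 in \<open>auto simp: flat_exp_def\<close>)
    then show ?thesis using 1 by (simp add: flat_exp_def)
  next
    case 2
    have "((\<lambda>y. flat_exp P y / y) \<longlongrightarrow> 0) (at_left 0)"
    proof (rule tendsto_eventually)
      show "\<forall>\<^sub>F y in at_left 0. flat_exp P y / y = 0"
        unfolding eventually_at_left_field by (intro exI[of _ "-1"]) (auto simp: flat_exp_def)
    qed
    \<comment> \<open>In terms of \<open>x = inverse y\<close> the quotient is
      \<open>x * poly P x / exp x\<close>. The additional \<open>x\<close> is the
      \<open>pCons 0\<close>, and the exponential beats every polynomial.\<close>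
    moreover have "((\<lambda>y. flat_exp P y / y) \<longlongrightarrow> 0) (at_right 0)"
    proof (rule Lim_transform_eventually)
      show "((\<lambda>y. poly (pCons 0 P) (inverse y) / exp (inverse y)) \<longlongrightarrow> 0) (at_right (0::real))"
        by (rule filterlim_compose[OF poly_div_exp_tendsto_0 filterlim_inverse_at_top_right])
      show "\<forall>\<^sub>F y in at_right 0. poly (pCons 0 P) (inverse y) / exp (inverse y) = flat_exp P y / y"
        unfolding eventually_at_right_field
        by (intro exI[of _ 1]) (auto simp: flat_exp_def exp_minus field_simps)
    qed
    ultimately have "((\<lambda>y. flat_exp P y / y) \<longlongrightarrow> 0) (at 0)"
      by (simp add: filterlim_at_split)
    then have "(flat_exp P has_real_derivative 0) (at 0)"
      by (simp add: has_field_derivative_iff flat_exp_def)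
    then show ?thesis using 2 by (simp add: flat_exp_def)
  next
    case 3
    have "((\<lambda>t. poly P (1 / t) * exp (- (1 / t))) has_real_derivative
      poly ([:0, 0, 1:] * (P - pderiv P)) (1 / t) * exp (- (1 / t))) (at t)"
      using 3 by (auto intro!: derivative_eq_intros simp: field_simps power2_eq_square)
    then have "(flat_exp P has_real_derivative poly ([:0, 0, 1:] * (P - pderiv P)) (1 / t) * exp (- (1 / t))) (at t)"
      by (rule has_field_derivative_transform_within_open[where S="{0<..}"]) (use 3 in \<open>auto simp: flat_exp_def\<close>)
    then show ?thesis using 3 by (simp add: flat_exp_def)
  qed
qed

text \<open>An algebra of functions that is closed under directional derivatives and contains
  \<open>x \<mapsto> exp (- 1 / (r\<^sup>2 - |x|\<^sup>2))\<close>.\<close>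

inductive bump_alg :: "real \<Rightarrow> (real ^ 'n \<Rightarrow> real) \<Rightarrow> bool" for r where
  const: "bump_alg r (\<lambda>x. c)"
| inner: "bump_alg r (\<lambda>x. x \<bullet> v)"
| flat: "bump_alg r (\<lambda>x. flat_exp P (r\<^sup>2 - x \<bullet> x))"
| add: "bump_alg r f \<Longrightarrow> bump_alg r g \<Longrightarrow> bump_alg r (\<lambda>x. f x + g x)"
| mult: "bump_alg r f \<Longrightarrow> bump_alg r g \<Longrightarrow> bump_alg r (\<lambda>x. f x * g x)"

text \<open>The derivative comes as a map whose value in every fixed direction is again in the
  algebra; this is the shape that the recursion of \<open>Ck\<close> consumes.\<close>

lemma bump_alg_derivative:
  assumes "bump_alg r f"
  shows "\<exists>f'. (\<forall>x. (f has_derivative f' x) (at x)) \<and> (\<forall>v. bump_alg r (\<lambda>x. f' x v))"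
  using assms
proof induction
  case (const c)
  have "\<forall>x. ((\<lambda>x. c) has_derivative (\<lambda>h. 0)) (at x)" by simp
  then show ?case using bump_alg.const[of r 0] by (intro exI[of _ "\<lambda>x h. 0"]) blast
next
  case (inner v)
  have "((\<lambda>x. x \<bullet> v) has_derivative (\<lambda>h. h \<bullet> v)) (at x)" for x
    by (intro derivative_eq_intros) auto
  moreover have "bump_alg r (\<lambda>x. h \<bullet> v)" for h by (rule bump_alg.const)
  ultimately show ?case by (intro exI[of _ "\<lambda>x h. h \<bullet> v"]) blast
next
  case (flat P)
  let ?Q = "[:0, 0, 1:] * (P - pderiv P)"
  have "((\<lambda>x. flat_exp P (r\<^sup>2 - x \<bullet> x)) has_derivative (\<lambda>h. flat_exp ?Q (r\<^sup>2 - x \<bullet> x) * ((- 2) * (x \<bullet> h)))) (at x)" for x :: "real ^ 'n"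
  proof -
    have "((\<lambda>x. r\<^sup>2 - x \<bullet> x) has_derivative (\<lambda>h. (- 2) * (x \<bullet> h))) (at x)"
      by (auto intro!: derivative_eq_intros simp: inner_commute)
    moreover have "(flat_exp P has_derivative (\<lambda>t. flat_exp ?Q (r\<^sup>2 - x \<bullet> x) * t)) (at (r\<^sup>2 - x \<bullet> x))"
      using flat_exp_has_derivative by (simp add: has_field_derivative_def)
    ultimately show ?thesis by (rule has_derivative_compose)
  qed
  moreover have "bump_alg r (\<lambda>x. flat_exp ?Q (r\<^sup>2 - x \<bullet> x) * ((- 2) * (x \<bullet> h)))" for h :: "real ^ 'n"
    by (intro bump_alg.intros)
  ultimately show ?case by (intro exI[of _ "\<lambda>x h. flat_exp ?Q (r\<^sup>2 - x \<bullet> x) * ((- 2) * (x \<bullet> h))"]) blast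
next
  case (add f g)
  then obtain f' g' where "\<And>x. (f has_derivative f' x) (at x)" "\<And>v. bump_alg r (\<lambda>x. f' x v)"
    "\<And>x. (g has_derivative g' x) (at x)" "\<And>v. bump_alg r (\<lambda>x. g' x v)" by blast
  then have "\<forall>x. ((\<lambda>x. f x + g x) has_derivative (\<lambda>h. f' x h + g' x h)) (at x)"
    "\<forall>v. bump_alg r (\<lambda>x. f' x v + g' x v)"
    by (auto intro: has_derivative_add bump_alg.intros)
  then show ?case by (intro exI[of _ "\<lambda>x h. f' x h + g' x h"]) blast
next
  case (mult f g)
  then obtain f' g' where D: "\<And>x. (f has_derivative f' x) (at x)" "\<And>v. bump_alg r (\<lambda>x. f' x v)"
    "\<And>x. (g has_derivative g' x) (at x)" "\<And>v. bump_alg r (\<lambda>x. g' x v)" by blast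
  have "\<forall>x. ((\<lambda>x. f x * g x) has_derivative (\<lambda>h. f x * g' x h + f' x h * g x)) (at x)"
    by (intro allI has_derivative_mult D)
  moreover have "\<forall>v. bump_alg r (\<lambda>x. f x * g' x v + f' x v * g x)"
    by (intro allI bump_alg.add[OF bump_alg.mult[OF mult.hyps(1) D(4)] bump_alg.mult[OF D(2) mult.hyps(2)]])
  ultimately show ?case by (intro exI[of _ "\<lambda>x h. f x * g' x h + f' x h * g x"]) blast
qed

lemma bump_alg_Ck: "bump_alg r f \<Longrightarrow> Ck k f"
proof (induction k arbitrary: f)
  case 0
  from bump_alg_derivative[OF 0] have "f differentiable_on UNIV"
    unfolding differentiable_on_def differentiable_def by blast
  then show ?case by (simp add: differentiable_imp_continuous_on)
next
  case (Suc k)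
  from bump_alg_derivative[OF Suc.prems] obtain f'
    where f': "\<And>x. (f has_derivative f' x) (at x)" "\<And>v. bump_alg r (\<lambda>x. f' x v)" by blast
  have "frechet_derivative f (at x) = f' x" for x
    using frechet_derivative_at[OF f'(1)] by simp
  then show ?case using f' Suc.IH by (auto simp: differentiable_def)
qed

text \<open>The bump \<open>b\<close> is positive exactly on the open ball of radius
  \<open>d\<close> and is at most 1, so its integral is positive and finite and can be
  normalised.\<close>

lemma smooth_mollifier_exists:
  assumes d: "0 < d"
  obtains \<phi> :: "real ^ 'n \<Rightarrow> real" where "\<And>k. Ck k \<phi>" "\<And>z. 0 \<le> \<phi> z" "\<And>z. d \<le> norm z \<Longrightarrow> \<phi> z = 0"
    "(\<integral>\<^sup>+z. ennreal (\<phi> z) \<partial>lborel) = 1"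
proof -
  define b where "b x = flat_exp 1 (d\<^sup>2 - x \<bullet> x)" for x :: "real ^ 'n"
  have alg: "bump_alg d b" unfolding b_def[abs_def] by (rule bump_alg.flat)
  have "Ck 0 b" by (rule bump_alg_Ck[OF alg])
  then have [measurable]: "b \<in> borel_measurable borel" by (simp add: borel_measurable_continuous_onI)
  have b0: "0 \<le> b x" and b1: "b x \<le> 1" for x by (simp_all add: b_def flat_exp_def)
  have pos_iff: "0 < d\<^sup>2 - x \<bullet> x \<longleftrightarrow> norm x < d" for x :: "real ^ 'n"
    using d norm_lt_square[of x d] by (simp add: power2_norm_eq_inner[symmetric])
  have b_pos: "0 < b x" if "norm x < d" for x
    using that pos_iff[of x] by (simp add: b_def flat_exp_def)
  have b_out: "b x = 0" if "d \<le> norm x" for x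
    using that pos_iff[of x] by (auto simp: b_def flat_exp_def)
  have ball [measurable]: "ball (0 :: real ^ 'n) d \<in> sets borel" by simp
  have "(\<integral>\<^sup>+x. ennreal (b x) \<partial>lborel) \<le> (\<integral>\<^sup>+x. indicator (ball (0 :: real ^ 'n) d) x \<partial>lborel)"
  proof (rule nn_integral_mono)
    fix x show "ennreal (b x) \<le> indicator (ball 0 d) x"
      using ennreal_leI[OF b1[of x]] b_out[of x] by (cases "norm x < d") simp_all
  qed
  also have "\<dots> < \<infinity>" using emeasure_lborel_ball_finite[of "0 :: real ^ 'n" d] by simp
  finally have fin: "(\<integral>\<^sup>+x. ennreal (b x) \<partial>lborel) < \<infinity>" .
  have "(\<integral>\<^sup>+x. ennreal (b x) \<partial>lborel) \<noteq> 0"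
  proof
    assume "(\<integral>\<^sup>+x. ennreal (b x) \<partial>lborel) = 0"
    then have "AE x in lborel. ennreal (b x) = 0" by (subst (asm) nn_integral_0_iff_AE) measurable
    \<comment> \<open>As \<open>b\<close> is positive on the ball, a vanishing integral would make
      the ball a null set.\<close>
    then have "AE x in lborel. x \<notin> ball (0 :: real ^ 'n) d"
      by eventually_elim (use b_pos in \<open>force simp: ennreal_eq_0_iff\<close>)
    then have "emeasure lborel (ball (0 :: real ^ 'n) d) = 0"
      by (subst (asm) AE_iff_measurable[of "ball 0 d"]) auto
    moreover have "0 < measure lborel (ball (0 :: real ^ 'n) d)" by (rule content_ball_pos[OF d])
    ultimately show False by (simp add: measure_def)
  qed
  with fin obtain c where c: "(\<integral>\<^sup>+x. ennreal (b x) \<partial>lborel) = ennreal c" "0 < c"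
    by (cases "\<integral>\<^sup>+x. ennreal (b x) \<partial>lborel") auto
  show ?thesis
  proof (rule that[of "\<lambda>x. (1 / c) * b x"])
    show "Ck k (\<lambda>x. 1 / c * b x)" for k
      by (rule bump_alg_Ck[OF bump_alg.mult[OF bump_alg.const alg]])
    have "(\<integral>\<^sup>+x. ennreal (1 / c * b x) \<partial>lborel) = ennreal (1 / c) * (\<integral>\<^sup>+x. ennreal (b x) \<partial>lborel)"
      using c(2) b0 by (subst nn_integral_cmult[symmetric]) (simp_all add: ennreal_mult[symmetric])
    also have "\<dots> = 1" using c by (simp add: ennreal_mult[symmetric])
    finally show "(\<integral>\<^sup>+x. ennreal (1 / c * b x) \<partial>lborel) = 1" .
  qed (use b0 b_out c in simp_all)
qed

text \<open>Compact support is recorded by an explicit radius, which is easy to follow through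
  differentiation and convolution; closures appear only in the conversion to and from
  \<open>test_functions\<close>.\<close>

definition smooth_supported :: "real \<Rightarrow> (real ^ 'n \<Rightarrow> real) \<Rightarrow> bool" where
  "smooth_supported R f \<longleftrightarrow> (\<forall>k. Ck k f) \<and> (\<forall>x. R \<le> norm x \<longrightarrow> f x = 0)"

lemma smooth_supported_has_derivative:
  "smooth_supported R f \<Longrightarrow> (f has_derivative frechet_derivative f (at x)) (at x)"
  unfolding smooth_supported_def using Ck.simps(2)[of 0 f] by (auto simp: frechet_derivative_works[symmetric])

lemma smooth_supported_continuous: "smooth_supported R f \<Longrightarrow> continuous_on UNIV f"
  unfolding smooth_supported_def using Ck.simps(1)[of f] by blast

text \<open>The margin 1 provides an open set: a point with \<open>R + 1 \<le> norm x\<close> lies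
  in the complement of \<open>cball 0 R\<close>, on which \<open>f\<close> is identically 0.\<close>

lemma smooth_supported_derivative:
  assumes "smooth_supported R f"
  shows "smooth_supported (R + 1) (\<lambda>x. frechet_derivative f (at x) v)"
  unfolding smooth_supported_def
proof (intro conjI allI impI)
  show "Ck k (\<lambda>x. frechet_derivative f (at x) v)" for k
    using assms Ck.simps(2)[of k f] by (simp add: smooth_supported_def del: Ck.simps)
  fix x :: "real ^ 'a" assume x: "R + 1 \<le> norm x"
  have "((\<lambda>x. 0) has_derivative (\<lambda>h. 0)) (at x)" by simp
  then have "(f has_derivative (\<lambda>h. 0)) (at x)"
  proof (rule has_derivative_transform_within_open[where s="- cball 0 R"])
    show "0 = f y" if "y \<in> - cball 0 R" for y using assms that by (simp add: smooth_supported_def)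
  qed (use x in auto)
  from frechet_derivative_at[OF this] show "frechet_derivative f (at x) v = 0" by metis
qed

lemma smooth_supported_bounded:
  assumes "smooth_supported R f"
  obtains B where "0 \<le> B" "\<And>x. \<bar>f x\<bar> \<le> B"
proof -
  have "compact (f ` cball 0 R)"
    by (intro compact_continuous_image continuous_on_subset[OF smooth_supported_continuous[OF assms]]) auto
  then have "bounded (f ` cball 0 R)" by (rule compact_imp_bounded)
  then obtain B where "\<forall>x\<in>cball 0 R. \<bar>f x\<bar> \<le> B" by (auto simp: bounded_iff)
  then have B: "\<And>x. norm x \<le> R \<Longrightarrow> \<bar>f x\<bar> \<le> B" by simp
  show ?thesis
  proof (rule that[of "max 0 B"])
    show "\<bar>f x\<bar> \<le> max 0 B" for x
      using B[of x] assms by (cases "norm x \<le> R") (auto simp: smooth_supported_def)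
  qed simp
qed

text \<open>Every directional derivative is again smooth with bounded support, hence bounded. The
  finitely many basis directions give a bound that is uniform in the point and linear in
  \<open>h\<close>, and the mean value inequality turns it into a Lipschitz estimate.\<close>

lemma smooth_supported_lipschitz:
  assumes f: "smooth_supported R f"
  obtains L where "0 \<le> L" "\<And>x h. \<bar>frechet_derivative f (at x) h\<bar> \<le> L * norm h"
    "\<And>x y. \<bar>f x - f y\<bar> \<le> L * norm (x - y)"
proof -
  have "\<forall>b. \<exists>B. \<forall>x. \<bar>frechet_derivative f (at x) b\<bar> \<le> B"
    using smooth_supported_bounded[OF smooth_supported_derivative[OF f]] by metis
  then obtain B where B: "\<And>b x. \<bar>frechet_derivative f (at x) b\<bar> \<le> B b" by metis
  define L where "L = (\<Sum>b\<in>Basis. B b)"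
  have B0: "0 \<le> B b" for b using B[of 0 b] by linarith
  have L0: "0 \<le> L" unfolding L_def by (intro sum_nonneg B0)
  have L: "\<bar>frechet_derivative f (at x) h\<bar> \<le> L * norm h" for x h
  proof -
    interpret D: bounded_linear "frechet_derivative f (at x)"
      by (rule has_derivative_bounded_linear[OF smooth_supported_has_derivative[OF f]])
    have "frechet_derivative f (at x) h = frechet_derivative f (at x) (\<Sum>b\<in>Basis. (h \<bullet> b) *\<^sub>R b)"
      by (simp only: euclidean_representation)
    also have "\<dots> = (\<Sum>b\<in>Basis. (h \<bullet> b) * frechet_derivative f (at x) b)"
      by (simp add: D.sum D.scaleR)
    also have "\<bar>\<dots>\<bar> \<le> (\<Sum>b\<in>Basis. norm h * B b)"
      by (rule order_trans[OF sum_abs]) (auto simp: abs_mult intro!: sum_mono mult_mono B Basis_le_norm)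
    also have "\<dots> = L * norm h" by (simp add: L_def sum_distrib_left mult.commute)
    finally show ?thesis .
  qed
  have "\<bar>f x - f y\<bar> \<le> L * norm (x - y)" for x y
  proof -
    have "norm (f x - f y) \<le> L * norm (x - y)"
    proof (rule differentiable_bound[of UNIV f "\<lambda>x. frechet_derivative f (at x)"])
      show "onorm (frechet_derivative f (at x)) \<le> L" for x
        by (rule onorm_bound[OF L0]) (simp add: L)
    qed (use smooth_supported_has_derivative[OF f] in auto)
    then show ?thesis by simp
  qed
  with L0 L show ?thesis by (rule that)
qed

text \<open>The derivative falls on the smooth factor alone. The remainder quotient of
  \<open>\<psi>\<close> tends to 0 pointwise and is bounded by twice the Lipschitz constant, so
  \<open>2 * L * \<bar>w t\<bar>\<close> is an integrable majorant.\<close>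

lemma convolution_has_derivative:
  fixes w \<psi> :: "real ^ 'n \<Rightarrow> real"
  assumes w: "integrable lborel w" and \<psi>: "smooth_supported R \<psi>"
  shows "((\<lambda>x. \<integral>t. w t * \<psi> (x - t) \<partial>lborel) has_derivative
    (\<lambda>h. \<integral>t. w t * frechet_derivative \<psi> (at (x - t)) h \<partial>lborel)) (at x)"
proof -
  let ?D = "\<lambda>x. frechet_derivative \<psi> (at x)"
  have [measurable]: "w \<in> borel_measurable borel" using w by auto
  have [measurable]: "\<psi> \<in> borel_measurable borel"
    by (rule borel_measurable_continuous_onI[OF smooth_supported_continuous[OF \<psi>]])
  have [measurable]: "(\<lambda>x. ?D x h) \<in> borel_measurable borel" for h
    by (rule borel_measurable_continuous_onI[OF smooth_supported_continuous[OF smooth_supported_derivative[OF \<psi>]]])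
  have Dt [measurable]: "(\<lambda>t. ?D (x - t) h) \<in> borel_measurable borel" for x h
    by (rule measurable_compose[of "\<lambda>t. x - t" borel borel "\<lambda>x. ?D x h"]) measurable
  obtain L where L: "0 \<le> L" "\<And>x h. \<bar>?D x h\<bar> \<le> L * norm h" "\<And>x y. \<bar>\<psi> x - \<psi> y\<bar> \<le> L * norm (x - y)"
    using smooth_supported_lipschitz[OF \<psi>] by blast
  obtain B where B: "\<And>x. \<bar>\<psi> x\<bar> \<le> B" using smooth_supported_bounded[OF \<psi>] by blast
  have int: "integrable lborel (\<lambda>t. w t * g t)"
    if [measurable]: "g \<in> borel_measurable borel" and g: "\<And>t. \<bar>g t\<bar> \<le> C" for g C
  proof (rule Bochner_Integration.integrable_bound[of lborel "\<lambda>t. C * w t"])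
    show "AE t in lborel. norm (w t * g t) \<le> norm (C * w t)"
    proof (intro AE_I2)
      fix t
      have "\<bar>w t\<bar> * \<bar>g t\<bar> \<le> \<bar>w t\<bar> * \<bar>C\<bar>"
        using g[of t] by (intro mult_left_mono) auto
      then show "norm (w t * g t) \<le> norm (C * w t)" by (simp add: abs_mult mult.commute)
    qed
  qed (use w in simp_all)
  have int_\<psi>: "integrable lborel (\<lambda>t. w t * \<psi> (x - t))" for x by (rule int[OF _ B]) measurable
  have int_D: "integrable lborel (\<lambda>t. w t * ?D (x - t) h)" for x h by (rule int[OF Dt L(2)])
  have lin: "bounded_linear (\<lambda>h. \<integral>t. w t * ?D (x - t) h \<partial>lborel)"
  proof (rule bounded_linear_intro)
    have D_linear: "bounded_linear (?D y)" for y
      by (rule has_derivative_bounded_linear[OF smooth_supported_has_derivative[OF \<psi>]])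
    fix h k :: "real ^ 'n" and c :: real
    show "(\<integral>t. w t * ?D (x - t) (h + k) \<partial>lborel) = (\<integral>t. w t * ?D (x - t) h \<partial>lborel) + (\<integral>t. w t * ?D (x - t) k \<partial>lborel)"
      by (simp add: linear_add[OF bounded_linear.linear[OF D_linear]] distrib_left int_D)
    show "(\<integral>t. w t * ?D (x - t) (c *\<^sub>R h) \<partial>lborel) = c *\<^sub>R (\<integral>t. w t * ?D (x - t) h \<partial>lborel)"
      by (simp add: linear_scale[OF bounded_linear.linear[OF D_linear]] mult.left_commute[of "w _" c])
    have "norm (\<integral>t. w t * ?D (x - t) h \<partial>lborel) \<le> (\<integral>t. \<bar>w t\<bar> * (L * norm h) \<partial>lborel)"
    proof (rule order_trans[OF integral_norm_bound])
      show "(\<integral>t. norm (w t * ?D (x - t) h) \<partial>lborel) \<le> (\<integral>t. \<bar>w t\<bar> * (L * norm h) \<partial>lborel)"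
      proof (rule integral_mono)
        show "integrable lborel (\<lambda>t. norm (w t * ?D (x - t) h))" by (rule integrable_norm[OF int_D])
        show "integrable lborel (\<lambda>t. \<bar>w t\<bar> * (L * norm h))" using w by (intro integrable_mult_left) auto
        show "norm (w t * ?D (x - t) h) \<le> \<bar>w t\<bar> * (L * norm h)" for t
          using L(2)[of "x - t" h] by (simp add: abs_mult mult_left_mono)
      qed
    qed
    also have "\<dots> = norm h * (L * (\<integral>t. \<bar>w t\<bar> \<partial>lborel))" by simp
    finally show "norm (\<integral>t. w t * ?D (x - t) h \<partial>lborel) \<le> norm h * (L * (\<integral>t. \<bar>w t\<bar> \<partial>lborel))" .
  qed
  have "((\<lambda>y. norm ((\<integral>t. w t * \<psi> (y - t) \<partial>lborel) - (\<integral>t. w t * \<psi> (x - t) \<partial>lborel) - (\<integral>t. w t * ?D (x - t) (y - x) \<partial>lborel))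
     / norm (y - x)) \<longlongrightarrow> 0) (at x)"
    unfolding tendsto_at_iff_sequentially comp_def
  proof (intro allI impI)
    \<comment> \<open>The limit is tested along sequences, to which dominated convergence
      applies.\<close>
    fix X :: "nat \<Rightarrow> real ^ 'n" assume X: "\<forall>i. X i \<in> UNIV - {x}" "X \<longlonglongrightarrow> x"
    define r where "r i t = (\<psi> (X i - t) - \<psi> (x - t) - ?D (x - t) (X i - x)) / norm (X i - x)" for i t
    have [measurable]: "r i \<in> borel_measurable borel" for i unfolding r_def[abs_def] by measurable
    have r_lim: "(\<lambda>i. r i t) \<longlonglongrightarrow> 0" for t
    proof -
      have "((\<lambda>y. norm (\<psi> y - \<psi> (x - t) - ?D (x - t) (y - (x - t))) / norm (y - (x - t))) \<longlongrightarrow> 0) (at (x - t))"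
        using smooth_supported_has_derivative[OF \<psi>, of "x - t"] unfolding has_derivative_iff_norm by blast
      moreover have "\<forall>i. X i - t \<in> UNIV - {x - t}" "(\<lambda>i. X i - t) \<longlonglongrightarrow> x - t"
        using X by (auto intro: tendsto_diff)
      ultimately have "(\<lambda>i. norm (\<psi> (X i - t) - \<psi> (x - t) - ?D (x - t) (X i - x)) / norm (X i - x)) \<longlonglongrightarrow> 0"
        unfolding tendsto_at_iff_sequentially comp_def by fastforce
      then have "(\<lambda>i. \<bar>r i t\<bar>) \<longlonglongrightarrow> 0" by (simp add: r_def)
      then show ?thesis by (rule tendsto_rabs_zero_cancel)
    qed
    have r_bound: "\<bar>r i t\<bar> \<le> 2 * L" for i t
    proof -
      have ne: "0 < norm (X i - x)" using X(1) by auto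
      have "\<bar>\<psi> (X i - t) - \<psi> (x - t) - ?D (x - t) (X i - x)\<bar> \<le> 2 * L * norm (X i - x)"
        using L(3)[of "X i - t" "x - t"] L(2)[of "x - t" "X i - x"] by simp
      then show ?thesis using ne by (simp add: r_def field_simps)
    qed
    have "(\<lambda>i. \<integral>t. w t * r i t \<partial>lborel) \<longlonglongrightarrow> (\<integral>t. 0 \<partial>(lborel :: (real ^ 'n) measure))"
    proof (rule integral_dominated_convergence[where w="\<lambda>t. 2 * L * \<bar>w t\<bar>"])
      show "AE t in lborel. (\<lambda>i. w t * r i t) \<longlonglongrightarrow> 0"
        using tendsto_mult[OF tendsto_const r_lim] by (intro AE_I2) fastforce
      show "AE t in lborel. norm (w t * r i t) \<le> 2 * L * \<bar>w t\<bar>" for i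
        using r_bound by (intro AE_I2) (simp add: abs_mult mult.commute[of "\<bar>w _\<bar>"] mult_right_mono)
    qed (use w in simp_all)
    then have "(\<lambda>i. \<integral>t. w t * r i t \<partial>lborel) \<longlonglongrightarrow> 0" by simp
    then have lim: "(\<lambda>i. norm (\<integral>t. w t * r i t \<partial>lborel)) \<longlonglongrightarrow> 0"
      by (rule tendsto_norm_zero)
    have "(\<integral>t. w t * r i t \<partial>lborel) = ((\<integral>t. w t * \<psi> (X i - t) \<partial>lborel) - (\<integral>t. w t * \<psi> (x - t) \<partial>lborel)
       - (\<integral>t. w t * ?D (x - t) (X i - x) \<partial>lborel)) / norm (X i - x)" for i
    proof -
      have "w t * r i t = (w t * \<psi> (X i - t) - w t * \<psi> (x - t) - w t * ?D (x - t) (X i - x)) / norm (X i - x)" for t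
        by (simp add: r_def algebra_simps)
      then have "(\<integral>t. w t * r i t \<partial>lborel) =
         (\<integral>t. w t * \<psi> (X i - t) - w t * \<psi> (x - t) - w t * ?D (x - t) (X i - x) \<partial>lborel) / norm (X i - x)"
        by simp
      then show ?thesis by (simp add: int_\<psi> int_D)
    qed
    with lim show "(\<lambda>i. norm ((\<integral>t. w t * \<psi> (X i - t) \<partial>lborel) - (\<integral>t. w t * \<psi> (x - t) \<partial>lborel) -
       (\<integral>t. w t * ?D (x - t) (X i - x) \<partial>lborel)) / norm (X i - x)) \<longlonglongrightarrow> 0"
      by simp
  qed
  then show ?thesis unfolding has_derivative_iff_norm using lin by blast
qed

text \<open>The induction runs over all \<open>\<psi>\<close> and \<open>R\<close> at once: a
  directional derivative of the convolution is the convolution with that derivative of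
  \<open>\<psi>\<close>, whose recorded radius is \<open>R + 1\<close>.\<close>

lemma convolution_Ck:
  assumes w: "integrable lborel w"
  shows "smooth_supported R \<psi> \<Longrightarrow> Ck k (\<lambda>x. \<integral>t. w t * \<psi> (x - t) \<partial>lborel)"
proof (induction k arbitrary: R \<psi>)
  case 0
  have "(\<lambda>x. \<integral>t. w t * \<psi> (x - t) \<partial>lborel) differentiable_on UNIV"
    unfolding differentiable_on_def differentiable_def using convolution_has_derivative[OF w 0] by blast
  then show ?case by (simp add: differentiable_imp_continuous_on)
next
  case (Suc k)
  note D = convolution_has_derivative[OF w Suc.prems]
  have "frechet_derivative (\<lambda>x. \<integral>t. w t * \<psi> (x - t) \<partial>lborel) (at x) = (\<lambda>h. \<integral>t. w t * frechet_derivative \<psi> (at (x - t)) h \<partial>lborel)" for x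
    using frechet_derivative_at[OF D] by simp
  moreover have "Ck k (\<lambda>x. \<integral>t. w t * frechet_derivative \<psi> (at (x - t)) h \<partial>lborel)" for h
    by (rule Suc.IH[OF smooth_supported_derivative[OF Suc.prems]])
  ultimately show ?case using D by (auto simp: differentiable_def)
qed

section \<open>Test functions as smooth functions with a support radius\<close>

lemma smooth_supported_test_function:
  assumes "smooth_supported R f"
  shows "f \<in> test_functions"
proof -
  have "bounded {x. f x \<noteq> 0}"
    using assms unfolding smooth_supported_def bounded_iff by (metis (mono_tags) linear mem_Collect_eq)
  then show ?thesis using assms by (simp add: test_functions_def smooth_supported_def del: Ck.simps)
qed

lemma test_function_smooth_supported:
  fixes f :: "real ^ 'n \<Rightarrow> real"
  assumes "f \<in> test_functions"
  obtains R where "1 \<le> R" "smooth_supported R f"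
proof -
  have "bounded {x. f x \<noteq> 0}" using assms by (simp add: test_functions_def)
  then obtain R where R: "\<And>x. f x \<noteq> 0 \<Longrightarrow> norm x \<le> R" by (auto simp: bounded_iff)
  \<comment> \<open>Points of norm exactly \<open>R\<close> may carry nonzero values, hence
    \<open>R + 1\<close>; the maximum secures the lower bound 1.\<close>
  have "smooth_supported (max 1 (R + 1)) f"
    unfolding smooth_supported_def
  proof (intro conjI allI impI)
    fix x :: "real ^ 'n" assume "max 1 (R + 1) \<le> norm x"
    then show "f x = 0" using R[of x] by (cases "f x = 0") auto
  qed (use assms in \<open>simp add: test_functions_def del: Ck.simps\<close>)
  then show ?thesis by (rule that[rotated]) simp
qed

text \<open>A reflection makes \<open>v\<close> the integrable weight and \<open>\<phi>\<close> the
  translated factor, so that differentiation meets only the smooth function.\<close>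

lemma mollification_test_function:
  fixes v \<phi> :: "real ^ 'n \<Rightarrow> real"
  assumes v [measurable]: "v \<in> borel_measurable borel" and M: "\<And>x. \<bar>v x\<bar> \<le> M"
    and R: "\<And>x. R \<le> norm x \<Longrightarrow> v x = 0" and \<phi>: "smooth_supported d \<phi>"
  shows "(\<lambda>x. \<integral>z. \<phi> z * v (x - z) \<partial>lborel) \<in> test_functions"
proof -
  have [measurable]: "\<phi> \<in> borel_measurable borel"
    by (rule borel_measurable_continuous_onI[OF smooth_supported_continuous[OF \<phi>]])
  have int: "integrable lborel v"
  proof (rule integrableI_bounded_set[of "cball 0 R" _ _ M])
    show "emeasure lborel (cball (0 :: real ^ 'n) R) < \<infinity>" by (rule emeasure_lborel_cball_finite)
    have "v x = 0" if "x \<notin> cball 0 R" for x using that R[of x] by simp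
    then show "AE x in lborel. x \<notin> cball 0 R \<longrightarrow> v x = 0" by simp
  qed (use M in simp_all)
  have eq: "(\<integral>z. \<phi> z * v (x - z) \<partial>lborel) = (\<integral>t. v t * \<phi> (x - t) \<partial>lborel)" for x
  proof -
    have "(\<integral>t. v t * \<phi> (x - t) \<partial>lborel) = (\<integral>t. v t * \<phi> (x - t) \<partial>distr lborel borel (\<lambda>z. x - z))"
      by (simp only: lborel_distr_reflect)
    also have "\<dots> = (\<integral>z. v (x - z) * \<phi> (x - (x - z)) \<partial>lborel)"
      by (subst integral_distr) simp_all
    finally show ?thesis by (simp add: mult.commute)
  qed
  have "smooth_supported (R + d) (\<lambda>x. \<integral>z. \<phi> z * v (x - z) \<partial>lborel)"
    unfolding smooth_supported_def
  proof (intro conjI allI impI)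
    show "Ck k (\<lambda>x. \<integral>z. \<phi> z * v (x - z) \<partial>lborel)" for k
      unfolding eq by (rule convolution_Ck[OF int \<phi>])
    fix x :: "real ^ 'n" assume x: "R + d \<le> norm x"
    \<comment> \<open>A nonzero product would need \<open>norm z < d\<close> and
      \<open>norm (x - z) < R\<close>, hence \<open>norm x < R + d\<close>.\<close>
    have zero: "\<phi> z * v (x - z) = 0" for z
    proof (cases "d \<le> norm z")
      case True
      then show ?thesis using \<phi> by (simp add: smooth_supported_def)
    next
      case False
      have "norm x \<le> norm (x - z) + norm z" using norm_triangle_ineq[of "x - z" z] by simp
      then show ?thesis using R[of "x - z"] x False by simp
    qed
    show "(\<integral>z. \<phi> z * v (x - z) \<partial>lborel) = 0" by (simp only: zero Bochner_Integration.integral_zero)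
  qed
  then show ?thesis by (rule smooth_supported_test_function)
qed

section \<open>Density of test functions\<close>

lemma ennpowr_le:
  assumes "x \<le> ennreal (t powr r)" "0 < t" "0 < r"
  shows "ennpowr x (1 / r) \<le> ennreal t"
proof -
  have "x < top" using assms(1) by (simp add: le_less_trans[OF _ ennreal_less_top])
  then obtain y where y: "x = ennreal y" "0 \<le> y" by (cases x) auto
  then have "y \<le> t powr r" using assms(1) by (simp add: ennreal_le_iff)
  then have "y powr (1 / r) \<le> (t powr r) powr (1 / r)" using y assms(3) by (intro powr_mono2) auto
  also have "\<dots> = t" using assms(2,3) by (simp add: powr_powr)
  finally show ?thesis using y by (simp add: ennpowr_def ennreal_leI)
qed

lemma ennpowr_less_infinity_iff: "ennpowr x r < \<infinity> \<longleftrightarrow> x < \<infinity>"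
  by (simp add: ennpowr_def less_top[symmetric])

text \<open>A countable cover for \<open>lborel\<close> remains one for its completion. The result
  gives access to Tonelli's theorem on \<open>lebesgue \<Otimes>\<^sub>M lebesgue\<close>.\<close>

lemma sigma_finite_lebesgue: "sigma_finite_measure (lebesgue :: 'a::euclidean_space measure)"
proof
  obtain A :: "'a set set" where A: "countable A" "A \<subseteq> sets lborel" "\<Union>A = space lborel" "\<forall>a\<in>A. emeasure lborel a \<noteq> \<infinity>"
    using lborel.sigma_finite_countable by blast
  then show "\<exists>A::'a set set. countable A \<and> A \<subseteq> sets lebesgue \<and> \<Union> A = space lebesgue \<and> (\<forall>a\<in>A. emeasure lebesgue a \<noteq> \<infinity>)"
    by (intro exI[of _ A]) (auto simp: emeasure_completion subset_eq)
qed

text \<open>The product of the completed measures lives on a larger sigma-algebra than the product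
  of the Borel measures, so the double integrals are compared through iterated ones, a variable at a
  time: completion does not change a single integral, and \<open>u\<close> is replaced by
  \<open>u'\<close> almost everywhere in the inner variable and then in the outer one.
  \<open>F\<close> abstracts the integrand together with its measurability, which has to hold for
  both products.\<close>

lemma lebesgue_pair_integral_eq_lborel:
  fixes u u' :: "'a::euclidean_space \<Rightarrow> real" and F :: "real \<Rightarrow> real \<Rightarrow> 'a \<Rightarrow> 'a \<Rightarrow> ennreal"
  assumes u: "u \<in> borel_measurable lebesgue" and u' [measurable]: "u' \<in> borel_measurable borel"
    and ae: "AE x in lborel. u x = u' x"
    and F: "\<And>(M :: ('a \<times> 'a) measure) f g h k. f \<in> borel_measurable M \<Longrightarrow> g \<in> borel_measurable M \<Longrightarrow> h \<in> M \<rightarrow>\<^sub>M borel \<Longrightarrow> k \<in> M \<rightarrow>\<^sub>M borel \<Longrightarrow>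
        (\<lambda>z. F (f z) (g z) (h z) (k z)) \<in> borel_measurable M"
  shows "(\<integral>\<^sup>+(x, y). F (u x) (u y) x y \<partial>(lebesgue \<Otimes>\<^sub>M lebesgue)) =
    (\<integral>\<^sup>+z. F (u' (fst z)) (u' (snd z)) (fst z) (snd z) \<partial>(lborel \<Otimes>\<^sub>M lborel))"
proof -
  interpret L: sigma_finite_measure "lebesgue :: 'a measure" by (rule sigma_finite_lebesgue)
  have id: "(\<lambda>x. x) \<in> lebesgue \<rightarrow>\<^sub>M (borel :: 'a measure)"
    by (rule measurable_completion) simp
  have "(\<lambda>z. F (u (fst z)) (u (snd z)) (fst z) (snd z)) \<in> borel_measurable (lebesgue \<Otimes>\<^sub>M lebesgue)"
    by (intro F measurable_compose[OF measurable_fst u] measurable_compose[OF measurable_snd u]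
        measurable_compose[OF measurable_fst id] measurable_compose[OF measurable_snd id])
  then have "(\<integral>\<^sup>+(x, y). F (u x) (u y) x y \<partial>(lebesgue \<Otimes>\<^sub>M lebesgue)) = (\<integral>\<^sup>+x. \<integral>\<^sup>+y. F (u x) (u y) x y \<partial>lebesgue \<partial>lebesgue)"
    by (subst L.nn_integral_fst[symmetric]) (simp_all add: split_beta')
  also have "\<dots> = (\<integral>\<^sup>+x. \<integral>\<^sup>+y. F (u x) (u y) x y \<partial>lborel \<partial>lborel)"
    by (simp only: nn_integral_completion)
  also have "\<dots> = (\<integral>\<^sup>+x. \<integral>\<^sup>+y. F (u x) (u' y) x y \<partial>lborel \<partial>lborel)"
  proof (rule nn_integral_cong, rule nn_integral_cong_AE)
    show "AE y in lborel. F (u x) (u y) x y = F (u x) (u' y) x y" for x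
      using ae by eventually_elim simp
  qed
  also have "\<dots> = (\<integral>\<^sup>+x. \<integral>\<^sup>+y. F (u' x) (u' y) x y \<partial>lborel \<partial>lborel)"
  proof (rule nn_integral_cong_AE)
    show "AE x in lborel. (\<integral>\<^sup>+y. F (u x) (u' y) x y \<partial>lborel) = (\<integral>\<^sup>+y. F (u' x) (u' y) x y \<partial>lborel)"
      using ae by eventually_elim simp
  qed
  also have "\<dots> = (\<integral>\<^sup>+z. F (u' (fst z)) (u' (snd z)) (fst z) (snd z) \<partial>(lborel \<Otimes>\<^sub>M lborel))"
    by (rule lborel_pair_integral_iterated[symmetric, of "\<lambda>x y. F (u' x) (u' y) x y"]) (intro F; measurable)
  finally show ?thesis .
qed

context weighted_sobolev
begin

lemma test_function_approximation:
  assumes u: "u \<in> borel_measurable borel" and fin: "energy u < \<infinity>" "mass u < \<infinity>" and e: "0 < e"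
  obtains f where "f \<in> test_functions" "energy (\<lambda>x. u x - f x) \<le> ennreal e" "mass (\<lambda>x. u x - f x) \<le> ennreal e"
proof -
  let ?e = "e / (2 * 2 powr q)"
  have e': "0 < ?e" using e by simp
  obtain v M \<rho> R where v: "v \<in> borel_measurable borel" and M: "\<And>x. \<bar>v x\<bar> \<le> M"
    and \<rho>R: "0 < \<rho>" "0 < R" "\<And>x. norm x \<le> \<rho> \<Longrightarrow> v x = 0" "\<And>x. R \<le> norm x \<Longrightarrow> v x = 0"
    and v_fin: "energy v < \<infinity>"
    and uv: "energy (\<lambda>x. u x - v x) \<le> ennreal ?e" "mass (\<lambda>x. u x - v x) \<le> ennreal ?e"
    by (rule approx_bounded_annular[OF u fin e']) blast
  note \<rho> = \<rho>R(1,3) and R = \<rho>R(2,4)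
  obtain d where d: "0 < d" and
    small: "\<And>\<phi>. \<phi> \<in> borel_measurable borel \<Longrightarrow> (\<And>z. 0 \<le> \<phi> z) \<Longrightarrow> (\<integral>\<^sup>+z. ennreal (\<phi> z) \<partial>lborel) = 1 \<Longrightarrow>
      (\<And>z. d \<le> norm z \<Longrightarrow> \<phi> z = 0) \<Longrightarrow>
      energy (\<lambda>x. (\<integral>z. \<phi> z * v (x - z) \<partial>lborel) - v x) \<le> ennreal ?e \<and>
      mass (\<lambda>x. (\<integral>z. \<phi> z * v (x - z) \<partial>lborel) - v x) \<le> ennreal ?e"
    using mollification_small[OF v M \<rho> R v_fin e'] by blast
  obtain \<phi> :: "real ^ 'n \<Rightarrow> real" where \<phi>: "\<And>k. Ck k \<phi>" "\<And>z. 0 \<le> \<phi> z" "\<And>z. d \<le> norm z \<Longrightarrow> \<phi> z = 0"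
    "(\<integral>\<^sup>+z. ennreal (\<phi> z) \<partial>lborel) = 1"
    using smooth_mollifier_exists[OF d] by blast
  have smooth: "smooth_supported d \<phi>" using \<phi> by (simp add: smooth_supported_def del: Ck.simps)
  have \<phi>_meas: "\<phi> \<in> borel_measurable borel"
    by (rule borel_measurable_continuous_onI[OF smooth_supported_continuous[OF smooth]])
  let ?f = "\<lambda>x. \<integral>z. \<phi> z * v (x - z) \<partial>lborel"
  have f: "?f \<in> borel_measurable borel"
    by (rule mollification_measurable[OF v M \<phi>_meas \<phi>(2,4,3)])
  have vf: "energy (\<lambda>x. v x - ?f x) \<le> ennreal ?e" "mass (\<lambda>x. v x - ?f x) \<le> ennreal ?e"
    using small[OF \<phi>_meas \<phi>(2,4,3)] energy_diff_commute[of v ?f] mass_diff_commute[of v ?f] by simp_all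
  show ?thesis
  proof (rule that)
    show "?f \<in> test_functions" by (rule mollification_test_function[OF v M R(2) smooth])
    show "energy (\<lambda>x. u x - ?f x) \<le> ennreal e" by (rule energy_diff_le[OF u v f e uv(1) vf(1)])
    show "mass (\<lambda>x. u x - ?f x) \<le> ennreal e" by (rule mass_diff_le[OF u v f e uv(2) vf(2)])
  qed
qed

text \<open>Finite energy is another instance of the cutoff estimate: for the constant
  \<open>D\<close> as \<open>g\<close> and \<open>f x / D\<close> as cutoff, the commutator
  integrand is the energy density of \<open>f\<close>. Finite mass follows from boundedness and the
  local integrability of the weight.\<close>

lemma test_function_finite:
  assumes "f \<in> test_functions"
  shows "f \<in> borel_measurable borel" "energy f < \<infinity>" "mass f < \<infinity>"
proof -
  obtain R where R: "1 \<le> R" and f: "smooth_supported R f"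
    using test_function_smooth_supported[OF assms] by blast
  then have R0: "0 < R" by simp
  show f_meas [measurable]: "f \<in> borel_measurable borel"
    by (rule borel_measurable_continuous_onI[OF smooth_supported_continuous[OF f]])
  obtain B where B: "0 \<le> B" "\<And>x. \<bar>f x\<bar> \<le> B" using smooth_supported_bounded[OF f] by blast
  obtain L where L: "0 \<le> L" "\<And>x y. \<bar>f x - f y\<bar> \<le> L * norm (x - y)"
    using smooth_supported_lipschitz[OF f] by metis
  \<comment> \<open>By \<open>2 * B \<le> D\<close> the differences of \<open>f x / D\<close> are at
    most 1, and by \<open>L * R \<le> D\<close> its Lipschitz constant is at most
    \<open>1 / R\<close>; the summand 1 keeps \<open>D\<close> positive.\<close>
  define D where "D = 2 * B + L * R + 1"
  have LR: "0 \<le> L * R" using L(1) R0 by simp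
  have D: "0 < D" "2 * B \<le> D" "L * R \<le> D" using B(1) LR unfolding D_def by linarith+
  have lip: "\<bar>f x / D - f y / D\<bar> \<le> min 1 (norm (x - y) / R)" for x y
  proof -
    have "\<bar>f x / D - f y / D\<bar> = \<bar>f x - f y\<bar> / D" using D(1) by (simp add: diff_divide_distrib[symmetric])
    moreover have "\<bar>f x - f y\<bar> / D \<le> 1"
    proof -
      have "\<bar>f x - f y\<bar> \<le> D" using B(2)[of x] B(2)[of y] D(2) by linarith
      then show ?thesis using D(1) by simp
    qed
    moreover have "\<bar>f x - f y\<bar> / D \<le> norm (x - y) / R"
    proof -
      have "\<bar>f x - f y\<bar> * R \<le> L * norm (x - y) * R" using L(2) R0 by (intro mult_right_mono) auto
      also have "\<dots> = (L * R) * norm (x - y)" by simp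
      also have "\<dots> \<le> D * norm (x - y)" using D(3) by (intro mult_right_mono) auto
      finally show ?thesis using D(1) R0 by (simp add: field_simps)
    qed
    ultimately show ?thesis by simp
  qed
  have out: "f x / D = 0" if "2 * R \<le> norm x" for x
    using that R0 f by (simp add: smooth_supported_def)
  obtain C where C: "0 \<le> C"
    "\<And>R g \<eta>. 0 < R \<Longrightarrow> g \<in> borel_measurable borel \<Longrightarrow> \<eta> \<in> borel_measurable borel \<Longrightarrow>
      (\<And>x y. \<bar>\<eta> x - \<eta> y\<bar> \<le> min 1 (norm (x - y) / R)) \<Longrightarrow> (\<And>x. 2 * R \<le> norm x \<Longrightarrow> \<eta> x = 0) \<Longrightarrow>
      (\<integral>\<^sup>+z. ennreal (\<bar>min \<bar>g (fst z)\<bar> \<bar>g (snd z)\<bar> * (\<eta> (fst z) - \<eta> (snd z))\<bar> powr p * ker (fst z) (snd z)) \<partial>(lborel \<Otimes>\<^sub>M lborel))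
      \<le> ennreal (C * R powr (- (s * p))) *
         (\<integral>\<^sup>+x. ennreal (\<bar>g x\<bar> powr p / norm x powr (2 * a)) * indicator {x. norm x < 2 * R} x \<partial>lborel)"
    using cutoff_energy by blast
  obtain C' where C': "0 \<le> C'"
    "\<And>R g M. 0 < R \<Longrightarrow> (\<And>x. \<bar>g x\<bar> \<le> M) \<Longrightarrow>
     (\<integral>\<^sup>+x. ennreal (\<bar>g x\<bar> powr p / norm (x :: real ^ 'n) powr (2 * a)) * indicator {x. norm x < R} x \<partial>lborel)
       \<le> ennreal (M powr p * (C' * R powr (N - 2 * a)))"
    using weighted_power_near by blast
  have "energy f = (\<integral>\<^sup>+z. ennreal (\<bar>min \<bar>D\<bar> \<bar>D\<bar> * (f (fst z) / D - f (snd z) / D)\<bar> powr p * ker (fst z) (snd z)) \<partial>(lborel \<Otimes>\<^sub>M lborel))"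
    unfolding energy_def using D(1) by (simp add: right_diff_distrib)
  also have "\<dots> \<le> ennreal (C * R powr (- (s * p))) *
      (\<integral>\<^sup>+x. ennreal (\<bar>D\<bar> powr p / norm (x :: real ^ 'n) powr (2 * a)) * indicator {x. norm x < 2 * R} x \<partial>lborel)"
    by (rule C(2)[of R "\<lambda>_. D" "\<lambda>x. f x / D", OF R0 _ _ lip out]) simp_all
  also have "\<dots> \<le> ennreal (C * R powr (- (s * p))) * ennreal (D powr p * (C' * (2 * R) powr (N - 2 * a)))"
    using R0 D(1) by (intro mult_left_mono C'(2)) simp_all
  also have "\<dots> < \<infinity>" by (simp add: ennreal_mult_less_top)
  finally show "energy f < \<infinity>" .
  let ?b = "2 * a * q / p"
  have "?b < real DIM(real ^ 'n)" unfolding DIM_N by (rule mass_exponent)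
  then obtain C1 where C1: "0 \<le> C1"
    "\<And>r. 0 < r \<Longrightarrow> (\<integral>\<^sup>+x. ennreal (1 / norm (x :: real ^ 'n) powr ?b) * indicator {x. norm x < r} x \<partial>lborel)
        \<le> ennreal (C1 * r powr (N - ?b))"
    using nn_integral_norm_powr_near[where 'a="real ^ 'n"] unfolding DIM_N by blast
  have pt: "ennreal (\<bar>f x\<bar> powr q / norm x powr ?b) \<le>
      ennreal (B powr q) * (ennreal (1 / norm x powr ?b) * indicator {x. norm x < R} x)" for x
  proof (cases "norm x < R")
    case True
    have "\<bar>f x\<bar> powr q / norm x powr ?b \<le> B powr q * (1 / norm x powr ?b)"
      using B(2)[of x] q_gt by (simp add: divide_right_mono powr_mono2)
    then show ?thesis using True by (simp add: ennreal_mult[symmetric] ennreal_leI)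
  next
    case False
    then have "f x = 0" using f by (simp add: smooth_supported_def)
    then show ?thesis by simp
  qed
  have "mass f \<le> ennreal (B powr q) * (\<integral>\<^sup>+x. ennreal (1 / norm (x :: real ^ 'n) powr ?b) * indicator {x. norm x < R} x \<partial>lborel)"
    unfolding mass_def by (rule order_trans[OF nn_integral_mono[OF pt]]) (subst nn_integral_cmult, measurable)
  also have "\<dots> \<le> ennreal (B powr q) * ennreal (C1 * R powr (N - ?b))"
    by (intro mult_left_mono C1(2) R0) simp
  also have "\<dots> < \<infinity>" by (simp add: ennreal_mult_less_top)
  finally show "mass f < \<infinity>" .
qed

lemma gagliardo_eq_energy:
  fixes u u' :: "real ^ 'n \<Rightarrow> real"
  assumes "u \<in> borel_measurable lebesgue" "u' \<in> borel_measurable borel" "AE x in lborel. u x = u' x"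
  shows "gagliardo s p a u = ennpowr (energy u') (1 / p)"
  unfolding gagliardo_def energy_def N[symmetric]
  using lebesgue_pair_integral_eq_lborel[OF assms, of "\<lambda>t t' x y. ennreal (\<bar>t - t'\<bar> powr p * ker x y)"]
  by (simp add: ker_def mult.assoc)

lemma weighted_norm_eq_mass:
  fixes u u' :: "real ^ 'n \<Rightarrow> real"
  assumes ae: "AE x in lborel. u x = u' x"
  shows "weighted_norm s p a u = ennpowr (mass u') (1 / q)"
proof -
  have "crit_exp CARD('n) s p = q" unfolding crit_exp_def q_def N[symmetric] ..
  moreover have "(\<integral>\<^sup>+x. ennreal (\<bar>u x\<bar> powr q / norm x powr (2 * a * q / p)) \<partial>lebesgue) = mass u'"
    unfolding mass_def nn_integral_completion
    by (rule nn_integral_cong_AE) (use ae in eventually_elim, simp)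
  ultimately show ?thesis by (simp add: weighted_norm_def Let_def)
qed

lemma test_function_in_W_dot:
  fixes f :: "real ^ 'n \<Rightarrow> real"
  assumes f: "f \<in> test_functions"
  shows "f \<in> W_dot s p a"
proof -
  have "f \<in> borel_measurable lebesgue"
    using test_function_finite(1)[OF f] by (simp add: measurable_completion)
  then show ?thesis
    using test_function_finite[OF f] gagliardo_eq_energy[of f f] weighted_norm_eq_mass[of f f]
    by (simp add: W_dot_def W_tilde_def L_crit_def ennpowr_less_infinity_iff[unfolded infinity_ennreal_def])
qed

lemma W_dot_approximation:
  fixes u :: "real ^ 'n \<Rightarrow> real"
  assumes u: "u \<in> W_dot s p a" and \<delta>: "0 < \<delta>"
  obtains f where "f \<in> test_functions" "W_norm s p a (\<lambda>x. u x - f x) < \<delta>"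
proof -
  have u_meas: "u \<in> borel_measurable lebesgue" and fin: "gagliardo s p a u < \<infinity>" "weighted_norm s p a u < \<infinity>"
    using u by (simp_all add: W_dot_def W_tilde_def L_crit_def)
  obtain u' where u' [measurable]: "u' \<in> borel_measurable borel" and ae: "AE x in lborel. u x = u' x"
    using completion_ex_borel_measurable_real[OF u_meas] by auto
  have fin': "energy u' < \<infinity>" "mass u' < \<infinity>"
    using fin by (simp_all only: gagliardo_eq_energy[OF u_meas u' ae] weighted_norm_eq_mass[OF ae] ennpowr_less_infinity_iff)
  \<comment> \<open>Each of the two seminorms gets the allowance \<open>t\<close>;
    \<open>\<delta>\<close> may be infinite, and then 1 serves.\<close>
  obtain t where t: "0 < t" "ennreal (t + t) < \<delta>"
  proof (cases \<delta>)
    case (real r)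
    then show ?thesis using that[of "r / 4"] \<delta> by (auto simp: ennreal_lessI)
  qed (use that[of 1] in simp)
  \<comment> \<open>The minimum brings both the \<open>p\<close>-th and the \<open>q\<close>-th root
    down to at most \<open>t\<close>.\<close>
  obtain f where f: "f \<in> test_functions"
    and le: "energy (\<lambda>x. u' x - f x) \<le> ennreal (min (t powr p) (t powr q))" "mass (\<lambda>x. u' x - f x) \<le> ennreal (min (t powr p) (t powr q))"
    using test_function_approximation[OF u' fin', of "min (t powr p) (t powr q)"] t(1) by auto
  have f_meas [measurable]: "f \<in> borel_measurable borel" by (rule test_function_finite(1)[OF f])
  have f_leb: "f \<in> borel_measurable lebesgue" by (simp add: measurable_completion)
  have diff: "(\<lambda>x. u x - f x) \<in> borel_measurable lebesgue" by (rule borel_measurable_diff[OF u_meas f_leb])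
  have diff': "(\<lambda>x. u' x - f x) \<in> borel_measurable borel" by measurable
  have ae': "AE x in lborel. u x - f x = u' x - f x" using ae by eventually_elim simp
  have "gagliardo s p a (\<lambda>x. u x - f x) \<le> ennreal t"
    unfolding gagliardo_eq_energy[OF diff diff' ae']
    using p t(1) by (intro ennpowr_le order_trans[OF le(1)] ennreal_leI) auto
  moreover have "weighted_norm s p a (\<lambda>x. u x - f x) \<le> ennreal t"
    unfolding weighted_norm_eq_mass[OF ae']
    using q_gt t(1) by (intro ennpowr_le order_trans[OF le(2)] ennreal_leI) auto
  ultimately have "W_norm s p a (\<lambda>x. u x - f x) \<le> ennreal t + ennreal t"
    unfolding W_norm_def by (rule add_mono)
  also have "\<dots> = ennreal (t + t)" using t(1) by (intro ennreal_plus[symmetric]) simp_all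
  also have "\<dots> < \<delta>" by (rule t(2))
  finally show ?thesis by (rule that[OF f])
qed

end

theorem theorem1p1:
  fixes s p a :: real
  assumes "0 < s" "s < 1"
    and "1 < p"
    and "0 \<le> a" "a < (real CARD('n) - s * p) / 2"
  shows "(\<forall>u \<in> (W_dot s p a :: (real ^ 'n \<Rightarrow> real) set).
           \<exists>U :: real \<Rightarrow> real ^ 'n \<Rightarrow> real.
             (\<forall>\<epsilon>>0. U \<epsilon> \<in> test_functions) \<and>
             ((\<lambda>\<epsilon>. W_norm s p a (\<lambda>x. u x - U \<epsilon> x)) \<longlongrightarrow> 0) (at_right 0))
       \<and> (test_functions :: (real ^ 'n \<Rightarrow> real) set) \<subseteq> W_dot s p a
       \<and> (\<forall>u \<in> (W_dot s p a :: (real ^ 'n \<Rightarrow> real) set). \<forall>\<delta>>0.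
           \<exists>\<phi> \<in> test_functions. W_norm s p a (\<lambda>x. u x - \<phi> x) < \<delta>)"
proof -
  interpret weighted_sobolev s p a "real CARD('n)" "TYPE('n)"
    by unfold_locales (use assms in auto)
  have "\<exists>U :: real \<Rightarrow> real ^ 'n \<Rightarrow> real. (\<forall>\<epsilon>>0. U \<epsilon> \<in> test_functions) \<and>
      ((\<lambda>\<epsilon>. W_norm s p a (\<lambda>x. u x - U \<epsilon> x)) \<longlongrightarrow> 0) (at_right 0)"
    if u: "u \<in> (W_dot s p a :: (real ^ 'n \<Rightarrow> real) set)" for u
  proof -
    \<comment> \<open>The index is the error itself and not a mollification scale: for each positive
      \<open>\<epsilon>\<close> some test function with error below \<open>\<epsilon>\<close> is
      picked.\<close>
    have "\<forall>\<epsilon>. \<exists>f. 0 < \<epsilon> \<longrightarrow> f \<in> test_functions \<and> W_norm s p a (\<lambda>x. u x - f x) < ennreal \<epsilon>"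
      using W_dot_approximation[OF u] by (metis ennreal_0 ennreal_lessI)
    then obtain U where U: "\<And>\<epsilon>. 0 < \<epsilon> \<Longrightarrow> U \<epsilon> \<in> test_functions"
      "\<And>\<epsilon>. 0 < \<epsilon> \<Longrightarrow> W_norm s p a (\<lambda>x. u x - U \<epsilon> x) < ennreal \<epsilon>" by metis
    have "((\<lambda>\<epsilon>. W_norm s p a (\<lambda>x. u x - U \<epsilon> x)) \<longlongrightarrow> 0) (at_right 0)"
    proof (rule tendsto_ennreal_zeroI)
      fix e :: real assume e: "0 < e"
      have "W_norm s p a (\<lambda>x. u x - U \<epsilon> x) \<le> ennreal e" if "0 < \<epsilon>" "\<epsilon> < e" for \<epsilon>
        using U(2)[OF that(1)] ennreal_leI[of \<epsilon> e] that by (metis less_imp_le order_trans)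
      then show "\<forall>\<^sub>F \<epsilon> in at_right 0. W_norm s p a (\<lambda>x. u x - U \<epsilon> x) \<le> ennreal e"
        unfolding eventually_at_right_field using e by blast
    qed
    with U(1) show ?thesis by blast
  qed
  moreover have "\<exists>\<phi>\<in>test_functions. W_norm s p a (\<lambda>x. u x - \<phi> x) < \<delta>"
    if "u \<in> (W_dot s p a :: (real ^ 'n \<Rightarrow> real) set)" "0 < \<delta>" for u \<delta>
    using W_dot_approximation[OF that] by blast
  ultimately show ?thesis using test_function_in_W_dot by blast
qed

end
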